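(* Let $d\ge2$ be cube-free, $d=ab^2$ with $a>b\ge1$ squarefree and coprime, $L=\mathbb{Q}(\sqrt[3]{d})$, with ramification invariant $R$ and subfield unit index $Q$. Let $\Theta=(\theta_j)_{j\in\mathbb{Z}}$ be the chain of lattice minima of $\mathcal{O}_L$ with primitive period length $\ell\ge1$. Then: (1) If $d\equiv 0,\pm3\pmod 9$: $L$ is of type $\alpha$ iff $Q=1$; $L$ is of type $\beta$ iff there is $1\le j\le\ell-1$ with $N_{L/\mathbb{Q}}(\theta_j)\mid R^2$; $L$ is of type $\gamma$ iff $N_{L/\mathbb{Q}}(\theta_j)\nmid R^2$ for all $1\le j\le\ell-1$ and $Q=3$. (2) If $d\equiv\pm2,\pm4\pmod 9$: $L$ is of type $\alpha$ iff $Q=1$; $L$ is of type $\beta$ iff either there is $1\le j\le\ell-1$ with $N_{L/\mathbb{Q}}(\theta_j)\mid R^2$ or $Q=3$; and $L$ is never of type $\gamma$. (3) If $d\equiv\pm1\pmod 9$, let $\Phi=(\phi_j)_{j\in\mathbb{Z}}$ be the chain of lattice minima of the order $\mathcal{O}_{L,0}=\mathbb{Z}\oplus\mathbb{Z}\delta\oplus\mathbb{Z}\bar\delta$ with primitive period length $\ell_0\ge1$. Then $L$ is of type $\alpha$ iff $Q=1$; $L$ is of type $\beta$ iff there is $1\le j\le\ell_0-1$ with $N_{L/\mathbb{Q}}(\phi_j)\mid R^2$; $L$ is of type $\gamma$ iff $N_{L/\mathbb{Q}}(\phi_j)\nmid R^2$ for all $1\le j\le\ell_0-1$ and $Q=3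$.
   Context: Notation: $L\subset\mathbb{R}$, $\delta=\sqrt[3]{d}$, $\bar\delta=\sqrt[3]{a^2b}$ (real roots), $\zeta_3$ a primitive cube root of unity, $\mathit{k}_0=\mathbb{Q}(\zeta_3)$, $\mathit{k}=L(\zeta_3)$, $\sigma$ the generator of $\mathrm{Gal}(\mathit{k}/\mathit{k}_0)$ with $\sigma(\delta)=\zeta_3\delta$; $L'=\sigma(L)$, $L''=\sigma^2(L)$. $\mathcal{O}_L$ is the maximal order, $E_L$ its units. Ramification invariant: $R=ab$ if $d\equiv\pm1\pmod9$; $R=3ab$ if $d\equiv\pm2,\pm4\pmod9$; $R=ab$ if $3\mid ab$. Subfield unit index: $Q=[E_{\mathit{k}}:E_0]$, where $E_{\mathit{k}}$ is the unit group of $\mathit{k}$ and $E_0$ the subgroup generated by the units of $\mathit{k}_0$, $L$, $L'$, $L''$. Lattice minima: for $\alpha\in L$, $\alpha'=\sigma(\alpha)$, $\alpha''=\sigma^2(\alpha)$. For an order $\mathcal{O}\subseteq\mathcal{O}_L$, $\alpha\in\mathcal{O}$ with $\alpha>0$ is a lattice minimum if every $\beta\in\mathcal{O}$ with $\beta'\beta''<\alpha'\alpha''$ and $0\le\beta<\alpha$ is $0$. The lattice minima form a discrete subset of the positive reals; the chain of lattice minima is their enumeration $(\theta_j)_{j\in\mathbb{Z}}$ in increasing order with $\theta_0=1$, and the primitive period length is the index $\ell\ge1$ with $\theta_\ell$ equal to the smallest unit $>1$ of the order. Principal factors and types: a principal factor is $\alpha\in\mathcal{O}_L$ with $\sigma(\alpha\mathcal{O}_{\mathit{k}})=\alpha\mathcal{O}_{\mathit{k}}$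 and $\alpha\mathcal{O}_L\not\subseteq m\mathcal{O}_L$ for every integer $m>1$; it is non-trivial if it does not lie in the subgroup of $L^\times$ generated by $E_L$, $\mathbb{Q}^\times$ and $\delta$. $L$ is of type $\beta$ if it has a non-trivial principal factor; of type $\gamma$ if it is not of type $\beta$ and there is a unit $Z\in E_{\mathit{k}}$ with $N_{\mathit{k}/\mathit{k}_0}(Z)=\zeta_3$; of type $\alpha$ otherwise. *)

theory Defs
  imports "HOL-Analysis.Analysis" "HOL-Computational_Algebra.Computational_Algebra"
begin

text \<open>
  A pure cubic field is a set of real numbers; its normal closure lives in the complex numbers.
  Elements and subsets of the former enter the latter through \<^const>\<open>complex_of_real\<close>.
\<close>

section \<open>Subfields, integers and units\<close>

definition is_subfield :: "'a::field set \<Rightarrow> bool" where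
  "is_subfield K \<longleftrightarrow> 1 \<in> K \<and> (\<forall>x\<in>K. \<forall>y\<in>K. x - y \<in> K \<and> x * y \<in> K) \<and>
     (\<forall>x\<in>K. inverse x \<in> K)"

definition field_adjoin :: "'a::field set \<Rightarrow> 'a set" where
  "field_adjoin S = \<Inter>{K. is_subfield K \<and> S \<subseteq> K}"

definition maximal_order :: "'a::field set \<Rightarrow> 'a set" where
  "maximal_order K = {x \<in> K. algebraic_int x}"

definition ring_units :: "'a::field set \<Rightarrow> 'a set" where
  "ring_units A = {u \<in> A. \<exists>v\<in>A. u * v = 1}"

definition mult_subgroup_generated :: "'a::field set \<Rightarrow> 'a set" where
  "mult_subgroup_generated S =
     \<Inter>{H. 1 \<in> H \<and> (\<forall>x\<in>H. \<forall>y\<in>H. x * y \<in> H) \<and> (\<forall>x\<in>H. inverse x \<in> H) \<and> S \<subseteq> H}"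

text \<open>As with \<^const>\<open>card\<close>, an infinite index is \<open>0\<close>.\<close>

definition mult_index :: "'a::field set \<Rightarrow> 'a set \<Rightarrow> nat" where
  "mult_index G H = card ((\<lambda>g. (*) g ` H) ` G)"

definition principal_ideal :: "'a::field set \<Rightarrow> 'a \<Rightarrow> 'a set" where
  "principal_ideal A x = (*) x ` A"

text \<open>Automorphisms of \<open>K\<close> over \<open>F\<close>; their values outside \<open>K\<close> are arbitrary.\<close>

definition galois_group :: "'a::field set \<Rightarrow> 'a set \<Rightarrow> ('a \<Rightarrow> 'a) set" where
  "galois_group K F = {\<sigma>. bij_betw \<sigma> K K \<and>
     (\<forall>x\<in>K. \<forall>y\<in>K. \<sigma> (x + y) = \<sigma> x + \<sigma> y \<and> \<sigma> (x * y) = \<sigma> x * \<sigma> y) \<and>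
     (\<forall>x\<in>F. \<sigma> x = x)}"


section \<open>Pure cubic fields\<close>

definition cubefree :: "nat \<Rightarrow> bool" where
  "cubefree n \<longleftrightarrow> (\<forall>p. prime p \<longrightarrow> \<not> p ^ 3 dvd n)"

definition delta :: "nat \<Rightarrow> real" where
  "delta d = root 3 (real d)"

definition delta_bar :: "nat \<Rightarrow> nat \<Rightarrow> real" where
  "delta_bar a b = root 3 (real (a\<^sup>2 * b))"

definition pure_cubic :: "nat \<Rightarrow> real set" where
  "pure_cubic d = field_adjoin {delta d}"

definition cyclotomic3 :: "complex \<Rightarrow> complex set" where
  "cyclotomic3 \<zeta> = field_adjoin {\<zeta>}"

definition normal_closure :: "nat \<Rightarrow> complex \<Rightarrow> complex set" where
  "normal_closure d \<zeta> = field_adjoin (insert \<zeta> (complex_of_real ` pure_cubic d))"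

text \<open>The order spanned over the integers by \<open>1\<close>, \<^const>\<open>delta\<close> and \<^const>\<open>delta_bar\<close>.\<close>

definition order0 :: "nat \<Rightarrow> nat \<Rightarrow> nat \<Rightarrow> real set" where
  "order0 d a b = {of_int x + of_int y * delta d + of_int z * delta_bar a b | x y z. True}"

definition ram_invariant :: "nat \<Rightarrow> nat \<Rightarrow> nat \<Rightarrow> nat" where
  "ram_invariant d a b = (if d mod 9 \<in> {2, 4, 5, 7} then 3 * a * b else a * b)"

definition subfield_unit_index :: "nat \<Rightarrow> complex \<Rightarrow> (complex \<Rightarrow> complex) \<Rightarrow> nat" where
  "subfield_unit_index d \<zeta> \<sigma> =
    (let L = complex_of_real ` pure_cubic d; E = (\<lambda>K. ring_units (maximal_order K)) in
     mult_index (E (normal_closure d \<zeta>))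
       (mult_subgroup_generated (E (cyclotomic3 \<zeta>) \<union> E L \<union> E (\<sigma> ` L) \<union> E (\<sigma> ` \<sigma> ` L))))"

text \<open>The relative norm from the normal closure to \<^const>\<open>cyclotomic3\<close>. As \<open>\<sigma>\<close> maps the pure
  cubic field \<open>L\<close> to its three conjugates, on \<open>L\<close> this is the norm to the rationals.\<close>

definition rel_norm :: "(complex \<Rightarrow> complex) \<Rightarrow> complex \<Rightarrow> complex" where
  "rel_norm \<sigma> z = z * \<sigma> z * \<sigma> (\<sigma> z)"

definition norm_dvd :: "(complex \<Rightarrow> complex) \<Rightarrow> real \<Rightarrow> int \<Rightarrow> bool" where
  "norm_dvd \<sigma> x m \<longleftrightarrow> (\<exists>n::int. rel_norm \<sigma> (complex_of_real x) = of_int n \<and> n dvd m)"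


section \<open>Lattice minima\<close>

text \<open>For \<open>x\<close> in a pure cubic field, \<open>\<sigma> x\<close> and \<open>\<sigma> (\<sigma> x)\<close> are complex conjugates, so that
  their product is real. \<^const>\<open>Re\<close> only makes it comparable.\<close>

definition conj_prod :: "(complex \<Rightarrow> complex) \<Rightarrow> real \<Rightarrow> real" where
  "conj_prod \<sigma> x = Re (\<sigma> (complex_of_real x) * \<sigma> (\<sigma> (complex_of_real x)))"

definition lattice_minima :: "(complex \<Rightarrow> complex) \<Rightarrow> real set \<Rightarrow> real set" where
  "lattice_minima \<sigma> A = {\<alpha> \<in> A. 0 < \<alpha> \<and>
     (\<forall>\<beta>\<in>A. conj_prod \<sigma> \<beta> < conj_prod \<sigma> \<alpha> \<and> 0 \<le> \<beta> \<and> \<beta> < \<alpha> \<longrightarrow> \<beta> = 0)}"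

definition chain_of_minima :: "(complex \<Rightarrow> complex) \<Rightarrow> real set \<Rightarrow> (int \<Rightarrow> real) \<Rightarrow> bool" where
  "chain_of_minima \<sigma> A \<theta> \<longleftrightarrow> strict_mono \<theta> \<and> range \<theta> = lattice_minima \<sigma> A \<and> \<theta> 0 = 1"

definition primitive_period_length :: "real set \<Rightarrow> (int \<Rightarrow> real) \<Rightarrow> nat \<Rightarrow> bool" where
  "primitive_period_length A \<theta> l \<longleftrightarrow> 1 \<le> l \<and>
     \<theta> (int l) \<in> ring_units A \<and> 1 < \<theta> (int l) \<and>
     (\<forall>u\<in>ring_units A. 1 < u \<longrightarrow> \<theta> (int l) \<le> u)"


section \<open>Principal factors and types\<close>

definition principal_factor :: "nat \<Rightarrow> complex \<Rightarrow> (complex \<Rightarrow> complex) \<Rightarrow> real \<Rightarrow> bool" where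
  "principal_factor d \<zeta> \<sigma> \<alpha> \<longleftrightarrow>
    (let OL = maximal_order (pure_cubic d); Ok = maximal_order (normal_closure d \<zeta>) in
     \<alpha> \<in> OL \<and>
     \<sigma> ` principal_ideal Ok (complex_of_real \<alpha>) = principal_ideal Ok (complex_of_real \<alpha>) \<and>
     (\<forall>m::int. m > 1 \<longrightarrow> \<not> principal_ideal OL \<alpha> \<subseteq> principal_ideal OL (of_int m)))"

definition nontrivial_principal_factor ::
    "nat \<Rightarrow> complex \<Rightarrow> (complex \<Rightarrow> complex) \<Rightarrow> real \<Rightarrow> bool" where
  "nontrivial_principal_factor d \<zeta> \<sigma> \<alpha> \<longleftrightarrow> principal_factor d \<zeta> \<sigma> \<alpha> \<and>
     \<alpha> \<notin> mult_subgroup_generated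
       (ring_units (maximal_order (pure_cubic d)) \<union> (\<rat> - {0}) \<union> {delta d})"

definition type_beta :: "nat \<Rightarrow> complex \<Rightarrow> (complex \<Rightarrow> complex) \<Rightarrow> bool" where
  "type_beta d \<zeta> \<sigma> \<longleftrightarrow> (\<exists>\<alpha>. nontrivial_principal_factor d \<zeta> \<sigma> \<alpha>)"

definition type_gamma :: "nat \<Rightarrow> complex \<Rightarrow> (complex \<Rightarrow> complex) \<Rightarrow> bool" where
  "type_gamma d \<zeta> \<sigma> \<longleftrightarrow> \<not> type_beta d \<zeta> \<sigma> \<and>
     (\<exists>Z \<in> ring_units (maximal_order (normal_closure d \<zeta>)). rel_norm \<sigma> Z = \<zeta>)"

definition type_alpha :: "nat \<Rightarrow> complex \<Rightarrow> (complex \<Rightarrow> complex) \<Rightarrow> bool" where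
  "type_alpha d \<zeta> \<sigma> \<longleftrightarrow> \<not> type_beta d \<zeta> \<sigma> \<and> \<not> type_gamma d \<zeta> \<sigma>"

end

theory Submission
  imports Defs "Jordan_Normal_Form.Char_Poly"
begin

text \<open>
  An element \<open>\<alpha>\<close> of \<open>L\<close> generates an ideal invariant under \<open>\<sigma>\<close> iff \<open>\<alpha>\<^sup>3\<close> is a unit times its norm.
  Let \<open>\<alpha>\<close> be non-trivial of this kind with least norm, and let \<open>\<beta>\<close> be in the order. By minimality, every
  non-zero component of \<open>\<beta> / \<alpha>\<close> in \<open>\<rat>\<close>, \<open>\<rat>\<delta>\<close> or \<open>\<rat>\<delta>'\<close>, where \<open>\<delta>'\<^sup>3 = a\<^sup>2b\<close>, is at least 1 in absolute
  value. If \<open>\<beta>\<close> is smaller than \<open>\<alpha>\<close> in all absolute values, the components are averages of numbers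
  less than 1 in absolute value, so that \<open>\<beta> = 0\<close>. Hence \<open>\<alpha>\<close> is a lattice minimum; its norm divides \<open>R\<^sup>2\<close>, and
  a unit moves it into the first period. Conversely, if the norm \<open>n\<close> of a lattice minimum \<open>\<alpha>\<close> divides
  \<open>R\<^sup>2\<close>, then \<open>\<alpha>\<^sup>3 / n\<close> is integral by ramification and thus a unit; and \<open>\<alpha>\<close> is non-trivial or a unit because \<open>\<delta>\<close>
  and \<open>\<delta>'\<close> exceed 1 in all absolute values.

  For the unit index, measure a unit \<open>w\<close> of the normal closure by the exponents of the fundamental unit
  in the squared absolute values of the conjugates of \<open>w\<close>. The difference of two of them is a
  homomorphism to the integers, and the group generated by the units of the subfields is the preimage
  of the multiples of 3; so \<open>Q\<close> is 1 or 3. By Hilbert's Theorem 90, a unit outside of that group comes from a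
  non-trivial invariant ideal unless its relative norm is, up to sign, a power of \<open>\<zeta>\<close> other than 1. A
  congruence modulo a prime divisor of \<open>d\<close> excludes the latter when \<open>d\<close> is not congruent to 0, 1, 3, 6 or 8 modulo 9.
\<close>

section \<open>Algebraic integers\<close>

text \<open>The obstacle is the prime 3. A component g of \<beta> / \<alpha> is one third of a sum
  of conjugates twisted by powers of \<zeta>, so integrality only shows that 27 \<open>nm\<close>
  \<alpha> g^3 is an integer. The factor 27 can be removed if 3 divides d, because the summands of
  the norm form then have distinct 3-adic valuations modulo 3, or if 3 does not divide the norm of
  \<alpha>, because this norm also clears denominators. For d = +-1 mod 9 the second alternative
  holds for every principal factor; the factor itself may have denominators 3, but its square does
  not, and this is where the order \<open>O0\<close> comes in. For d = +-2, +-4 mod 9 neither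
  alternative need hold, so a non-trivial factor may escape the chain, and type \<beta> is read off
  the unit index instead. The index alone cannot separate the types: a non-trivial factor and a unit
  of relative norm \<zeta> both produce a unit outside the group generated by the subfields. Type
  \<alpha> is therefore Q = 1 throughout, while \<beta> and \<gamma> are told apart by the chain or
  by the absence of units of norm \<zeta>.\<close>

interpretation int_module: Modules.module "\<lambda>k x :: 'a::field_char_0. of_int k * x"
  by unfold_locales (auto simp: algebra_simps)

lemma mult_span_closed:
  fixes z :: "'a::field_char_0"
  assumes S: "\<And>s. s \<in> S \<Longrightarrow> z * s \<in> int_module.span S" and "x \<in> int_module.span S"
  shows "z * x \<in> int_module.span S"
  using assms(2)
proof (induction rule: int_module.span_induct_alt)
  case (step k s y)
  have "z * (of_int k * s + y) = of_int k * (z * s) + z * y"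
    by (simp add: algebra_simps)
  then show ?case
    using step S by (simp only:) (intro int_module.span_add int_module.span_scale)
qed (simp add: int_module.span_zero)

text \<open>A number acting on a finitely generated module through an integer matrix is a root of the
  characteristic polynomial of that matrix.\<close>

lemma algebraic_int_int_span:
  fixes z :: "'a::field_char_0"
  assumes "finite S" and "s0 \<in> S" and "s0 \<noteq> 0" and closed: "\<And>s. s \<in> S \<Longrightarrow> z * s \<in> int_module.span S"
  shows "algebraic_int z"
proof -
  obtain n and f :: "nat \<Rightarrow> 'a" where f: "bij_betw f {0..<n} S"
    using ex_bij_betw_nat_finite[OF \<open>finite S\<close>] by auto
  have "\<exists>c. z * s = (\<Sum>t\<in>S. of_int (c t) * t)" if "s \<in> S" for s
    using closed[OF that] by (auto simp: int_module.span_finite[OF \<open>finite S\<close>])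
  then obtain C where C: "\<And>s. s \<in> S \<Longrightarrow> z * s = (\<Sum>t\<in>S. of_int (C s t) * t)"
    using bchoice[of S "\<lambda>s c. z * s = (\<Sum>t\<in>S. of_int (c t) * t)"] by auto
  define A :: "int mat" where "A = mat n n (\<lambda>(i, j). C (f i) (f j))"
  define v where "v = vec n f"
  have A: "A \<in> carrier_mat n n" by (simp add: A_def)
  define B where "B = map_mat (of_int :: int \<Rightarrow> 'a) A"
  have B: "B \<in> carrier_mat n n" using A by (simp add: B_def)
  have fS: "f i \<in> S" if "i < n" for i
    using f that by (auto simp: bij_betw_def)
  have "B *\<^sub>v v = z \<cdot>\<^sub>v v"
  proof (rule eq_vecI)
    show "dim_vec (B *\<^sub>v v) = dim_vec (z \<cdot>\<^sub>v v)" using B by (simp add: v_def)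
    fix i assume "i < dim_vec (z \<cdot>\<^sub>v v)"
    then have i: "i < n" by (simp add: v_def)
    have "vec_index (B *\<^sub>v v) i = (\<Sum>j = 0..<n. of_int (C (f i) (f j)) * f j)"
      using i by (simp add: B_def A_def v_def scalar_prod_def)
    also have "\<dots> = (\<Sum>t\<in>S. of_int (C (f i) t) * t)"
      using sum.reindex_bij_betw[OF f, of "\<lambda>t. of_int (C (f i) t) * t"] by simp
    also have "\<dots> = z * f i" using C[OF fS[OF i]] by simp
    finally show "vec_index (B *\<^sub>v v) i = vec_index (z \<cdot>\<^sub>v v) i"
      using i by (simp add: v_def)
  qed
  moreover have "v \<noteq> 0\<^sub>v n"
  proof
    assume v0: "v = 0\<^sub>v n"
    obtain i where "i < n" "f i = s0"
      using f \<open>s0 \<in> S\<close> by (metis atLeastLessThan_iff bij_betw_iff_bijections)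
    then have "vec_index v i = s0" by (simp add: v_def)
    then show False using v0 \<open>i < n\<close> \<open>s0 \<noteq> 0\<close> by simp
  qed
  ultimately have "eigenvector B v z"
    using B unfolding eigenvector_def by (auto simp: v_def)
  then have "eigenvalue B z" unfolding eigenvalue_def by blast
  then have root: "poly (char_poly B) z = 0"
    using eigenvalue_root_char_poly[OF B] by simp
  have "char_poly B = map_poly of_int (char_poly A)"
    unfolding B_def by (rule of_int_hom.char_poly_hom[OF A])
  moreover have "monic (char_poly A)" using degree_monic_char_poly[OF A] by blast
  ultimately show ?thesis
    using root algebraic_int_altdef_ipoly by metis
qed

text \<open>The monic equation solved for its top power: the powers of x below the degree then span
  a module that multiplication by x preserves.\<close>

lemma algebraic_int_power_reduce:
  fixes x :: "'a::field_char_0"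
  assumes "algebraic_int x"
  obtains m c where "0 < m" and "x ^ m = (\<Sum>i<m. of_int (c i) * x ^ i)"
proof -
  obtain p :: "int poly" where p: "poly (map_poly of_int p) x = 0" "lead_coeff p = 1"
    using assms algebraic_int_altdef_ipoly by blast
  define m where "m = degree p"
  have "0 = (\<Sum>i\<le>m. of_int (coeff p i) * x ^ i)"
    using p by (simp add: poly_altdef m_def degree_map_poly coeff_map_poly)
  also have "\<dots> = (\<Sum>i<m. of_int (coeff p i) * x ^ i) + x ^ m"
    using p(2) by (simp add: m_def flip: lessThan_Suc_atMost)
  finally have eq: "x ^ m = (\<Sum>i<m. of_int (- coeff p i) * x ^ i)"
    by (simp add: eq_neg_iff_add_eq_0 add.commute sum_negf)
  have "m \<noteq> 0"
  proof
    assume "m = 0"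
    then show False using eq by simp
  qed
  then show thesis by (intro that[OF _ eq]) simp
qed

text \<open>The monomials x^i y^j with exponents below the two degrees span a module stable under x
  and under y. It is then stable under x + y and x y as well, which makes these integral.\<close>

lemma algebraic_int_common_module:
  fixes x y :: "'a::field_char_0"
  assumes "algebraic_int x" and "algebraic_int y"
  obtains S where "finite S" and "1 \<in> S"
    and "\<And>s. s \<in> S \<Longrightarrow> x * s \<in> int_module.span S" and "\<And>s. s \<in> S \<Longrightarrow> y * s \<in> int_module.span S"
proof -
  obtain m c where m: "0 < m" and c: "x ^ m = (\<Sum>i<m. of_int (c i) * x ^ i)"
    by (rule algebraic_int_power_reduce[OF assms(1)])
  obtain n e where n: "0 < n" and e: "y ^ n = (\<Sum>j<n. of_int (e j) * y ^ j)"
    by (rule algebraic_int_power_reduce[OF assms(2)])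
  define S where "S = (\<lambda>(i, j). x ^ i * y ^ j) ` ({..<m} \<times> {..<n})"
  have fin: "finite S" by (simp add: S_def)
  have mem: "x ^ i * y ^ j \<in> int_module.span S" if "i < m" "j < n" for i j
    by (rule int_module.span_base) (use that in \<open>auto simp: S_def\<close>)
  show thesis
  proof (rule that[OF fin])
    show "1 \<in> S" unfolding S_def using m n by (auto intro!: image_eqI[of _ _ "(0, 0)"])
  next
    fix s assume "s \<in> S"
    then obtain i j where ij: "i < m" "j < n" "s = x ^ i * y ^ j" by (auto simp: S_def)
    show "x * s \<in> int_module.span S"
    proof (cases "Suc i < m")
      case True
      then show ?thesis using mem[of "Suc i" j] ij by (simp add: mult.assoc)
    next
      case False
      then have "Suc i = m" using ij by simp
      then have "x * s = x ^ m * y ^ j" using ij by (simp add: mult.assoc[symmetric] flip: power_Suc)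
      also have "\<dots> = (\<Sum>k<m. of_int (c k) * (x ^ k * y ^ j))"
        by (simp add: c sum_distrib_right mult.assoc)
      also have "\<dots> \<in> int_module.span S" using ij by (intro int_module.span_sum int_module.span_scale mem) auto
      finally show ?thesis .
    qed
    show "y * s \<in> int_module.span S"
    proof (cases "Suc j < n")
      case True
      then show ?thesis using mem[of i "Suc j"] ij by (simp add: mult.left_commute)
    next
      case False
      then have "Suc j = n" using ij by simp
      then have "y * s = x ^ i * y ^ n"
        using ij by (simp add: mult.left_commute flip: power_Suc)
      also have "\<dots> = (\<Sum>k<n. of_int (e k) * (x ^ i * y ^ k))"
        by (simp add: e sum_distrib_left mult.left_commute)
      also have "\<dots> \<in> int_module.span S" using ij by (intro int_module.span_sum int_module.span_scale mem) auto
      finally show ?thesis .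
    qed
  qed
qed

lemma algebraic_int_add:
  fixes x y :: "'a::field_char_0"
  assumes "algebraic_int x" and "algebraic_int y"
  shows "algebraic_int (x + y)"
proof -
  obtain S where S: "finite S" "1 \<in> S"
    "\<And>s. s \<in> S \<Longrightarrow> x * s \<in> int_module.span S" "\<And>s. s \<in> S \<Longrightarrow> y * s \<in> int_module.span S"
    by (rule algebraic_int_common_module[OF assms]) blast
  show ?thesis
    by (rule algebraic_int_int_span[OF S(1,2)])
       (simp_all add: distrib_right int_module.span_add S(3) S(4))
qed

lemma algebraic_int_mult:
  fixes x y :: "'a::field_char_0"
  assumes "algebraic_int x" and "algebraic_int y"
  shows "algebraic_int (x * y)"
proof -
  obtain S where S: "finite S" "1 \<in> S"
    "\<And>s. s \<in> S \<Longrightarrow> x * s \<in> int_module.span S" "\<And>s. s \<in> S \<Longrightarrow> y * s \<in> int_module.span S"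
    by (rule algebraic_int_common_module[OF assms]) blast
  have "x * y * s \<in> int_module.span S" if "s \<in> S" for s
    using mult_span_closed[OF S(3) S(4)[OF that]] by (simp add: mult.assoc)
  then show ?thesis
    by (rule algebraic_int_int_span[OF S(1,2) one_neq_zero])
qed

lemma algebraic_int_diff:
  fixes x y :: "'a::field_char_0"
  shows "algebraic_int x \<Longrightarrow> algebraic_int y \<Longrightarrow> algebraic_int (x - y)"
  using algebraic_int_add[of x "- y"] by auto

lemma algebraic_int_power:
  fixes x :: "'a::field_char_0"
  shows "algebraic_int x \<Longrightarrow> algebraic_int (x ^ n)"
  by (induction n) (auto intro: algebraic_int_mult)

lemma algebraic_int_of_int [simp]: "algebraic_int (of_int k :: 'a::field_char_0)"
  by (rule int_imp_algebraic_int) simp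

lemma algebraic_int_power_imp:
  fixes x :: "'a::field_char_0"
  assumes "algebraic_int (x ^ n)" and "0 < n"
  shows "algebraic_int x"
  by (rule algebraic_int_root[of "x ^ n" "monom 1 n"])
     (use assms in \<open>auto simp: poly_monom degree_monom_eq\<close>)

lemma cubefreeD: "cubefree n \<Longrightarrow> k ^ 3 dvd n \<Longrightarrow> k = 1"
proof (rule ccontr)
  assume "cubefree n" "k ^ 3 dvd n" "k \<noteq> 1"
  then obtain p where "prime p" "p dvd k" using prime_factor_nat by blast
  then have "p ^ 3 dvd n" using \<open>k ^ 3 dvd n\<close> by (meson dvd_power_same dvd_trans)
  then show False using \<open>prime p\<close> \<open>cubefree n\<close> by (simp add: cubefree_def)
qed

lemma is_subfieldD:
  assumes "is_subfield K"
  shows "1 \<in> K" "0 \<in> K" "x \<in> K \<Longrightarrow> y \<in> K \<Longrightarrow> x - y \<in> K" "x \<in> K \<Longrightarrow> y \<in> K \<Longrightarrow> x * y \<in> K"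
    "x \<in> K \<Longrightarrow> inverse x \<in> K" "x \<in> K \<Longrightarrow> - x \<in> K" "x \<in> K \<Longrightarrow> y \<in> K \<Longrightarrow> x + y \<in> K"
    "x \<in> K \<Longrightarrow> y \<in> K \<Longrightarrow> x / y \<in> K" "x \<in> K \<Longrightarrow> x ^ n \<in> K"
proof -
  show 1: "1 \<in> K" and diff: "\<And>x y. x \<in> K \<Longrightarrow> y \<in> K \<Longrightarrow> x - y \<in> K"
    and mult: "\<And>x y. x \<in> K \<Longrightarrow> y \<in> K \<Longrightarrow> x * y \<in> K" and inv: "\<And>x. x \<in> K \<Longrightarrow> inverse x \<in> K"
    using assms unfolding is_subfield_def by auto
  show 0: "0 \<in> K" using diff[OF 1 1] by simp
  show neg: "\<And>x. x \<in> K \<Longrightarrow> - x \<in> K" using diff[OF 0] by simp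
  show "\<And>x y. x \<in> K \<Longrightarrow> y \<in> K \<Longrightarrow> x + y \<in> K" using diff neg 
    by (metis diff_minus_eq_add)
  show "\<And>x y. x \<in> K \<Longrightarrow> y \<in> K \<Longrightarrow> x / y \<in> K" using mult inv by (simp add: field_class.field_divide_inverse)
  show "x ^ n \<in> K" if "x \<in> K" using that 1 mult by (induction n) auto
qed

lemma is_subfield_of_nat: "is_subfield K \<Longrightarrow> of_nat n \<in> K"
  by (induction n) (auto intro: is_subfieldD)

lemma is_subfield_of_int: "is_subfield K \<Longrightarrow> of_int n \<in> K"
  by (cases n) (auto intro!: is_subfieldD(6) is_subfield_of_nat simp del: of_nat_Suc)

lemma is_subfield_Rats: "is_subfield K \<Longrightarrow> (x :: 'a::field_char_0) \<in> \<rat> \<Longrightarrow> x \<in> K"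
  by (auto elim!: Rats_cases' intro: is_subfieldD(8) is_subfield_of_int)

lemma field_adjoin_least: "is_subfield K \<Longrightarrow> S \<subseteq> K \<Longrightarrow> field_adjoin S \<subseteq> K"
  unfolding field_adjoin_def by blast

lemma field_adjoin_base: "S \<subseteq> field_adjoin S"
  unfolding field_adjoin_def by blast

lemma field_adjoin_subfield: "is_subfield (field_adjoin S)"
  unfolding is_subfield_def field_adjoin_def by auto

lemma is_subfield_rat_real: "is_subfield (\<rat> :: 'a::field_char_0 set)"
  by (simp add: is_subfield_def)

lemma Rats_power_imp_root3:
  assumes "(r :: real) \<in> \<rat>" and "r ^ 3 \<in> \<int>" shows "r \<in> \<int>"
  using assms rational_algebraic_int_is_int algebraic_int_power_imp[of r 3] int_imp_algebraic_int
  by auto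

section \<open>Pure cubic fields\<close>

locale pure_cubic_field =
  fixes d a b :: nat
  assumes d_ge: "d \<ge> 2" and d_cubefree: "cubefree d" and d_eq: "d = a * b\<^sup>2"
    and a_gt_b: "a > b" and b_ge: "b \<ge> 1"
    and squarefree_a: "squarefree a" and squarefree_b: "squarefree b" and coprime_ab: "coprime a b"
begin

abbreviation "D \<equiv> delta d"
abbreviation "E \<equiv> delta_bar a b"
abbreviation "L \<equiv> pure_cubic d"
abbreviation "OL \<equiv> maximal_order L"

text \<open>Coordinates in the basis 1, \<open>D\<close>, \<open>E\<close>. As \<open>E\<close> is
  D^2 / b and \<open>D\<close> is E^2 / a, this basis treats a and b symmetrically and has integral
  structure constants.\<close>

definition el :: "real \<Rightarrow> real \<Rightarrow> real \<Rightarrow> real" where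
  "el x y z = x + y * D + z * E"

text \<open>The norm form in these coordinates. It is polymorphic because the same polynomial is
  evaluated at real, complex and integer arguments.\<close>

definition nf :: "'a::comm_ring_1 \<Rightarrow> 'a \<Rightarrow> 'a \<Rightarrow> 'a" where
  "nf x y z = x ^ 3 + of_nat a * (of_nat b)\<^sup>2 * y ^ 3 + (of_nat a)\<^sup>2 * of_nat b * z ^ 3
     - 3 * of_nat a * of_nat b * x * y * z"

lemma a_ge: "a \<ge> 2" using a_gt_b b_ge by simp

lemma ab_pos: "real a > 0" "real b > 0" using a_ge b_ge by auto

lemma D_cubed: "D ^ 3 = real a * (real b)\<^sup>2"
  by (simp add: delta_def odd_real_root_pow d_eq)

lemma E_cubed: "E ^ 3 = (real a)\<^sup>2 * real b"
  by (simp add: delta_bar_def odd_real_root_pow)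

lemma D_E: "D * E = real a * real b"
proof -
  have "(D * E) ^ 3 = (real a * real b) ^ 3"
    using D_cubed E_cubed by Groebner_Basis.algebra
  then show ?thesis by (rule power_eq_imp_eq_base) (auto simp: delta_def delta_bar_def)
qed

lemma D_D: "D * D = real b * E"
proof -
  have "(D * D) ^ 3 = (real b * E) ^ 3"
    using D_cubed E_cubed by Groebner_Basis.algebra
  then show ?thesis by (rule power_eq_imp_eq_base) (auto simp: delta_def delta_bar_def)
qed

lemma E_E: "E * E = real a * D"
proof -
  have "(E * E) ^ 3 = (real a * D) ^ 3"
    using D_cubed E_cubed by Groebner_Basis.algebra
  then show ?thesis by (rule power_eq_imp_eq_base) (auto simp: delta_def delta_bar_def)
qed

lemma D_gt_1: "D > 1"
  using d_ge by (simp add: delta_def)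

lemma E_gt_1: "E > 1"
proof -
  have "1 * 1 < a\<^sup>2 * b" using a_ge b_ge by (intro mult_less_le_imp_less one_less_power) auto
  then have "1 < real (a\<^sup>2 * b)" by (metis mult_1 of_nat_1 of_nat_less_iff)
  then show ?thesis by (simp only: delta_bar_def real_root_gt_1_iff zero_less_numeral)
qed

lemma D_irrational: "D \<notin> \<rat>"
proof
  assume "D \<in> \<rat>"
  moreover have "D ^ 3 \<in> \<int>" by (simp add: D_cubed)
  ultimately have "D \<in> \<int>" by (rule Rats_power_imp_root3)
  then obtain k where k: "D = of_int k" by (auto elim: Ints_cases)
  define m where "m = nat k"
  have m: "D = real m" using k D_gt_1 by (simp add: m_def)
  have "real (m ^ 3) = real d" using m D_cubed by (simp add: d_eq)
  then have md: "m ^ 3 = d" by (simp only: of_nat_eq_iff)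
  then have "m = 1" using cubefreeD[OF d_cubefree, of m] by simp
  then show False using md d_ge by simp
qed

lemma rational_mult_D: "y \<in> \<rat> \<Longrightarrow> y * D \<in> \<rat> \<Longrightarrow> y = 0"
  using D_irrational Rats_divide[of "y * D" y] by (cases "y = 0") auto

lemma rational_mult_E: "y \<in> \<rat> \<Longrightarrow> y * E \<in> \<rat> \<Longrightarrow> y = 0"
proof (rule ccontr)
  assume y: "y \<in> \<rat>" "y * E \<in> \<rat>" "y \<noteq> 0"
  then have "E \<in> \<rat>" using Rats_divide[of "y * E" y] by simp
  then have "E * E / real a \<in> \<rat>" by simp
  then show False using E_E D_irrational ab_pos by simp
qed

text \<open>Linear independence without degree theory: u = y D and v = z E have sum -x and a
  rational product, so u is a root of a rational quadratic polynomial. Reducing the rational number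
  u^3 by it leaves a rational multiple of u, and \<open>D\<close> and \<open>E\<close> are
  irrational.\<close>

lemma el_eq_0:
  assumes "x \<in> \<rat>" "y \<in> \<rat>" "z \<in> \<rat>" and "el x y z = 0"
  shows "x = 0 \<and> y = 0 \<and> z = 0"
proof -
  define u v where "u = y * D" and "v = z * E"
  have sum: "u + v = - x" using assms(4) by (simp add: u_def v_def el_def)
  have uv: "u * v = y * z * (real a * real b)"
    unfolding u_def v_def using D_E by Groebner_Basis.algebra
  define m where "m = y * z * (real a * real b)"
  have m: "m \<in> \<rat>" using assms by (simp add: m_def)
  have u3: "u ^ 3 \<in> \<rat>" using assms by (simp add: u_def power_mult_distrib D_cubed)
  have quad: "u * u + x * u + m = 0" using sum uv unfolding m_def by Groebner_Basis.algebra
  have "(x * x - m) * u = u ^ 3 - x * m" using quad by Groebner_Basis.algebra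
  then have *: "(x * x - m) * u \<in> \<rat>" using u3 m assms by simp
  show ?thesis
  proof (cases "x * x = m")
    case True
    \<comment> \<open>Here u is a root of X^2 + x X + x^2, whose discriminant -3 x^2 is negative
      unless x = 0.\<close>
    have "(u + x / 2) * (u + x / 2) + 3 / 4 * (x * x) = 0"
      using quad True by (simp add: algebra_simps)
    moreover have "0 \<le> (u + x / 2) * (u + x / 2)" "0 \<le> x * x" by simp_all
    ultimately have "x * x = 0" "(u + x / 2) * (u + x / 2) = 0" by linarith+
    then have "x = 0" "u = 0" by auto
    then have "v = 0" using sum by simp
    then show ?thesis using \<open>x = 0\<close> \<open>u = 0\<close> D_gt_1 E_gt_1 by (simp add: u_def v_def)
  next
    case False
    then have "u \<in> \<rat>" using * Rats_divide[of "(x * x - m) * u" "x * x - m"] m assms by simp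
    then have y: "y = 0" using rational_mult_D assms by (simp add: u_def)
    then have "v = - x" using sum by (simp add: u_def)
    then have "z = 0" using rational_mult_E assms by (simp add: v_def)
    then show ?thesis using y assms(4) by (simp add: el_def)
  qed
qed

lemma el_diff: "el x y z - el x' y' z' = el (x - x') (y - y') (z - z')"
  by (simp add: el_def algebra_simps)

lemma el_scale: "c * el x y z = el (c * x) (c * y) (c * z)"
  by (simp add: el_def algebra_simps)

lemma el_mult: "el x y z * el x' y' z' =
  el (x * x' + real a * real b * (y * z' + z * y')) (x * y' + y * x' + real a * z * z') (x * z' + z * x' + real b * y * y')"
  unfolding el_def using D_D E_E D_E by Groebner_Basis.algebra

lemma el_inject:
  assumes "x \<in> \<rat>" "y \<in> \<rat>" "z \<in> \<rat>" "x' \<in> \<rat>" "y' \<in> \<rat>" "z' \<in> \<rat>"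
  shows "el x y z = el x' y' z' \<longleftrightarrow> x = x' \<and> y = y' \<and> z = z'"
  using el_eq_0[of "x - x'" "y - y'" "z - z'"] assms by (auto simp flip: el_diff)

text \<open>The second factor is the product of the two other conjugates, written in coordinates. It
  provides inverses here and the formula for \<open>cp\<close> later.\<close>

lemma el_adj: "el x y z * el (x * x - real a * real b * y * z) (real a * z * z - x * y) (real b * y * y - x * z) = nf x y z"
  unfolding el_def nf_def using D_D E_E D_E by Groebner_Basis.algebra

text \<open>If the norm vanished at a non-zero element, its adjoint would vanish too. The
  coordinates of the adjoint then give b y^3 = a z^3 with z \<noteq> 0, and \<open>D\<close> would
  be the rational number b y / z.\<close>

lemma nf_eq_0:
  assumes xyz: "x \<in> \<rat>" "y \<in> \<rat>" "z \<in> \<rat>" and "nf x y z = (0 :: real)"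
  shows "x = 0 \<and> y = 0 \<and> z = 0"
proof (rule ccontr)
  assume nz: "\<not> ?thesis"
  then have "el x y z \<noteq> 0" using el_eq_0 xyz by blast
  then have "el (x * x - real a * real b * y * z) (real a * z * z - x * y) (real b * y * y - x * z) = 0"
    using el_adj[of x y z] assms(4) by simp
  then have eqs: "x * x = real a * real b * y * z" "real a * z * z = x * y" "real b * y * y = x * z"
    using el_eq_0[of "x * x - real a * real b * y * z" "real a * z * z - x * y" "real b * y * y - x * z"] xyz by auto
  have "z \<noteq> 0"
  proof
    assume "z = 0"
    then have "x = 0" "y = 0" using eqs ab_pos by auto
    then show False using nz \<open>z = 0\<close> by simp
  qed
  have "real b * y ^ 3 = real a * z ^ 3" using eqs by Groebner_Basis.algebra
  have "D ^ 3 * z ^ 3 = (real b * y) ^ 3"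
    using \<open>real b * y ^ 3 = real a * z ^ 3\<close> D_cubed by Groebner_Basis.algebra
  then have "D ^ 3 = (real b * y / z) ^ 3" using \<open>z \<noteq> 0\<close> by (simp add: power_divide field_simps)
  then have "D = real b * y / z"
    by (metis odd_real_root_unique odd_numeral)
  then show False using D_irrational xyz by simp
qed

text \<open>The right side is closed under inverses by \<open>el_adj\<close> and
  \<open>nf_eq_0\<close>, and it lies in L because \<open>E\<close> is D^2 / b.\<close>

lemma L_eq: "L = {el x y z | x y z. x \<in> \<rat> \<and> y \<in> \<rat> \<and> z \<in> \<rat>}" (is "_ = ?A")
proof
  have inA: "el x y z \<in> ?A" if "x \<in> \<rat>" "y \<in> \<rat>" "z \<in> \<rat>" for x y z
    using that by blast
  have "is_subfield ?A"
    unfolding is_subfield_def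
  proof (intro conjI ballI)
    have "1 = el 1 0 0" by (simp add: el_def)
    then show "1 \<in> ?A" using Rats_0 Rats_1 by blast
    fix u assume "u \<in> ?A"
    then obtain x y z where u: "u = el x y z" "x \<in> \<rat>" "y \<in> \<rat>" "z \<in> \<rat>" by blast
    show "inverse u \<in> ?A"
    proof (cases "u = 0")
      case True
      then show ?thesis using \<open>u \<in> ?A\<close> by simp
    next
      case False
      define n where "n = nf x y z"
      have n: "n \<in> \<rat>" using u by (simp add: n_def nf_def)
      have n0: "n \<noteq> 0" using nf_eq_0[of x y z] u False by (auto simp: n_def el_def)
      have "inverse u = (1 / n) * el (x * x - real a * real b * y * z) (real a * z * z - x * y) (real b * y * y - x * z)"
        using el_adj[of x y z, folded n_def, folded u(1)] n0 False by (simp add: field_simps)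
      then show ?thesis unfolding el_scale by (simp only:) (rule inA; use u n in simp)
    qed
    fix v assume "v \<in> ?A"
    then obtain x' y' z' where v: "v = el x' y' z'" "x' \<in> \<rat>" "y' \<in> \<rat>" "z' \<in> \<rat>" by blast
    show "u - v \<in> ?A" unfolding u(1) v(1) el_diff by (rule inA; use u v in simp)
    show "u * v \<in> ?A" unfolding u(1) v(1) el_mult by (rule inA; use u v in simp)
  qed
  moreover have "D = el 0 1 0" by (simp add: el_def)
  then have "{D} \<subseteq> ?A" using Rats_0 Rats_1 by blast
  ultimately show "L \<subseteq> ?A" unfolding pure_cubic_def by (rule field_adjoin_least)
  have sf: "is_subfield L" by (simp add: pure_cubic_def field_adjoin_subfield)
  have D: "D \<in> L" unfolding pure_cubic_def using field_adjoin_base by blast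
  have "E = D * D / real b" using D_D ab_pos by simp
  then have E: "E \<in> L" using D sf by (auto intro!: is_subfieldD(4,8) is_subfield_of_nat)
  show "?A \<subseteq> L"
  proof clarify
    fix x y z :: real assume "x \<in> \<rat>" "y \<in> \<rat>" "z \<in> \<rat>"
    then have "x \<in> L" "y \<in> L" "z \<in> L" using is_subfield_Rats[OF sf] by blast+
    then show "el x y z \<in> L" unfolding el_def using D E by (intro is_subfieldD(4,7)[OF sf])
  qed
qed

lemma L_subfield: "is_subfield L"
  by (simp add: pure_cubic_def field_adjoin_subfield)

lemma el_in_L [intro]: "x \<in> \<rat> \<Longrightarrow> y \<in> \<rat> \<Longrightarrow> z \<in> \<rat> \<Longrightarrow> el x y z \<in> L"
  unfolding L_eq by blast

lemma L_cases:
  assumes "u \<in> L"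
  obtains x y z where "u = el x y z" "x \<in> \<rat>" "y \<in> \<rat>" "z \<in> \<rat>"
  using assms unfolding L_eq by blast

lemma D_in_L: "D \<in> L" and E_in_L: "E \<in> L"
  using el_in_L[of 0 1 0] el_in_L[of 0 0 1] by (auto simp: el_def)

end

section \<open>The normal closure\<close>

locale pure_cubic_closure = pure_cubic_field +
  fixes \<zeta> :: complex and \<sigma> :: "complex \<Rightarrow> complex"
  assumes zeta_cubed: "\<zeta> ^ 3 = 1" and zeta_neq_1: "\<zeta> \<noteq> 1"
    and galois: "\<sigma> \<in> galois_group (normal_closure d \<zeta>) (cyclotomic3 \<zeta>)"
    and sigma_D: "\<sigma> (complex_of_real (delta d)) = \<zeta> * complex_of_real (delta d)"
begin

abbreviation "K \<equiv> normal_closure d \<zeta>"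
abbreviation "k0 \<equiv> cyclotomic3 \<zeta>"
abbreviation "OK \<equiv> maximal_order K"

lemma zeta_zeta: "\<zeta> * \<zeta> = - 1 - \<zeta>"
proof -
  have "(\<zeta> - 1) * (\<zeta> * \<zeta> + \<zeta> + 1) = 0" using zeta_cubed by Groebner_Basis.algebra
  then have "\<zeta> * \<zeta> + \<zeta> + 1 = 0" using zeta_neq_1 by simp
  then show ?thesis by Groebner_Basis.algebra
qed

lemma cmod_zeta: "cmod \<zeta> = 1"
proof -
  have "cmod \<zeta> ^ 3 = 1 ^ 3" using zeta_cubed by (simp flip: norm_power)
  then show ?thesis by (rule power_eq_imp_eq_base) auto
qed

lemma cnj_zeta: "cnj \<zeta> = \<zeta> * \<zeta>"
proof -
  have "\<zeta> * cnj \<zeta> = 1" by (simp add: complex_norm_square[symmetric] cmod_zeta)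
  then show ?thesis using zeta_cubed by Groebner_Basis.algebra
qed

lemma zeta_neq_0: "\<zeta> \<noteq> 0" using cmod_zeta by auto

lemma Im_zeta: "Im \<zeta> \<noteq> 0"
proof
  assume "Im \<zeta> = 0"
  then have "cnj \<zeta> = \<zeta>" by (simp add: complex_eq_iff)
  then have "\<zeta> * \<zeta> = \<zeta>" using cnj_zeta by simp
  then show False using zeta_neq_1 zeta_neq_0 by simp
qed

lemma real_zeta_eq_0: "complex_of_real u + complex_of_real v * \<zeta> = 0 \<Longrightarrow> u = 0 \<and> v = 0"
  using Im_zeta by (auto simp: complex_eq_iff)

text \<open>One model for both extensions by \<zeta>: F = \<rat> gives k0 and F = L gives K.\<close>

definition zeta_ext :: "real set \<Rightarrow> complex set" where
  "zeta_ext F = {complex_of_real u + complex_of_real v * \<zeta> | u v. u \<in> F \<and> v \<in> F}"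

lemma zeta_extI: "u \<in> F \<Longrightarrow> v \<in> F \<Longrightarrow> complex_of_real u + complex_of_real v * \<zeta> \<in> zeta_ext F"
  unfolding zeta_ext_def by blast

lemma zeta_extE:
  assumes "w \<in> zeta_ext F"
  obtains u v where "w = complex_of_real u + complex_of_real v * \<zeta>" "u \<in> F" "v \<in> F"
  using assms unfolding zeta_ext_def by blast

lemma is_subfield_zeta_ext:
  assumes F: "is_subfield F"
  shows "is_subfield (zeta_ext F)"
  unfolding is_subfield_def
proof (intro conjI ballI)
  show "1 \<in> zeta_ext F" using zeta_extI[of 1 F 0] is_subfieldD(1,2)[OF F] by simp
  fix w assume "w \<in> zeta_ext F"
  then obtain u v where w: "w = complex_of_real u + complex_of_real v * \<zeta>" and uv: "u \<in> F" "v \<in> F"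
    by (rule zeta_extE)
  show "inverse w \<in> zeta_ext F"
  proof (cases "w = 0")
    case True
    then show ?thesis using \<open>w \<in> zeta_ext F\<close> by simp
  next
    case False
    \<comment> \<open>The squared absolute value of w; the second factor below is the complex
      conjugate of w, since that of \<zeta> is -1 - \<zeta>.\<close>
    define n where "n = u * u - u * v + v * v"
    have *: "w * (complex_of_real (u - v) + complex_of_real (- v) * \<zeta>) = complex_of_real n"
      unfolding w n_def of_real_diff of_real_add of_real_mult of_real_minus using zeta_zeta by Groebner_Basis.algebra
    have "n \<noteq> 0"
    proof
      assume "n = 0"
      then have "complex_of_real (u - v) + complex_of_real (- v) * \<zeta> = 0" using * False by simp
      then have "u - v = 0 \<and> - v = 0" by (rule real_zeta_eq_0)
      then show False using w False by simp
    qed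
    have "complex_of_real ((u - v) / n) + complex_of_real (- v / n) * \<zeta>
        = (complex_of_real (u - v) + complex_of_real (- v) * \<zeta>) / complex_of_real n"
      by (simp add: add_divide_distrib diff_divide_distrib)
    then have "w * (complex_of_real ((u - v) / n) + complex_of_real (- v / n) * \<zeta>) = 1"
      using * \<open>n \<noteq> 0\<close> by simp
    then have "inverse w = complex_of_real ((u - v) / n) + complex_of_real (- v / n) * \<zeta>"
      by (rule inverse_unique)
    also have "\<dots> \<in> zeta_ext F"
      unfolding n_def by (rule zeta_extI; intro is_subfieldD(3,4,6,7,8)[OF F] uv)
    finally show ?thesis .
  qed
  fix w' assume "w' \<in> zeta_ext F"
  then obtain u' v' where w': "w' = complex_of_real u' + complex_of_real v' * \<zeta>" and uv': "u' \<in> F" "v' \<in> F"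
    by (rule zeta_extE)
  have "w - w' = complex_of_real (u - u') + complex_of_real (v - v') * \<zeta>"
    by (simp add: w w' algebra_simps)
  also have "\<dots> \<in> zeta_ext F" by (rule zeta_extI; intro is_subfieldD(3)[OF F] uv uv')
  finally show "w - w' \<in> zeta_ext F" .
  have "w * w' = complex_of_real (u * u' - v * v') + complex_of_real (u * v' + v * u' - v * v') * \<zeta>"
    unfolding w w' of_real_diff of_real_add of_real_mult using zeta_zeta by Groebner_Basis.algebra
  also have "\<dots> \<in> zeta_ext F" by (rule zeta_extI; intro is_subfieldD(3,4,7)[OF F] uv uv')
  finally show "w * w' \<in> zeta_ext F" .
qed

lemma k0_subfield: "is_subfield k0"
  by (simp add: cyclotomic3_def field_adjoin_subfield)

lemma K_subfield: "is_subfield K"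
  by (simp add: normal_closure_def field_adjoin_subfield)

lemma zeta_in_k0 [simp]: "\<zeta> \<in> k0"
  unfolding cyclotomic3_def using field_adjoin_base by blast

lemma zeta_in_K [simp]: "\<zeta> \<in> K"
  unfolding normal_closure_def using field_adjoin_base[of "insert \<zeta> (complex_of_real ` L)"] by simp

lemma L_subset_K: "u \<in> L \<Longrightarrow> complex_of_real u \<in> K"
  unfolding normal_closure_def using field_adjoin_base[of "insert \<zeta> (complex_of_real ` L)"] by auto

lemma of_real_Rats: "u \<in> \<rat> \<Longrightarrow> complex_of_real u \<in> \<rat>"
  by (auto elim!: Rats_cases')

lemma k0_eq: "k0 = zeta_ext \<rat>"
proof
  have "\<zeta> \<in> zeta_ext \<rat>" using zeta_extI[of 0 \<rat> 1] by simp
  then show "k0 \<subseteq> zeta_ext \<rat>"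
    by (simp add: cyclotomic3_def field_adjoin_least is_subfield_zeta_ext is_subfield_rat_real)
  show "zeta_ext \<rat> \<subseteq> k0"
  proof
    fix w assume "w \<in> zeta_ext \<rat>"
    then obtain u v where w: "w = complex_of_real u + complex_of_real v * \<zeta>" "u \<in> \<rat>" "v \<in> \<rat>"
      by (rule zeta_extE)
    then have "complex_of_real u \<in> k0" "complex_of_real v \<in> k0"
      using is_subfield_Rats[OF k0_subfield] of_real_Rats by blast+
    then show "w \<in> k0" using is_subfieldD(4,7)[OF k0_subfield] zeta_in_k0 w(1) by simp
  qed
qed

lemma k0_cases:
  assumes "w \<in> k0"
  obtains u v where "w = complex_of_real u + complex_of_real v * \<zeta>" "u \<in> \<rat>" "v \<in> \<rat>"
  using assms unfolding k0_eq by (rule zeta_extE)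

lemma k0_subset_K: "w \<in> k0 \<Longrightarrow> w \<in> K"
proof -
  have "k0 \<subseteq> K" unfolding cyclotomic3_def by (intro field_adjoin_least K_subfield) simp
  then show "w \<in> k0 \<Longrightarrow> w \<in> K" by blast
qed

lemma Rats_in_k0: "w \<in> \<rat> \<Longrightarrow> w \<in> k0"
  by (rule is_subfield_Rats[OF k0_subfield])

lemma K_eq: "K = zeta_ext L"
proof
  have "\<zeta> \<in> zeta_ext L" using zeta_extI[of 0 L 1] is_subfieldD(1,2)[OF L_subfield] by simp
  moreover have "complex_of_real u \<in> zeta_ext L" if "u \<in> L" for u
    using zeta_extI[of u L 0] that is_subfieldD(2)[OF L_subfield] by simp
  ultimately have "insert \<zeta> (complex_of_real ` L) \<subseteq> zeta_ext L" by auto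
  then show "K \<subseteq> zeta_ext L"
    by (simp add: normal_closure_def field_adjoin_least is_subfield_zeta_ext L_subfield)
  show "zeta_ext L \<subseteq> K"
  proof
    fix w assume "w \<in> zeta_ext L"
    then obtain u v where w: "w = complex_of_real u + complex_of_real v * \<zeta>" "u \<in> L" "v \<in> L"
      by (rule zeta_extE)
    then show "w \<in> K" using is_subfieldD(4,7)[OF K_subfield] zeta_in_K L_subset_K w(1) by simp
  qed
qed

text \<open>The basis of L over the rationals is also a basis of K over k0, and it consists of
  eigenvectors of \<sigma> with eigenvalues 1, \<zeta> and \<zeta>^2.\<close>

definition kel :: "complex \<Rightarrow> complex \<Rightarrow> complex \<Rightarrow> complex" where
  "kel p q r = p + q * complex_of_real D + r * complex_of_real E"

lemma cD_D: "complex_of_real D * complex_of_real D = of_nat b * complex_of_real E"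
  by (simp only: of_real_mult[symmetric] D_D) simp

lemma cD_E: "complex_of_real D * complex_of_real E = of_nat a * of_nat b"
  by (simp only: of_real_mult[symmetric] D_E) simp

lemma of_real_el: "complex_of_real (el x y z) = kel (complex_of_real x) (complex_of_real y) (complex_of_real z)"
  by (simp add: el_def kel_def)

lemma kel_in_K: "p \<in> k0 \<Longrightarrow> q \<in> k0 \<Longrightarrow> r \<in> k0 \<Longrightarrow> kel p q r \<in> K"
  unfolding kel_def
  by (intro is_subfieldD(4,7)[OF K_subfield] k0_subset_K L_subset_K D_in_L E_in_L)

lemma K_cases:
  assumes "w \<in> K"
  obtains p q r where "w = kel p q r" "p \<in> k0" "q \<in> k0" "r \<in> k0"
proof -
  obtain u v where w: "w = complex_of_real u + complex_of_real v * \<zeta>" "u \<in> L" "v \<in> L"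
    using assms unfolding K_eq by (rule zeta_extE)
  obtain x y z where u: "u = el x y z" "x \<in> \<rat>" "y \<in> \<rat>" "z \<in> \<rat>" using w(2) by (rule L_cases)
  obtain x' y' z' where v: "v = el x' y' z'" "x' \<in> \<rat>" "y' \<in> \<rat>" "z' \<in> \<rat>" using w(3) by (rule L_cases)
  show thesis
  proof (rule that)
    show "w = kel (complex_of_real x + complex_of_real x' * \<zeta>) (complex_of_real y + complex_of_real y' * \<zeta>)
        (complex_of_real z + complex_of_real z' * \<zeta>)"
      by (simp add: w u v of_real_el kel_def algebra_simps)
  qed (unfold k0_eq, (rule zeta_extI; fact)+)
qed

lemma kel_eq_0:
  assumes "kel p q r = 0" "p \<in> k0" "q \<in> k0" "r \<in> k0"
  shows "p = 0 \<and> q = 0 \<and> r = 0"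
proof -
  obtain x x' where p: "p = complex_of_real x + complex_of_real x' * \<zeta>" "x \<in> \<rat>" "x' \<in> \<rat>"
    using assms(2) by (rule k0_cases)
  obtain y y' where q: "q = complex_of_real y + complex_of_real y' * \<zeta>" "y \<in> \<rat>" "y' \<in> \<rat>"
    using assms(3) by (rule k0_cases)
  obtain z z' where r: "r = complex_of_real z + complex_of_real z' * \<zeta>" "z \<in> \<rat>" "z' \<in> \<rat>"
    using assms(4) by (rule k0_cases)
  have "complex_of_real (el x y z) + complex_of_real (el x' y' z') * \<zeta> = kel p q r"
    by (simp add: p q r of_real_el kel_def algebra_simps)
  then have "el x y z = 0" "el x' y' z' = 0" using real_zeta_eq_0 assms(1) by simp_all
  then show ?thesis using el_eq_0[of x y z] el_eq_0[of x' y' z'] p q r by simp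
qed

lemma kel_diff: "kel p q r - kel p' q' r' = kel (p - p') (q - q') (r - r')"
  by (simp add: kel_def algebra_simps)

lemma kel_scale: "c * kel p q r = kel (c * p) (c * q) (c * r)"
  by (simp add: kel_def algebra_simps)

lemma kel_inject:
  assumes "p \<in> k0" "q \<in> k0" "r \<in> k0" "p' \<in> k0" "q' \<in> k0" "r' \<in> k0"
  shows "kel p q r = kel p' q' r' \<longleftrightarrow> p = p' \<and> q = q' \<and> r = r'"
proof
  assume "kel p q r = kel p' q' r'"
  then have "kel (p - p') (q - q') (r - r') = 0" by (simp flip: kel_diff)
  then show "p = p' \<and> q = q' \<and> r = r'"
    using kel_eq_0[of "p - p'" "q - q'" "r - r'"] assms is_subfieldD(3)[OF k0_subfield] by auto
qed simp

lemma sigma_K: "w \<in> K \<Longrightarrow> \<sigma> w \<in> K"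
  and sigma_add: "w \<in> K \<Longrightarrow> w' \<in> K \<Longrightarrow> \<sigma> (w + w') = \<sigma> w + \<sigma> w'"
  and sigma_mult: "w \<in> K \<Longrightarrow> w' \<in> K \<Longrightarrow> \<sigma> (w * w') = \<sigma> w * \<sigma> w'"
  and sigma_k0: "w \<in> k0 \<Longrightarrow> \<sigma> w = w"
  using galois unfolding galois_group_def bij_betw_def by auto

lemma sigma_E: "\<sigma> (complex_of_real E) = \<zeta> * \<zeta> * complex_of_real E"
proof -
  have b: "of_nat b \<in> k0" by (rule is_subfield_of_nat[OF k0_subfield])
  have "of_nat b * \<sigma> (complex_of_real E) = \<sigma> (of_nat b * complex_of_real E)"
    using b by (simp add: sigma_mult k0_subset_K L_subset_K E_in_L sigma_k0)
  also have "\<dots> = \<sigma> (complex_of_real D * complex_of_real D)" by (simp only: cD_D)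
  also have "\<dots> = (\<zeta> * complex_of_real D) * (\<zeta> * complex_of_real D)"
    by (simp only: sigma_mult L_subset_K D_in_L sigma_D)
  also have "\<dots> = of_nat b * (\<zeta> * \<zeta> * complex_of_real E)" using cD_D by Groebner_Basis.algebra
  finally show ?thesis using b_ge by simp
qed

lemma sigma_kel:
  assumes "p \<in> k0" "q \<in> k0" "r \<in> k0"
  shows "\<sigma> (kel p q r) = kel p (q * \<zeta>) (r * (\<zeta> * \<zeta>))"
  unfolding kel_def using assms
  by (simp add: sigma_add sigma_mult k0_subset_K L_subset_K D_in_L E_in_L sigma_k0 sigma_D sigma_E
      is_subfieldD(4,7)[OF K_subfield] mult.assoc)

lemma sigma_sigma_kel:
  assumes "p \<in> k0" "q \<in> k0" "r \<in> k0"
  shows "\<sigma> (\<sigma> (kel p q r)) = kel p (q * (\<zeta> * \<zeta>)) (r * \<zeta>)"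
proof -
  have *: "\<zeta> * \<zeta> * (\<zeta> * \<zeta>) = \<zeta>" using zeta_cubed by Groebner_Basis.algebra
  have "\<sigma> (\<sigma> (kel p q r)) = kel p (q * \<zeta> * \<zeta>) (r * (\<zeta> * \<zeta>) * (\<zeta> * \<zeta>))"
    using assms by (simp only: sigma_kel is_subfieldD(4)[OF k0_subfield] zeta_in_k0)
  then show ?thesis by (simp only: mult.assoc[of q] mult.assoc[of r] *)
qed

lemma zeta_3: "\<zeta> * (\<zeta> * \<zeta>) = 1" using zeta_cubed by Groebner_Basis.algebra

lemma sigma_3: "w \<in> K \<Longrightarrow> \<sigma> (\<sigma> (\<sigma> w)) = w"
proof (elim K_cases)
  fix p q r assume w: "w = kel p q r" "p \<in> k0" "q \<in> k0" "r \<in> k0"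
  have "\<sigma> (\<sigma> (\<sigma> w)) = kel p (q * (\<zeta> * \<zeta>) * \<zeta>) (r * \<zeta> * (\<zeta> * \<zeta>))"
    using w by (simp only: sigma_sigma_kel[OF w(2-4)]) (simp only: sigma_kel is_subfieldD(4)[OF k0_subfield] zeta_in_k0)
  then show ?thesis using zeta_3 w(1) by (simp only: mult.assoc mult_1_right)
qed

lemma sigma_inj: "w \<in> K \<Longrightarrow> w' \<in> K \<Longrightarrow> \<sigma> w = \<sigma> w' \<longleftrightarrow> w = w'"
  using sigma_3 by metis

lemma sigma_1 [simp]: "\<sigma> 1 = 1" and sigma_0 [simp]: "\<sigma> 0 = 0" and sigma_zeta [simp]: "\<sigma> \<zeta> = \<zeta>"
  using is_subfieldD(1,2)[OF k0_subfield] by (simp_all add: sigma_k0)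

lemma sigma_eq_0: "w \<in> K \<Longrightarrow> \<sigma> w = 0 \<longleftrightarrow> w = 0"
  using sigma_inj[of w 0] is_subfieldD(2)[OF K_subfield] by simp

lemma sigma_of_int [simp]: "\<sigma> (of_int n) = of_int n"
  by (rule sigma_k0, rule is_subfield_of_int[OF k0_subfield])

lemma sigma_minus: "w \<in> K \<Longrightarrow> \<sigma> (- w) = - \<sigma> w"
  using sigma_mult[of "of_int (- 1)" w] is_subfield_of_int[OF K_subfield, of "-1"] sigma_of_int[of "-1"] by simp

lemma sigma_power: "w \<in> K \<Longrightarrow> \<sigma> (w ^ n) = \<sigma> w ^ n"
  by (induction n) (auto simp: sigma_mult is_subfieldD(9)[OF K_subfield])

lemma sigma_inverse: "w \<in> K \<Longrightarrow> \<sigma> (inverse w) = inverse (\<sigma> w)"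
proof (cases "w = 0")
  case False
  assume w: "w \<in> K"
  have "\<sigma> w * \<sigma> (inverse w) = 1"
    using w False by (simp add: is_subfieldD(5)[OF K_subfield] flip: sigma_mult)
  then show ?thesis by (metis inverse_unique)
qed simp

lemma sigma_divide: "w \<in> K \<Longrightarrow> w' \<in> K \<Longrightarrow> \<sigma> (w / w') = \<sigma> w / \<sigma> w'"
  by (simp add: field_class.field_divide_inverse sigma_mult sigma_inverse is_subfieldD(5)[OF K_subfield])

lemma cnj_k0: "w \<in> k0 \<Longrightarrow> cnj w \<in> k0"
proof (elim k0_cases)
  fix u v :: real assume uv: "w = complex_of_real u + complex_of_real v * \<zeta>" "u \<in> \<rat>" "v \<in> \<rat>"
  then have "cnj w = complex_of_real (u - v) + complex_of_real (- v) * \<zeta>"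
    by (simp add: cnj_zeta zeta_zeta algebra_simps)
  then show "cnj w \<in> k0" unfolding k0_eq using uv by (simp only:) (rule zeta_extI; simp)
qed

lemma cnj_kel: "cnj (kel p q r) = kel (cnj p) (cnj q) (cnj r)"
  by (simp add: kel_def)

lemma cnj_K: "w \<in> K \<Longrightarrow> cnj w \<in> K"
  by (elim K_cases) (simp add: cnj_kel kel_in_K cnj_k0)

text \<open>Complex conjugation exchanges \<zeta> and \<zeta>^2 and fixes \<open>D\<close> and
  \<open>E\<close>, so it conjugates \<sigma> into its inverse, which is \<sigma> applied
  twice.\<close>

lemma cnj_sigma: "w \<in> K \<Longrightarrow> cnj (\<sigma> w) = \<sigma> (\<sigma> (cnj w))"
proof (elim K_cases)
  fix p q r assume w: "w = kel p q r" "p \<in> k0" "q \<in> k0" "r \<in> k0"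
  have *: "\<zeta> * \<zeta> * (\<zeta> * \<zeta>) = \<zeta>" using zeta_cubed by Groebner_Basis.algebra
  have "\<sigma> (\<sigma> (cnj w)) = kel (cnj p) (cnj q * (\<zeta> * \<zeta>)) (cnj r * \<zeta>)"
    unfolding w(1) cnj_kel by (intro sigma_sigma_kel cnj_k0 w)
  also have "\<dots> = cnj (\<sigma> w)"
    unfolding w(1) sigma_kel[OF w(2-4)] cnj_kel complex_cnj_mult cnj_zeta * ..
  finally show ?thesis ..
qed

lemma cnj_sigma_sigma: "w \<in> K \<Longrightarrow> cnj (\<sigma> (\<sigma> w)) = \<sigma> (cnj w)"
  by (simp add: cnj_sigma cnj_K sigma_K sigma_3)

lemma cD_cubed: "complex_of_real D ^ 3 = of_nat a * (of_nat b)\<^sup>2"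
  by (simp only: of_real_power[symmetric] D_cubed) simp

lemma cE_cubed: "complex_of_real E ^ 3 = (of_nat a)\<^sup>2 * of_nat b"
  by (simp only: of_real_power[symmetric] E_cubed) simp

text \<open>With u = q D and v = r E this is the factorisation of p^3 + u^3 + v^3 - 3 p u v into
  three linear forms over the cyclotomic field.\<close>

lemma rel_norm_kel:
  assumes "p \<in> k0" "q \<in> k0" "r \<in> k0"
  shows "rel_norm \<sigma> (kel p q r) = nf p q r"
proof -
  define u v where "u = q * complex_of_real D" and "v = r * complex_of_real E"
  have "rel_norm \<sigma> (kel p q r)
      = (p + u + v) * (p + u * \<zeta> + v * (\<zeta> * \<zeta>)) * (p + u * (\<zeta> * \<zeta>) + v * \<zeta>)"
    unfolding rel_norm_def sigma_sigma_kel[OF assms] unfolding sigma_kel[OF assms]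
    by (simp add: kel_def u_def v_def mult_ac)
  also have "\<dots> = p ^ 3 + u ^ 3 + v ^ 3 - 3 * p * u * v"
    using zeta_zeta by Groebner_Basis.algebra
  also have "\<dots> = p ^ 3 + q ^ 3 * complex_of_real D ^ 3 + r ^ 3 * complex_of_real E ^ 3
      - 3 * p * q * r * (complex_of_real D * complex_of_real E)"
    by (simp add: u_def v_def power_mult_distrib)
  also have "\<dots> = nf p q r"
    unfolding cD_E cD_cubed cE_cubed nf_def by (simp add: mult_ac)
  finally show ?thesis .
qed

lemma rel_norm_mult: "w \<in> K \<Longrightarrow> w' \<in> K \<Longrightarrow> rel_norm \<sigma> (w * w') = rel_norm \<sigma> w * rel_norm \<sigma> w'"
  by (simp add: rel_norm_def sigma_mult sigma_K)

text \<open>The product of the two non-real conjugates of an element of the cubic field.\<close>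

definition cp :: "real \<Rightarrow> real" where
  "cp u = (cmod (\<sigma> (complex_of_real u)))\<^sup>2"

definition nm :: "real \<Rightarrow> real" where
  "nm u = u * cp u"

lemma sigma_sigma_L: "u \<in> L \<Longrightarrow> \<sigma> (\<sigma> (complex_of_real u)) = cnj (\<sigma> (complex_of_real u))"
  by (simp add: cnj_sigma L_subset_K)

lemma of_real_cp: "u \<in> L \<Longrightarrow> complex_of_real (cp u) = \<sigma> (complex_of_real u) * \<sigma> (\<sigma> (complex_of_real u))"
  by (simp only: cp_def sigma_sigma_L complex_norm_square)

lemma conj_prod_L: "u \<in> L \<Longrightarrow> conj_prod \<sigma> u = cp u"
  unfolding conj_prod_def by (simp flip: of_real_cp)

lemma rel_norm_L: "u \<in> L \<Longrightarrow> rel_norm \<sigma> (complex_of_real u) = complex_of_real (nm u)"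
  unfolding rel_norm_def nm_def of_real_mult by (simp add: of_real_cp)

lemma cp_mult: "u \<in> L \<Longrightarrow> v \<in> L \<Longrightarrow> cp (u * v) = cp u * cp v"
  by (simp add: cp_def sigma_mult L_subset_K norm_mult power_mult_distrib)

lemma nm_mult: "u \<in> L \<Longrightarrow> v \<in> L \<Longrightarrow> nm (u * v) = nm u * nm v"
  by (simp add: nm_def cp_mult)

lemma cp_pos: "u \<in> L \<Longrightarrow> u \<noteq> 0 \<Longrightarrow> cp u > 0"
  by (simp add: cp_def sigma_eq_0 L_subset_K)

lemma nm_1: "nm 1 = 1"
  by (simp add: nm_def cp_def)

lemma nm_power: "u \<in> L \<Longrightarrow> nm (u ^ n) = nm u ^ n"
  by (induction n) (auto simp: nm_mult nm_1 is_subfieldD(9)[OF L_subfield])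

lemma nm_eq_0: "u \<in> L \<Longrightarrow> nm u = 0 \<longleftrightarrow> u = 0"
  using cp_pos[of u] by (cases "u = 0") (auto simp: nm_def)

lemma nm_pos: "u \<in> L \<Longrightarrow> u > 0 \<Longrightarrow> nm u > 0"
  using cp_pos[of u] by (auto simp: nm_def)

lemma nm_el: "x \<in> \<rat> \<Longrightarrow> y \<in> \<rat> \<Longrightarrow> z \<in> \<rat> \<Longrightarrow> nm (el x y z) = nf x y z"
proof -
  assume xyz: "x \<in> \<rat>" "y \<in> \<rat>" "z \<in> \<rat>"
  have "complex_of_real (nm (el x y z)) = nf (complex_of_real x) (complex_of_real y) (complex_of_real z)"
    using xyz by (simp add: rel_norm_L[symmetric] el_in_L of_real_el rel_norm_kel Rats_in_k0 of_real_Rats)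
  also have "\<dots> = complex_of_real (nf x y z)" by (simp add: nf_def)
  finally show ?thesis by (simp only: of_real_eq_iff)
qed

lemma cp_el: "x \<in> \<rat> \<Longrightarrow> y \<in> \<rat> \<Longrightarrow> z \<in> \<rat> \<Longrightarrow>
  cp (el x y z) = el (x * x - real a * real b * y * z) (real a * z * z - x * y) (real b * y * y - x * z)"
proof (cases "el x y z = 0")
  case True
  assume xyz: "x \<in> \<rat>" "y \<in> \<rat>" "z \<in> \<rat>"
  then have "x = 0" "y = 0" "z = 0" using el_eq_0 True by auto
  then show ?thesis by (simp add: el_def cp_def)
next
  case False
  assume xyz: "x \<in> \<rat>" "y \<in> \<rat>" "z \<in> \<rat>"
  have "el x y z * cp (el x y z) = nf x y z" using nm_el[OF xyz] by (simp add: nm_def)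
  then have "el x y z * cp (el x y z) = el x y z *
      el (x * x - real a * real b * y * z) (real a * z * z - x * y) (real b * y * y - x * z)"
    by (simp only: el_adj)
  then show ?thesis using mult_left_cancel[OF False] by blast
qed

lemma cp_in_L: "u \<in> L \<Longrightarrow> cp u \<in> L"
  by (elim L_cases) (auto simp: cp_el intro!: el_in_L)

lemma nm_Rats: "u \<in> L \<Longrightarrow> nm u \<in> \<rat>"
  by (elim L_cases) (simp add: nm_el nf_def)

end

section \<open>The maximal order\<close>

lemma prime_3_int: "prime (3 :: int)" by simp

lemma three_dvd_cube: "(3::int) dvd x ^ n \<Longrightarrow> 3 dvd x"
  by (rule prime_dvd_power[OF prime_3_int])

text \<open>Expanding at the point where everything is 1, the form is 9 (k - m)^2 modulo 27 with k -
  m = (A - B) / 3. So 27 forces A and B to agree modulo 9, and A B^2 is then the cube of a number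
  congruent to 1 modulo 3.\<close>

lemma norm_form_mod_27:
  fixes A B x y z :: int
  assumes A: "A mod 3 = 1" and B: "B mod 3 = 1" and x: "x mod 3 = 1" and y: "y mod 3 = 1" and z: "z mod 3 = 1"
    and N: "27 dvd x ^ 3 + A * B\<^sup>2 * y ^ 3 + A\<^sup>2 * B * z ^ 3 - 3 * A * B * x * y * z"
  shows "9 dvd A * B\<^sup>2 - 1"
proof -
  have shift: "\<exists>k. u = 1 + 3 * k" if "u mod 3 = 1" for u :: int
    using that by presburger
  obtain k where k: "A = 1 + 3 * k" using shift[OF A] by blast
  obtain m where m: "B = 1 + 3 * m" using shift[OF B] by blast
  obtain u where u: "x = 1 + 3 * u" using shift[OF x] by blast
  obtain v where v: "y = 1 + 3 * v" using shift[OF y] by blast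
  obtain w where w: "z = 1 + 3 * w" using shift[OF z] by blast
  have "x ^ 3 + A * B\<^sup>2 * y ^ 3 + A\<^sup>2 * B * z ^ 3 - 3 * A * B * x * y * z = 9 * (k - m)\<^sup>2 +
    27 * (u\<^sup>2 + u ^ 3 + A * B\<^sup>2 * (v\<^sup>2 + v ^ 3) + A\<^sup>2 * B * (w\<^sup>2 + w ^ 3) - A * B * (u * v + v * w + w * u)
      - 3 * A * B * u * v * w - u * (k + m + 3 * k * m) + v * A * B * m + w * A * B * k
      + k * m + k * m * (k + m))"
    unfolding k m u v w by Groebner_Basis.algebra
  then have "27 dvd 9 * (k - m)\<^sup>2"
    using N by (simp add: dvd_add_left_iff)
  then have "3 dvd (k - m)\<^sup>2" by presburger
  then have "3 dvd k - m" by (rule three_dvd_cube)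
  then obtain r where r: "k = m + 3 * r" by (metis dvdE diff_add_cancel add.commute)
  have "A * B\<^sup>2 - 1 = 9 * (m + r + 3 * m\<^sup>2 + 6 * r * m + 9 * r * m\<^sup>2 + 3 * m ^ 3)"
    unfolding k m r by Groebner_Basis.algebra
  then show ?thesis by simp
qed

lemma cube_mod_3: "3 dvd (x::int) ^ 3 - x"
proof -
  have "x mod 3 = 0 \<or> x mod 3 = 1 \<or> x mod 3 = 2" by presburger
  then obtain k where "x = 3 * k \<or> x = 3 * k + 1 \<or> x = 3 * k + 2" by (metis add.right_neutral mult_div_mod_eq)
  moreover have "(3 * k) ^ 3 - 3 * k = 3 * (9 * k ^ 3 - k)" for k :: int by Groebner_Basis.algebra
  moreover have "(3 * k + 1) ^ 3 - (3 * k + 1) = 3 * (9 * k ^ 3 + 9 * k ^ 2 + 2 * k)" for k :: int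
    by Groebner_Basis.algebra
  moreover have "(3 * k + 2) ^ 3 - (3 * k + 2) = 3 * (9 * k ^ 3 + 18 * k ^ 2 + 11 * k + 2)" for k :: int
    by Groebner_Basis.algebra
  ultimately show ?thesis by (metis dvd_triv_left)
qed

text \<open>Signs are chosen so that all five quantities become congruent to 1 modulo 3.\<close>

lemma norm_form_not_dvd_3:
  fixes a b x y z :: int
  assumes a: "\<not> 3 dvd a" and b: "\<not> 3 dvd b" and x: "\<not> 3 dvd x"
    and S: "3 dvd x\<^sup>2 - a * b * y * z"
    and N: "27 dvd x ^ 3 + a * b\<^sup>2 * y ^ 3 + a\<^sup>2 * b * z ^ 3 - 3 * a * b * x * y * z"
  shows "9 dvd a * b\<^sup>2 - 1 \<or> 9 dvd a * b\<^sup>2 + 1"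
proof -
  have sgn: "\<exists>e. (e = 1 \<or> e = -1) \<and> (e * u) mod 3 = 1" if "\<not> 3 dvd u" for u :: int
  proof -
    have "(1 * u) mod 3 = 1 \<or> (-1 * u) mod 3 = 1" using that by presburger
    then show ?thesis by blast
  qed
  obtain e where e: "e = 1 \<or> e = -1" "(e * x) mod 3 = 1" using sgn[OF x] by blast
  obtain s where s: "s = 1 \<or> s = -1" "(s * a) mod 3 = 1" using sgn[OF a] by blast
  obtain t where t: "t = 1 \<or> t = -1" "(t * b) mod 3 = 1" using sgn[OF b] by blast
  \<comment> \<open>The signs given to y and z compensate those of a and b, so that the whole form
    only changes by the factor e.\<close>
  define A B X Y Z where "A = s * a" and "B = t * b" and "X = e * x" and "Y = e * s * y" and "Z = e * t * z"
  have sq: "e * e = 1" "s * s = 1" "t * t = 1" using e s t by auto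
  have *: "X ^ 3 + A * B\<^sup>2 * Y ^ 3 + A\<^sup>2 * B * Z ^ 3 - 3 * A * B * X * Y * Z
      = e * (x ^ 3 + a * b\<^sup>2 * y ^ 3 + a\<^sup>2 * b * z ^ 3 - 3 * a * b * x * y * z)"
    unfolding A_def B_def X_def Y_def Z_def using sq by Groebner_Basis.algebra
  have N': "27 dvd X ^ 3 + A * B\<^sup>2 * Y ^ 3 + A\<^sup>2 * B * Z ^ 3 - 3 * A * B * X * Y * Z"
    unfolding * using N by (rule dvd_mult)
  have "X\<^sup>2 - A * B * Y * Z = x\<^sup>2 - a * b * y * z"
    unfolding A_def B_def X_def Y_def Z_def using sq by Groebner_Basis.algebra
  then have S': "3 dvd X\<^sup>2 - A * B * Y * Z" using S by simp
  have A: "A mod 3 = 1" and B: "B mod 3 = 1" and X: "X mod 3 = 1"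
    using e s t by (simp_all add: A_def B_def X_def)
  have dvds: "3 dvd A - 1" "3 dvd B - 1" "3 dvd X - 1" using A B X by presburger+
  \<comment> \<open>The condition S becomes YZ = 1 modulo 3, so Y and Z are both 1 or both -1; the
    norm, reduced modulo 3 to 1 + Y + Z, then excludes -1.\<close>
  have "1 - Y * Z = (X\<^sup>2 - A * B * Y * Z) - (X - 1) * (X + 1) + (A - 1) * (B * Y * Z) + (B - 1) * (Y * Z)"
    by Groebner_Basis.algebra
  then have YZ: "3 dvd 1 - Y * Z"
    using S' dvds by (metis dvd_add dvd_diff dvd_mult2)
  have N3: "3 dvd X ^ 3 + A * B\<^sup>2 * Y ^ 3 + A\<^sup>2 * B * Z ^ 3 - 3 * A * B * X * Y * Z"
    using N' by (rule dvd_trans[rotated]) simp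
  obtain n c1 c2 c3 where nc: "X ^ 3 + A * B\<^sup>2 * Y ^ 3 + A\<^sup>2 * B * Z ^ 3 - 3 * A * B * X * Y * Z = 3 * n"
    "X ^ 3 - X = 3 * c1" "Y ^ 3 - Y = 3 * c2" "Z ^ 3 - Z = 3 * c3"
    using N3 cube_mod_3 unfolding dvd_def by metis
  obtain a' b' x' where abx: "A - 1 = 3 * a'" "B - 1 = 3 * b'" "X - 1 = 3 * x'"
    using dvds unfolding dvd_def by metis
  have "1 + Y + Z = 3 * (n - c1 - x' - c2 - c3 + A * B * X * Y * Z
      - (a' * (Y ^ 3 * B\<^sup>2 + Z ^ 3 * (A + 1)) + b' * (Z ^ 3 * A\<^sup>2 + Y ^ 3 * (B + 1))))"
    using nc abx by Groebner_Basis.algebra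
  then have sum: "3 dvd 1 + Y + Z" by simp
  have "Y mod 3 = 1 \<and> Z mod 3 = 1"
  proof -
    have "Y mod 3 = 0 \<or> Y mod 3 = 1 \<or> Y mod 3 = 2" by presburger
    moreover have "Y mod 3 \<noteq> 0" 
    proof
      assume "Y mod 3 = 0"
      then have "3 dvd Y * Z" by (simp add: mod_eq_0_iff_dvd)
      then have "3 dvd (1 - Y * Z) + Y * Z" using YZ by (intro dvd_add)
      then show False by simp
    qed
    moreover have "Y mod 3 \<noteq> 2"
    proof
      assume "Y mod 3 = 2"
      then have "3 dvd Z" using sum by presburger
      then have "3 dvd Y * Z" by simp
      then have "3 dvd (1 - Y * Z) + Y * Z" using YZ by (intro dvd_add)
      then show False by simp
    qed
    ultimately show ?thesis using sum by presburger
  qed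
  then have 9: "9 dvd A * B\<^sup>2 - 1" using norm_form_mod_27 A B X N' by blast
  have AB:  "A * B\<^sup>2 = s * (a * b\<^sup>2)"
    unfolding A_def B_def using sq by Groebner_Basis.algebra
  show ?thesis
  proof (cases "s = 1")
    case True
    then show ?thesis using 9 AB by simp
  next
    case False
    then have "A * B\<^sup>2 - 1 = - (a * b\<^sup>2 + 1)" using s(1) AB by simp
    then show ?thesis using 9 by (metis dvd_minus_iff)
  qed
qed

text \<open>If 3 divides a, the summands of the norm have different valuations at 3, so divisibility
  by 27 is inherited first by y and then by z; if 3 divides b, the roles are exchanged. If 3 divides
  neither, S gives one of the two divisibilities and the norm the other.\<close>

lemma norm_form_dvd_3:
  fixes a b x y z :: int
  assumes a: "\<not> 9 dvd a" and b: "\<not> 9 dvd b" and ab: "\<not> (3 dvd a \<and> 3 dvd b)" and x: "3 dvd x"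
    and S: "3 dvd x\<^sup>2 - a * b * y * z"
    and N: "27 dvd x ^ 3 + a * b\<^sup>2 * y ^ 3 + a\<^sup>2 * b * z ^ 3 - 3 * a * b * x * y * z"
  shows "3 dvd y \<and> 3 dvd z"
proof -
  have main: "3 dvd y \<and> 3 dvd z" if a: "3 dvd a" "\<not> 9 dvd a" "\<not> 3 dvd b" and x: "3 dvd x"
    and N: "27 dvd x ^ 3 + a * b\<^sup>2 * y ^ 3 + a\<^sup>2 * b * z ^ 3 - 3 * a * b * x * y * z" for a b x y z :: int
  proof -
    obtain u where u: "x = 3 * u" using x by blast
    obtain c where c: "a = 3 * c" using a by blast
    have c3: "\<not> 3 dvd c" using a c by auto
    have "9 * (3 * (u ^ 3 - c * b * u * y * z) + c\<^sup>2 * b * z ^ 3) + 3 * (c * b\<^sup>2 * y ^ 3)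
      = x ^ 3 + a * b\<^sup>2 * y ^ 3 + a\<^sup>2 * b * z ^ 3 - 3 * a * b * x * y * z"
      unfolding u c by Groebner_Basis.algebra
    then have *: "27 dvd 9 * (3 * (u ^ 3 - c * b * u * y * z) + c\<^sup>2 * b * z ^ 3) + 3 * (c * b\<^sup>2 * y ^ 3)"
      using N by simp
    then have "3 dvd c * b\<^sup>2 * y ^ 3" by presburger
    then have "3 dvd y" using c3 a three_dvd_cube by (metis prime_dvd_mult_iff prime_3_int)
    then obtain v where v: "y = 3 * v" by blast
    have "9 * (3 * (u ^ 3 - c * b * u * y * z) + c\<^sup>2 * b * z ^ 3) + 3 * (c * b\<^sup>2 * y ^ 3)
      = 27 * (u ^ 3 - c * b * u * y * z + 3 * (c * b\<^sup>2 * v ^ 3)) + 9 * (c\<^sup>2 * b * z ^ 3)"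
      unfolding v by Groebner_Basis.algebra
    then have "27 dvd 9 * (c\<^sup>2 * b * z ^ 3)" using * by presburger
    then have "3 dvd c\<^sup>2 * b * z ^ 3" by presburger
    then have "3 dvd z" using c3 a three_dvd_cube by (metis prime_dvd_mult_iff prime_3_int)
    then show ?thesis using \<open>3 dvd y\<close> by simp
  qed
  consider "3 dvd a" | "3 dvd b" | "\<not> 3 dvd a" "\<not> 3 dvd b" by blast
  then show ?thesis
  proof cases
    case 1
    then show ?thesis using main[of a b x y z] assms by blast
  next
    case 2
    \<comment> \<open>The form is symmetric under exchanging a with b and y with z
      simultaneously.\<close>
    have "27 dvd x ^ 3 + b * a\<^sup>2 * z ^ 3 + b\<^sup>2 * a * y ^ 3 - 3 * b * a * x * z * y"
      using N by (simp add: algebra_simps)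
    then show ?thesis using main[of b a x z y] 2 assms by blast
  next
    case 3
    have N3: "3 dvd x ^ 3 + a * b\<^sup>2 * y ^ 3 + a\<^sup>2 * b * z ^ 3 - 3 * a * b * x * y * z"
      using N by (rule dvd_trans[rotated]) simp
    obtain u where u: "x = 3 * u" using x by blast
    have "x ^ 3 + a * b\<^sup>2 * y ^ 3 + a\<^sup>2 * b * z ^ 3 - 3 * a * b * x * y * z
        = 3 * (9 * u ^ 3 - a * b * x * y * z) + (a * b\<^sup>2 * y ^ 3 + a\<^sup>2 * b * z ^ 3)"
      unfolding u by Groebner_Basis.algebra
    then have N4: "3 dvd a * b\<^sup>2 * y ^ 3 + a\<^sup>2 * b * z ^ 3" using N3 by presburger
    have "3 dvd x\<^sup>2" using x by (simp add: power2_eq_square)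
    then have "3 dvd a * b * y * z" using S by (simp add: dvd_diff_right_iff)
    then have "3 dvd y \<or> 3 dvd z" using 3 by (simp add: prime_dvd_mult_iff prime_3_int)
    then show ?thesis
    proof
      assume y: "3 dvd y"
      then have "3 dvd a * b\<^sup>2 * y ^ 3" by (simp add: power3_eq_cube)
      then have "3 dvd a\<^sup>2 * b * z ^ 3" using N4 by (simp add: dvd_add_right_iff)
      then show ?thesis using y 3 three_dvd_cube by (metis prime_dvd_mult_iff prime_3_int)
    next
      assume z: "3 dvd z"
      then have "3 dvd a\<^sup>2 * b * z ^ 3" by (simp add: power3_eq_cube)
      then have "3 dvd a * b\<^sup>2 * y ^ 3" using N4 by (simp add: dvd_add_left_iff)
      then show ?thesis using z 3 three_dvd_cube by (metis prime_dvd_mult_iff prime_3_int)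
    qed
  qed
qed

text \<open>The cube of the denominator of y, in lowest terms, divides n.\<close>

lemma cubefree_rational:
  assumes n: "cubefree n" and y: "(y::real) \<in> \<rat>" and int: "real n * y ^ 3 \<in> \<int>"
  shows "y \<in> \<int>"
proof -
  obtain p q :: int where pq: "q > 0" "coprime p q" "y = of_int p / of_int q"
    using y by (auto elim: Rats_cases')
  obtain k where k: "real n * y ^ 3 = of_int k" using int by (auto elim: Ints_cases)
  have "real n * of_int p ^ 3 = of_int k * of_int q ^ 3"
    using k pq by (simp add: power_divide field_simps)
  then have "real_of_int (int n * p ^ 3) = real_of_int (k * q ^ 3)" by simp
  then have eq: "int n * p ^ 3 = k * q ^ 3" by (simp only: of_int_eq_iff)
  have "q ^ 3 dvd int n * p ^ 3" unfolding eq by simp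
  moreover have "coprime (q ^ 3) (p ^ 3)" using pq by (simp add: coprime_commute)
  ultimately have "q ^ 3 dvd int n" by (simp add: coprime_dvd_mult_left_iff)
  then have "nat q ^ 3 dvd n" using pq by (simp add: nat_power_eq[symmetric] nat_dvd_iff flip: int_dvd_int_iff)
  then have "nat q = 1" by (rule cubefreeD[OF n])
  then have "q = 1" using pq(1) by simp
  then show ?thesis using pq(3) by simp
qed

lemma cubefree_square_mult:
  assumes a: "squarefree a" and b: "squarefree b" and c: "coprime a b" "b > 0" "a > 0"
  shows "cubefree (a\<^sup>2 * b)"
  unfolding cubefree_def
proof (intro allI impI notI)
  fix p :: nat assume p: "prime p" "p ^ 3 dvd a\<^sup>2 * b"
  have sq: "\<not> p\<^sup>2 dvd n" if "squarefree n" for n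
    using that p(1) by (metis not_prime_unit squarefree_def)
  show False
  proof (cases "p dvd a")
    case True
    then obtain k where k: "a = p * k" by blast
    have "coprime p b" using True c(1) by (meson coprime_divisors dvd_refl)
    then have "coprime (p ^ 3) b" by simp
    then have "p ^ 3 dvd a\<^sup>2" using p by (simp add: coprime_dvd_mult_left_iff)
    then have "p\<^sup>2 * p dvd p\<^sup>2 * k\<^sup>2" by (simp add: k power_mult_distrib numeral_eq_Suc)
    then obtain r where "p\<^sup>2 * k\<^sup>2 = p\<^sup>2 * (p * r)" by (auto simp: dvd_def mult.assoc)
    then have "k\<^sup>2 = p * r" using p(1) by auto
    then have "p dvd k\<^sup>2" by simp
    then have "p dvd k" using p(1) prime_dvd_power by blast
    then have "p\<^sup>2 dvd a" unfolding k power2_eq_square by (rule mult_dvd_mono[OF dvd_refl])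
    then show False using sq[OF a] by simp
  next
    case False
    then have "coprime (p ^ 3) (a\<^sup>2)" using p(1) by (simp add: prime_imp_coprime)
    then have "p ^ 3 dvd b" using p by (simp add: coprime_dvd_mult_right_iff)
    moreover have "p\<^sup>2 dvd p ^ 3" by (simp add: le_imp_power_dvd)
    ultimately show False using sq[OF b] dvd_trans by blast
  qed
qed

section \<open>Integral elements and the order \<open>O0\<close>\<close>

context pure_cubic_closure
begin

lemma algebraic_int_sigma:
  assumes w: "w \<in> K" and "algebraic_int w"
  shows "algebraic_int (\<sigma> w)"
proof -
  obtain p :: "int poly" where p: "poly (map_poly of_int p) w = 0" "lead_coeff p = 1"
    using assms(2) algebraic_int_altdef_ipoly by blast
  have "poly (map_poly of_int q) w \<in> K \<and> \<sigma> (poly (map_poly of_int q) w) = poly (map_poly of_int q) (\<sigma> w)"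
    for q :: "int poly"
  proof (induction q)
    case 0
    show ?case using is_subfieldD(2)[OF K_subfield] by simp
  next
    case (pCons c q)
    then show ?case
      using w is_subfield_of_int[OF K_subfield, of c] is_subfieldD(4,7)[OF K_subfield]
      by (simp add: map_poly_pCons sigma_add sigma_mult)
  qed
  then have "poly (map_poly of_int p) (\<sigma> w) = 0" using p by (metis sigma_0)
  then show ?thesis using p(2) algebraic_int_altdef_ipoly by blast
qed

lemma OK_iff: "w \<in> OK \<longleftrightarrow> w \<in> K \<and> algebraic_int w"
  by (simp add: maximal_order_def)

lemma OL_iff: "u \<in> OL \<longleftrightarrow> u \<in> L \<and> algebraic_int u"
  by (simp add: maximal_order_def)

lemma OK_mult: "w \<in> OK \<Longrightarrow> w' \<in> OK \<Longrightarrow> w * w' \<in> OK"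
  and OK_add: "w \<in> OK \<Longrightarrow> w' \<in> OK \<Longrightarrow> w + w' \<in> OK"
  and OK_sigma: "w \<in> OK \<Longrightarrow> \<sigma> w \<in> OK"
  and OK_cnj: "w \<in> OK \<Longrightarrow> cnj w \<in> OK"
  and OK_of_real: "u \<in> OL \<Longrightarrow> complex_of_real u \<in> OK"
  by (auto simp: OK_iff OL_iff algebraic_int_mult algebraic_int_add algebraic_int_sigma sigma_K cnj_K
      L_subset_K is_subfieldD(4,7)[OF K_subfield])

lemma OL_mult: "u \<in> OL \<Longrightarrow> v \<in> OL \<Longrightarrow> u * v \<in> OL"
  and OL_power: "u \<in> OL \<Longrightarrow> u ^ n \<in> OL"
  and OL_minus: "u \<in> OL \<Longrightarrow> - u \<in> OL"
  and OL_of_int: "of_int k \<in> OL"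
  by (auto simp: OL_iff algebraic_int_mult algebraic_int_power is_subfieldD[OF L_subfield]
      is_subfield_of_int[OF L_subfield])

lemma OL_cp: "u \<in> OL \<Longrightarrow> cp u \<in> OL"
proof -
  assume u: "u \<in> OL"
  then have "\<sigma> (complex_of_real u) * \<sigma> (\<sigma> (complex_of_real u)) \<in> OK"
    by (intro OK_mult OK_sigma OK_of_real)
  then have "algebraic_int (complex_of_real (cp u))" using u by (simp add: of_real_cp OL_iff OK_iff)
  then show ?thesis using u by (simp add: OL_iff cp_in_L algebraic_int_of_real_iff)
qed

lemma nm_int: "u \<in> OL \<Longrightarrow> nm u \<in> \<int>"
proof -
  assume u: "u \<in> OL"
  then have "nm u \<in> OL" unfolding nm_def by (intro OL_mult OL_cp)
  then show ?thesis using u nm_Rats by (intro rational_algebraic_int_is_int) (simp_all add: OL_iff)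
qed

text \<open>In the sum of the three conjugates the terms with \<open>D\<close> and \<open>E\<close>
  cancel, because 1 + \<zeta> + \<zeta>^2 = 0. What remains is the trace.\<close>

lemma trace_int:
  assumes xyz: "x \<in> \<rat>" "y \<in> \<rat>" "z \<in> \<rat>" and u: "el x y z \<in> OL"
  shows "3 * x \<in> \<int>"
proof -
  have k: "complex_of_real x \<in> k0" "complex_of_real y \<in> k0" "complex_of_real z \<in> k0"
    using xyz Rats_in_k0 of_real_Rats by blast+
  define w where "w = complex_of_real (el x y z)"
  have w: "w \<in> OK" using u OK_of_real by (simp add: w_def)
  have "w + \<sigma> w + \<sigma> (\<sigma> w) = complex_of_real (3 * x)"
    unfolding w_def of_real_el unfolding sigma_sigma_kel[OF k]
    unfolding sigma_kel[OF k] unfolding kel_def of_real_mult of_real_numeral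
    using zeta_zeta by Groebner_Basis.algebra
  then have "algebraic_int (complex_of_real (3 * x))"
    using w OK_add OK_sigma OK_iff by metis
  then have "algebraic_int (3 * x)" by (simp only: algebraic_int_of_real_iff)
  then show ?thesis using xyz by (intro rational_algebraic_int_is_int) auto
qed

lemma a2b_cubefree: "cubefree (a\<^sup>2 * b)"
  using squarefree_a squarefree_b coprime_ab a_ge b_ge by (intro cubefree_square_mult) auto

text \<open>The trace of u, the trace of its adjoint and the norm of u are integers; these are the
  elementary symmetric functions of its conjugates. The first shows that 3 x is an integer, and the
  other two become the displayed divisibilities once the same is known for 3 y and 3 z.\<close>

lemma OL_thirds:
  assumes u: "u \<in> OL"
  obtains x y z :: int where "u = el (of_int x / 3) (of_int y / 3) (of_int z / 3)"
    and "3 dvd x\<^sup>2 - int a * int b * y * z"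
    and "27 dvd x ^ 3 + int a * (int b)\<^sup>2 * y ^ 3 + (int a)\<^sup>2 * int b * z ^ 3 - 3 * int a * int b * x * y * z"
proof -
  have "u \<in> L" using u by (simp add: OL_iff)
  then obtain x y z where xyz: "u = el x y z" "x \<in> \<rat>" "y \<in> \<rat>" "z \<in> \<rat>" by (rule L_cases)
  define A B where "A = real a" and "B = real b"
  have AB: "A \<in> \<int>" "B \<in> \<int>" by (simp_all add: A_def B_def)
  have X: "3 * x \<in> \<int>" using trace_int xyz u by blast
  have "3 * (x * x - A * B * y * z) \<in> \<int>"
    by (rule trace_int[of _ "A * z * z - x * y" "B * y * y - x * z"])
      (use xyz OL_cp[OF u] in \<open>auto simp: cp_el A_def B_def\<close>)
  then obtain S where S: "3 * (x * x - A * B * y * z) = of_int S" by (elim Ints_cases)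
  have "nf x y z \<in> \<int>" using nm_int[OF u] xyz by (simp add: nm_el)
  then obtain N where N: "nf x y z = (of_int N :: real)" by (elim Ints_cases)
  obtain X where X: "3 * x = of_int X" using X by (elim Ints_cases)
  have P: "A * B * (3 * y) * (3 * z) = of_int (X\<^sup>2 - 3 * S)"
    unfolding of_int_diff of_int_add of_int_mult of_int_power of_int_numeral of_int_of_nat_eq S[symmetric] X[symmetric]
    by Groebner_Basis.algebra
  \<comment> \<open>The terms of 27 times the norm that belong to y and z. Their sum and product are
    integers, so they are rational roots of a monic integer polynomial; d and a^2 b being cube-free
    then clears the denominators of 3 y and 3 z.\<close>
  define U V where "U = A * B\<^sup>2 * (3 * y) ^ 3" and "V = A\<^sup>2 * B * (3 * z) ^ 3"
  have UV: "U + V = of_int (27 * N - X ^ 3 + 3 * X * (X\<^sup>2 - 3 * S))"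
    unfolding of_int_diff of_int_add of_int_mult of_int_power of_int_numeral of_int_of_nat_eq S[symmetric] X[symmetric] N[symmetric]
      U_def V_def nf_def A_def B_def
    by Groebner_Basis.algebra
  have "U * V = of_int ((X\<^sup>2 - 3 * S) ^ 3)"
    unfolding of_int_power P[symmetric] U_def V_def by Groebner_Basis.algebra
  then obtain t r where tr: "U + V = of_int t" "U * V = of_int r" using UV by metis
  have Ux: "U \<in> \<rat>" "V \<in> \<rat>" using xyz by (auto simp: U_def V_def A_def B_def)
  have "U * U - of_int t * U + of_int r = 0" unfolding tr[symmetric] by Groebner_Basis.algebra
  moreover have "V * V - of_int t * V + of_int r = 0" unfolding tr[symmetric] by Groebner_Basis.algebra
  ultimately have "poly [:of_int r, - of_int t, 1:] U = 0" "poly [:of_int r, - of_int t, 1:] V = 0"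
    by (simp_all add: algebra_simps)
  moreover have "\<forall>i. coeff [:of_int r, - of_int t, 1 :: real:] i \<in> \<int>"
    by (auto simp: coeff_pCons split: nat.splits)
  ultimately have "algebraic_int U" "algebraic_int V"
    by (auto intro!: algebraic_int.intros[of "[:of_int r, - of_int t, 1 :: real:]"])
  then have UVint: "U \<in> \<int>" "V \<in> \<int>" using Ux rational_algebraic_int_is_int by blast+
  have "3 * y \<in> \<int>"
    by (rule cubefree_rational[OF d_cubefree]) (use UVint xyz in \<open>auto simp: U_def A_def B_def d_eq\<close>)
  then obtain Y where Y: "3 * y = of_int Y" by (elim Ints_cases)
  have "3 * z \<in> \<int>"
    by (rule cubefree_rational[OF a2b_cubefree]) (use UVint xyz in \<open>auto simp: V_def A_def B_def\<close>)
  then obtain Z where Z: "3 * z = of_int Z" by (elim Ints_cases)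
  have "real_of_int (X\<^sup>2 - int a * int b * Y * Z) = real_of_int (3 * S)"
    unfolding of_int_diff of_int_add of_int_mult of_int_power of_int_numeral of_int_of_nat_eq S[symmetric] X[symmetric] Y[symmetric] Z[symmetric]
      A_def B_def
    by Groebner_Basis.algebra
  then have 1: "X\<^sup>2 - int a * int b * Y * Z = 3 * S" by (simp only: of_int_eq_iff)
  have "real_of_int (X ^ 3 + int a * (int b)\<^sup>2 * Y ^ 3 + (int a)\<^sup>2 * int b * Z ^ 3 - 3 * int a * int b * X * Y * Z)
      = real_of_int (27 * N)"
    unfolding of_int_diff of_int_add of_int_mult of_int_power of_int_numeral of_int_of_nat_eq N[symmetric] X[symmetric] Y[symmetric] Z[symmetric]
      nf_def
    by Groebner_Basis.algebra
  then have 2: "X ^ 3 + int a * (int b)\<^sup>2 * Y ^ 3 + (int a)\<^sup>2 * int b * Z ^ 3 - 3 * int a * int b * X * Y * Z = 27 * N"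
    by (simp only: of_int_eq_iff)
  have "x = of_int X / 3" "y = of_int Y / 3" "z = of_int Z / 3" using X Y Z by simp_all
  then have "u = el (of_int X / 3) (of_int Y / 3) (of_int Z / 3)" by (simp only: xyz(1))
  then show thesis by (rule that) (simp_all only: 1 2 dvd_triv_left)
qed

abbreviation "O0 \<equiv> order0 d a b"

lemma O0_iff: "u \<in> O0 \<longleftrightarrow> (\<exists>x y z :: int. u = el (of_int x) (of_int y) (of_int z))"
  by (simp add: order0_def el_def)

lemma O0I: "el (of_int x) (of_int y) (of_int z) \<in> O0"
  unfolding O0_iff by blast

lemma O0E:
  assumes "u \<in> O0"
  obtains x y z :: int where "u = el (of_int x) (of_int y) (of_int z)"
  using assms unfolding O0_iff by blast

lemma D_alg_int: "algebraic_int D"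
  by (rule algebraic_int_power_imp[of D 3]) (simp_all add: D_cubed algebraic_int_mult algebraic_int_power int_imp_algebraic_int)

lemma E_alg_int: "algebraic_int E"
  by (rule algebraic_int_power_imp[of E 3]) (simp_all add: E_cubed algebraic_int_mult algebraic_int_power int_imp_algebraic_int)

lemma O0_subset_OL: "u \<in> O0 \<Longrightarrow> u \<in> OL"
proof (elim O0E)
  fix x y z :: int assume "u = el (of_int x) (of_int y) (of_int z)"
  then show "u \<in> OL"
    using el_in_L by (simp add: OL_iff el_def algebraic_int_add algebraic_int_mult D_alg_int E_alg_int)
qed

lemma O0_mult: "u \<in> O0 \<Longrightarrow> v \<in> O0 \<Longrightarrow> u * v \<in> O0"
proof (elim O0E)
  fix x y z x' y' z' :: int
  assume "u = el (of_int x) (of_int y) (of_int z)" "v = el (of_int x') (of_int y') (of_int z')"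
  then have "u * v = el (of_int (x * x' + int a * int b * (y * z' + z * y')))
      (of_int (x * y' + y * x' + int a * z * z')) (of_int (x * z' + z * x' + int b * y * y'))"
    by (simp add: el_mult)
  then show "u * v \<in> O0" by (simp only: O0I)
qed

lemma O0_cp: "u \<in> O0 \<Longrightarrow> cp u \<in> O0"
proof (elim O0E)
  fix x y z :: int
  assume "u = el (of_int x) (of_int y) (of_int z)"
  then have "cp u = el (of_int (x * x - int a * int b * y * z))
      (of_int (int a * z * z - x * y)) (of_int (int b * y * y - x * z))"
    by (simp add: cp_el)
  then show "cp u \<in> O0" by (simp only: O0I)
qed

lemma O0_diff: "u \<in> O0 \<Longrightarrow> v \<in> O0 \<Longrightarrow> u - v \<in> O0"
proof (elim O0E)
  fix x y z x' y' z' :: int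
  assume "u = el (of_int x) (of_int y) (of_int z)" "v = el (of_int x') (of_int y') (of_int z')"
  then have "u - v = el (of_int (x - x')) (of_int (y - y')) (of_int (z - z'))"
    by (simp add: el_diff)
  then show "u - v \<in> O0" by (simp only: O0I)
qed

lemma O0_of_int: "of_int k \<in> O0"
  using O0I[of k 0 0] by (simp add: el_def)

lemma O0_minus: "u \<in> O0 \<Longrightarrow> - u \<in> O0"
  using O0_diff[of 0 u] O0_of_int[of 0] by simp

lemma O0_add: "u \<in> O0 \<Longrightarrow> v \<in> O0 \<Longrightarrow> u + v \<in> O0"
  using O0_diff[of u "- v"] O0_minus by simp

lemma O0_D: "D \<in> O0" and O0_E: "E \<in> O0"
  using O0I[of 0 1 0] O0I[of 0 0 1] by (simp_all add: el_def)

lemma O0_in_L: "u \<in> O0 \<Longrightarrow> u \<in> L"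
  using O0_subset_OL OL_iff by blast

lemma OL_triple: "u \<in> OL \<Longrightarrow> 3 * u \<in> O0"
  by (elim OL_thirds) (simp add: el_scale O0I)

lemma not_9_dvd: "\<not> 9 dvd int a" "\<not> 9 dvd int b"
proof -
  have *: "\<not> 9 dvd int n" if "squarefree n" for n
  proof
    assume "9 dvd int n"
    then have "9 dvd n" by presburger
    then have "3\<^sup>2 dvd n" by simp
    then have "is_unit (3 :: nat)" by (rule squarefreeD[OF that])
    then show False by simp
  qed
  show "\<not> 9 dvd int a" "\<not> 9 dvd int b" using * squarefree_a squarefree_b by blast+
qed

lemma not_3_dvd_both: "\<not> (3 dvd int a \<and> 3 dvd int b)"
proof
  assume "3 dvd int a \<and> 3 dvd int b"
  then have "3 dvd a" "3 dvd b" by presburger+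
  then have "3 dvd gcd a b" by simp
  then show False using coprime_ab by simp
qed

text \<open>The numerator x is the trace, so \<open>norm_form_dvd_3\<close> applies and cancels the
  remaining denominators.\<close>

lemma OL_trace_3_imp_O0:
  assumes u: "el (of_int x / 3) (of_int y / 3) (of_int z / 3) \<in> OL" and x: "3 dvd x"
  shows "el (of_int x / 3) (of_int y / 3) (of_int z / 3) \<in> O0"
proof -
  obtain x' y' z' where *: "el (of_int x / 3) (of_int y / 3) (of_int z / 3)
      = el (of_int x' / 3) (of_int y' / 3) (of_int z' / 3)"
    "3 dvd x'\<^sup>2 - int a * int b * y' * z'"
    "27 dvd x' ^ 3 + int a * (int b)\<^sup>2 * y' ^ 3 + (int a)\<^sup>2 * int b * z' ^ 3 - 3 * int a * int b * x' * y' * z'"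
    using u by (rule OL_thirds)
  then have eq: "x' = x" "y' = y" "z' = z" by (simp_all add: el_inject)
  have "3 dvd y \<and> 3 dvd z"
    using norm_form_dvd_3[OF not_9_dvd not_3_dvd_both x] *(2,3) unfolding eq by blast
  then obtain u v w where "x = 3 * u" "y = 3 * v" "z = 3 * w" using x by (metis dvdE)
  then show ?thesis by (simp add: O0I)
qed

text \<open>An integral element with trace prime to 3 would make ab prime to 3, and the norm
  congruence modulo 27 would then put d into one of the residue classes excluded here.\<close>

lemma OL_eq_O0:
  assumes "d mod 9 \<notin> {1, 8}"
  shows "OL = O0"
proof
  show "O0 \<subseteq> OL" using O0_subset_OL by blast
  show "OL \<subseteq> O0"
  proof
    fix u assume u: "u \<in> OL"
    then obtain x y z where *: "u = el (of_int x / 3) (of_int y / 3) (of_int z / 3)"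
      "3 dvd x\<^sup>2 - int a * int b * y * z"
      "27 dvd x ^ 3 + int a * (int b)\<^sup>2 * y ^ 3 + (int a)\<^sup>2 * int b * z ^ 3 - 3 * int a * int b * x * y * z"
      by (rule OL_thirds)
    have "3 dvd x"
    proof (rule ccontr)
      assume x: "\<not> 3 dvd x"
      have ab: "\<not> 3 dvd int a" "\<not> 3 dvd int b"
      proof -
        have "3 dvd x" if "3 dvd int a \<or> 3 dvd int b"
        proof -
          have "3 dvd int a * int b * y * z" using that by auto
          then have "3 dvd x\<^sup>2" using *(2) by (metis dvd_diffD1 diff_add_cancel dvd_add)
          then show ?thesis by (rule three_dvd_cube)
        qed
        then show "\<not> 3 dvd int a" "\<not> 3 dvd int b" using x by blast+
      qed
      have "9 dvd int a * (int b)\<^sup>2 - 1 \<or> 9 dvd int a * (int b)\<^sup>2 + 1"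
        by (rule norm_form_not_dvd_3[OF ab x *(2,3)])
      then have "9 dvd int d - 1 \<or> 9 dvd int d + 1" by (simp add: d_eq)
      then have "d mod 9 = 1 \<or> d mod 9 = 8" by presburger
      then show False using assms by simp
    qed
    then show "u \<in> O0" using OL_trace_3_imp_O0 *(1) u by blast
  qed
qed

end

section \<open>Ramified primes\<close>

lemma squarefree_int_prime:
  assumes "squarefree n" and p: "prime (p :: int)"
  shows "\<not> p\<^sup>2 dvd int n"
proof
  assume dvd: "p\<^sup>2 dvd int n"
  define q where "q = nat p"
  have q: "p = int q" using p by (simp add: q_def prime_ge_0_int)
  have "int (q\<^sup>2) dvd int n" using dvd by (simp add: q)
  then have "q\<^sup>2 dvd n" by (simp only: int_dvd_int_iff)
  then have "q dvd 1" by (rule squarefreeD[OF assms(1)])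
  then show False using p q by simp
qed

lemma prime_cube_dvd_square:
  assumes p: "prime (p :: int)" and sqf: "\<not> p\<^sup>2 dvd r"
  shows "\<not> p ^ 3 dvd r\<^sup>2"
proof
  assume dvd: "p ^ 3 dvd r\<^sup>2"
  have "p dvd p ^ 3" by simp
  then have "p dvd r" using dvd prime_dvd_power[OF p] dvd_trans by blast
  then obtain k where k: "r = p * k" by blast
  obtain t where t: "r\<^sup>2 = p ^ 3 * t" using dvd by blast
  have "p\<^sup>2 * k\<^sup>2 = p\<^sup>2 * (p * t)" using t unfolding k by Groebner_Basis.algebra
  then have "k\<^sup>2 = p * t" using p by auto
  then have "p dvd k\<^sup>2" by simp
  then have "p dvd k" by (rule prime_dvd_power[OF p])
  then have "p\<^sup>2 dvd r" unfolding k power2_eq_square by (rule mult_dvd_mono[OF dvd_refl])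
  then show False using sqf by simp
qed

lemma dvd_by_prime_powers:
  assumes n: "n \<noteq> (0::int)" and pk: "\<And>p k. prime p \<Longrightarrow> p ^ k dvd n \<Longrightarrow> p ^ k dvd c"
  shows "n dvd c"
proof (cases "c = 0")
  case False
  show ?thesis
  proof (rule multiplicity_le_imp_dvd[OF n])
    fix p :: int assume p: "prime p"
    have "p ^ multiplicity p n dvd c" by (rule pk[OF p multiplicity_dvd])
    then show "multiplicity p n \<le> multiplicity p c"
      using False p by (intro multiplicity_geI) auto
  qed
qed simp

text \<open>The conclusions concern one third of the last two coordinates of a cube, see
  \<open>el_power3\<close>. With signs normalised, the form is x^3 + Y^3 + Z^3 - 3 x Y Z + 3 (k -
  m)(Y^3 - Z^3) modulo 9. Its first part has the factor x + Y + Z, which is divisible by 3 along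
  with the cofactor. As d is not +-1 modulo 9, 3 does not divide k - m; so x, Y and Z agree modulo
  3, and each claim is about a sum of three equal residues.\<close>

lemma norm_form_mod_9:
  fixes a b x y z :: int
  assumes a: "\<not> 3 dvd a" and b: "\<not> 3 dvd b" and d: "\<not> 9 dvd a * b\<^sup>2 - 1" "\<not> 9 dvd a * b\<^sup>2 + 1"
    and N: "9 dvd x ^ 3 + a * b\<^sup>2 * y ^ 3 + a\<^sup>2 * b * z ^ 3 - 3 * a * b * x * y * z"
  shows "3 dvd x\<^sup>2 * y + a * x * z\<^sup>2 + a * b * y\<^sup>2 * z" and "3 dvd x\<^sup>2 * z + b * x * y\<^sup>2 + a * b * y * z\<^sup>2"
proof -
  have sgn: "\<exists>e k. (e = 1 \<or> e = -1) \<and> e * u = 1 + 3 * k" if "\<not> 3 dvd u" for u :: int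
  proof -
    have "(\<exists>k. u = 1 + 3 * k) \<or> (\<exists>k. - u = 1 + 3 * k)" using that by presburger
    then show ?thesis by (metis mult_1 mult_minus1)
  qed
  obtain s k where s: "s = 1 \<or> s = -1" and k: "s * a = 1 + 3 * k" using sgn[OF a] by blast
  obtain t m where t: "t = 1 \<or> t = -1" and m: "t * b = 1 + 3 * m" using sgn[OF b] by blast
  have sq: "s * s = 1" "t * t = 1" using s t by auto
  define Y Z where "Y = s * y" and "Z = t * z"
  have aA: "a = s * (1 + 3 * k)" and bB: "b = t * (1 + 3 * m)" using k m sq by Groebner_Basis.algebra+
  have yY: "y = s * Y" and zZ: "z = t * Z" unfolding Y_def Z_def using sq by Groebner_Basis.algebra+
  obtain n where n: "x ^ 3 + a * b\<^sup>2 * y ^ 3 + a\<^sup>2 * b * z ^ 3 - 3 * a * b * x * y * z = 9 * n"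
    using N by blast
  have eq: "x ^ 3 + a * b\<^sup>2 * y ^ 3 + a\<^sup>2 * b * z ^ 3 - 3 * a * b * x * y * z
    = x ^ 3 + Y ^ 3 + Z ^ 3 - 3 * x * Y * Z + 3 * (k - m) * (Y ^ 3 - Z ^ 3)
      + 9 * ((m + 2 * k * m + m\<^sup>2 + 3 * k * m\<^sup>2) * Y ^ 3 + (k + 2 * k * m + k\<^sup>2 + 3 * k\<^sup>2 * m) * Z ^ 3
        - (k + m + 3 * k * m) * x * Y * Z)"
    unfolding aA bB yY zZ using sq by Groebner_Basis.algebra
  obtain c1 c2 c3 where c: "x ^ 3 - x = 3 * c1" "Y ^ 3 - Y = 3 * c2" "Z ^ 3 - Z = 3 * c3"
    using cube_mod_3 unfolding dvd_def by metis
  define w where "w = 3 * n - c1 - c2 - c3 + x * Y * Z - (k - m) * (Y ^ 3 - Z ^ 3)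
      - 3 * ((m + 2 * k * m + m\<^sup>2 + 3 * k * m\<^sup>2) * Y ^ 3 + (k + 2 * k * m + k\<^sup>2 + 3 * k\<^sup>2 * m) * Z ^ 3
        - (k + m + 3 * k * m) * x * Y * Z)"
  have "x + Y + Z = 3 * w" using n eq c unfolding w_def by Groebner_Basis.algebra
  then have x: "x = 3 * w - Y - Z" by simp
  have "3 * ((k - m) * (Y ^ 3 - Z ^ 3)) = 9 * (n
      - ((m + 2 * k * m + m\<^sup>2 + 3 * k * m\<^sup>2) * Y ^ 3 + (k + 2 * k * m + k\<^sup>2 + 3 * k\<^sup>2 * m) * Z ^ 3
        - (k + m + 3 * k * m) * x * Y * Z) - w * (3 * w\<^sup>2 - (x * Y + Y * Z + Z * x)))"
    using n eq x by Groebner_Basis.algebra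
  then have "3 dvd (k - m) * (Y ^ 3 - Z ^ 3)" by presburger
  moreover have "\<not> 3 dvd k - m"
  proof
    assume "3 dvd k - m"
    then obtain r where r: "k = m + 3 * r" by (metis dvdE diff_add_cancel add.commute)
    have "a * b\<^sup>2 = s * (1 + 9 * (m + r + 3 * m\<^sup>2 + 6 * r * m + 9 * r * m\<^sup>2 + 3 * m ^ 3))"
      unfolding aA bB r using sq by Groebner_Basis.algebra
    then show False using s d by (auto simp: algebra_simps)
  qed
  ultimately have "3 dvd Y ^ 3 - Z ^ 3" by (simp add: prime_dvd_mult_iff prime_3_int)
  then obtain g where g: "Y ^ 3 - Z ^ 3 = 3 * g" by blast
  have YZ: "Y = Z + 3 * (g - c2 + c3)" using g c by Groebner_Basis.algebra
  define h where "h = g - c2 + c3"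
  have Y: "Y = Z + 3 * h" using YZ by (simp add: h_def)
  have xh: "x = Z + 3 * (w - h - Z)" using x Y by simp
  define v where "v = w - h - Z"
  have xv: "x = Z + 3 * v" using xh by (simp add: v_def)
  have "x\<^sup>2 * y + a * x * z\<^sup>2 + a * b * y\<^sup>2 * z = s * (x\<^sup>2 * Y + (1 + 3 * k) * x * Z\<^sup>2 + (1 + 3 * k) * (1 + 3 * m) * Y\<^sup>2 * Z)"
    unfolding aA bB yY zZ using sq by Groebner_Basis.algebra
  also have "x\<^sup>2 * Y + (1 + 3 * k) * x * Z\<^sup>2 + (1 + 3 * k) * (1 + 3 * m) * Y\<^sup>2 * Z
      = 3 * (Z ^ 3 + h * x\<^sup>2 + Z * (2 * Z * v + 3 * v\<^sup>2) + k * x * Z\<^sup>2 + v * Z\<^sup>2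
        + (k + m + 3 * k * m) * Y\<^sup>2 * Z + Z * (2 * Z * h + 3 * h\<^sup>2))"
    unfolding Y xv by Groebner_Basis.algebra
  finally show "3 dvd x\<^sup>2 * y + a * x * z\<^sup>2 + a * b * y\<^sup>2 * z" by simp
  have "x\<^sup>2 * z + b * x * y\<^sup>2 + a * b * y * z\<^sup>2 = t * (x\<^sup>2 * Z + (1 + 3 * m) * x * Y\<^sup>2 + (1 + 3 * k) * (1 + 3 * m) * Y * Z\<^sup>2)"
    unfolding aA bB yY zZ using sq by Groebner_Basis.algebra
  also have "x\<^sup>2 * Z + (1 + 3 * m) * x * Y\<^sup>2 + (1 + 3 * k) * (1 + 3 * m) * Y * Z\<^sup>2
      = 3 * (Z ^ 3 + Z * (2 * Z * v + 3 * v\<^sup>2) + v * Y\<^sup>2 + Z * (2 * Z * h + 3 * h\<^sup>2) + m * x * Y\<^sup>2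
        + (k + m + 3 * k * m) * Y * Z\<^sup>2 + h * Z\<^sup>2)"
    unfolding Y xv by Groebner_Basis.algebra
  finally show "3 dvd x\<^sup>2 * z + b * x * y\<^sup>2 + a * b * y * z\<^sup>2" by simp
qed

text \<open>A prime \<open>p\<close> dividing \<open>a\<close> is totally ramified: the valuations of the three summands of an
  element are pairwise incongruent modulo 3.\<close>

lemma norm_form_cube_dvd_prime:
  fixes a b x y z p :: int
  assumes p: "prime p" and pa: "p dvd a" "\<not> p\<^sup>2 dvd a" and pb: "\<not> p dvd b" and k: "k \<le> 2"
    and N: "p ^ k dvd x ^ 3 + a * b\<^sup>2 * y ^ 3 + a\<^sup>2 * b * z ^ 3 - 3 * a * b * x * y * z"
  shows "p ^ k dvd 9 * a * b * x * y * z" and "p ^ k dvd x\<^sup>2 * y + a * x * z\<^sup>2 + a * b * y\<^sup>2 * z"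
    and "p ^ k dvd x\<^sup>2 * z + b * x * y\<^sup>2 + a * b * y * z\<^sup>2"
proof -
  obtain c where c: "a = p * c" using pa by blast
  have pc: "\<not> p dvd c" using pa(2) unfolding c power2_eq_square by (metis mult_dvd_mono dvd_refl)
  have p0: "p \<noteq> 0" using p by auto
  have px: "p dvd x" if pN: "p dvd x ^ 3 + a * b\<^sup>2 * y ^ 3 + a\<^sup>2 * b * z ^ 3 - 3 * a * b * x * y * z"
  proof -
    obtain n where n: "x ^ 3 + a * b\<^sup>2 * y ^ 3 + a\<^sup>2 * b * z ^ 3 - 3 * a * b * x * y * z = p * n" using pN by blast
    have "x ^ 3 = p * (n - c * b\<^sup>2 * y ^ 3 - p * c\<^sup>2 * b * z ^ 3 + 3 * c * b * x * y * z)"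
      using n unfolding c by Groebner_Basis.algebra
    then have "p dvd x ^ 3" by simp
    then show ?thesis by (rule prime_dvd_power[OF p])
  qed
  have "k = 0 \<or> k = 1 \<or> k = 2" using k by auto
  then have "p ^ k dvd 9 * a * b * x * y * z \<and> p ^ k dvd x\<^sup>2 * y + a * x * z\<^sup>2 + a * b * y\<^sup>2 * z
    \<and> p ^ k dvd x\<^sup>2 * z + b * x * y\<^sup>2 + a * b * y * z\<^sup>2"
  proof (elim disjE)
    assume k1: "k = 1"
    then obtain u where u: "x = p * u" using px N by auto
    have "9 * a * b * x * y * z = p * (9 * c * b * x * y * z)"
      "x\<^sup>2 * y + a * x * z\<^sup>2 + a * b * y\<^sup>2 * z = p * (u * x * y + c * x * z\<^sup>2 + c * b * y\<^sup>2 * z)"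
      "x\<^sup>2 * z + b * x * y\<^sup>2 + a * b * y * z\<^sup>2 = p * (u * x * z + b * u * y\<^sup>2 + c * b * y * z\<^sup>2)"
      unfolding u c by Groebner_Basis.algebra+
    then show ?thesis using k1 by (metis dvd_triv_left power_one_right)
  next
    assume k2: "k = 2"
    then have N2: "p\<^sup>2 dvd x ^ 3 + a * b\<^sup>2 * y ^ 3 + a\<^sup>2 * b * z ^ 3 - 3 * a * b * x * y * z" using N by simp
    then have "p dvd x" using px by (metis dvd_trans dvd_triv_left power2_eq_square)
    then obtain u where u: "x = p * u" by blast
    obtain n where n: "x ^ 3 + a * b\<^sup>2 * y ^ 3 + a\<^sup>2 * b * z ^ 3 - 3 * a * b * x * y * z = p\<^sup>2 * n" using N2 by blast
    have "p * (c * b\<^sup>2 * y ^ 3) = p * (p * (n - p * u ^ 3 - c\<^sup>2 * b * z ^ 3 + 3 * c * b * u * y * z))"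
      using n unfolding c u by Groebner_Basis.algebra
    then have "c * b\<^sup>2 * y ^ 3 = p * (n - p * u ^ 3 - c\<^sup>2 * b * z ^ 3 + 3 * c * b * u * y * z)" using p0 by simp
    then have "p dvd c * b\<^sup>2 * y ^ 3" by simp
    then have "p dvd y" using pc pb p by (meson prime_dvd_mult_iff prime_dvd_power)
    then obtain v where v: "y = p * v" by blast
    have "9 * a * b * x * y * z = p\<^sup>2 * (9 * c * b * u * y * z)"
      "x\<^sup>2 * y + a * x * z\<^sup>2 + a * b * y\<^sup>2 * z = p\<^sup>2 * (u\<^sup>2 * y + c * u * z\<^sup>2 + c * b * v * y * z)"
      "x\<^sup>2 * z + b * x * y\<^sup>2 + a * b * y * z\<^sup>2 = p\<^sup>2 * (u\<^sup>2 * z + b * x * v\<^sup>2 + c * b * v * z\<^sup>2)"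
      unfolding u v c by Groebner_Basis.algebra+
    then show ?thesis using k2 by (metis dvd_triv_left)
  qed simp
  then show "p ^ k dvd 9 * a * b * x * y * z" and "p ^ k dvd x\<^sup>2 * y + a * x * z\<^sup>2 + a * b * y\<^sup>2 * z"
    and "p ^ k dvd x\<^sup>2 * z + b * x * y\<^sup>2 + a * b * y * z\<^sup>2" by blast+
qed

text \<open>The three right sides are the coordinates of the cube of the element x + y D + z E, so
  this says that the cube divided by the norm n stays in the order. It is checked one prime power at
  a time; exponents are at most 2 because r is squarefree.\<close>

lemma norm_form_cube_dvd:
  fixes a b x y z n r :: int
  assumes sqf: "\<And>p. prime p \<Longrightarrow> \<not> p\<^sup>2 dvd a" "\<And>p. prime p \<Longrightarrow> \<not> p\<^sup>2 dvd b" "\<And>p. prime p \<Longrightarrow> \<not> p\<^sup>2 dvd r"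
    and cop: "\<And>p. prime p \<Longrightarrow> \<not> (p dvd a \<and> p dvd b)"
    and r: "r = a * b \<or> (r = 3 * a * b \<and> \<not> 9 dvd a * b\<^sup>2 - 1 \<and> \<not> 9 dvd a * b\<^sup>2 + 1)"
    and n: "n = x ^ 3 + a * b\<^sup>2 * y ^ 3 + a\<^sup>2 * b * z ^ 3 - 3 * a * b * x * y * z" "n \<noteq> 0" "n dvd r\<^sup>2"
  shows "n dvd n + 9 * a * b * x * y * z" and "n dvd 3 * (x\<^sup>2 * y + a * x * z\<^sup>2 + a * b * y\<^sup>2 * z)"
    and "n dvd 3 * (x\<^sup>2 * z + b * x * y\<^sup>2 + a * b * y * z\<^sup>2)"
proof -
  have main: "p ^ k dvd 9 * a * b * x * y * z \<and> p ^ k dvd 3 * (x\<^sup>2 * y + a * x * z\<^sup>2 + a * b * y\<^sup>2 * z)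
    \<and> p ^ k dvd 3 * (x\<^sup>2 * z + b * x * y\<^sup>2 + a * b * y * z\<^sup>2)"
    if p: "prime p" and pk: "p ^ k dvd n" for p k
  proof (cases "k = 0")
    case False
    have "p ^ k dvd r\<^sup>2" using pk n(3) by (rule dvd_trans)
    have k2: "k \<le> 2"
    proof (rule ccontr)
      assume "\<not> k \<le> 2"
      then have "p ^ 3 dvd p ^ k" by (intro le_imp_power_dvd) simp
      then have "p ^ 3 dvd r\<^sup>2" using \<open>p ^ k dvd r\<^sup>2\<close> dvd_trans by blast
      then show False using prime_cube_dvd_square[OF p sqf(3)[OF p]] by simp
    qed
    have "p dvd p ^ k" using False by simp
    then have "p dvd r\<^sup>2" using \<open>p ^ k dvd r\<^sup>2\<close> dvd_trans by blast
    then have "p dvd r" by (rule prime_dvd_power[OF p])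
    have pkN: "p ^ k dvd x ^ 3 + a * b\<^sup>2 * y ^ 3 + a\<^sup>2 * b * z ^ 3 - 3 * a * b * x * y * z" using pk n(1) by simp
    show ?thesis
    proof (cases "p dvd a")
      case True
      then have pb: "\<not> p dvd b" using cop[OF p] by blast
      note * = norm_form_cube_dvd_prime[OF p True sqf(1)[OF p] pb k2 pkN]
      show ?thesis using *(1) dvd_mult[OF *(2)] dvd_mult[OF *(3)] by blast
    next
      case pa: False
      show ?thesis
      proof (cases "p dvd b")
        case True
        have pkN': "p ^ k dvd x ^ 3 + b * a\<^sup>2 * z ^ 3 + b\<^sup>2 * a * y ^ 3 - 3 * b * a * x * z * y"
          using pkN by (simp add: algebra_simps)
        have "p ^ k dvd 9 * b * a * x * z * y" "p ^ k dvd x\<^sup>2 * z + b * x * y\<^sup>2 + b * a * z\<^sup>2 * y"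
          "p ^ k dvd x\<^sup>2 * y + a * x * z\<^sup>2 + b * a * z * y\<^sup>2"
          by (rule norm_form_cube_dvd_prime[OF p True sqf(2)[OF p] pa k2 pkN'])+
        moreover have "9 * b * a * x * z * y = 9 * a * b * x * y * z"
          "x\<^sup>2 * z + b * x * y\<^sup>2 + b * a * z\<^sup>2 * y = x\<^sup>2 * z + b * x * y\<^sup>2 + a * b * y * z\<^sup>2"
          "x\<^sup>2 * y + a * x * z\<^sup>2 + b * a * z * y\<^sup>2 = x\<^sup>2 * y + a * x * z\<^sup>2 + a * b * y\<^sup>2 * z"
          by Groebner_Basis.algebra+
        ultimately have *: "p ^ k dvd 9 * a * b * x * y * z" "p ^ k dvd x\<^sup>2 * y + a * x * z\<^sup>2 + a * b * y\<^sup>2 * z"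
          "p ^ k dvd x\<^sup>2 * z + b * x * y\<^sup>2 + a * b * y * z\<^sup>2" by (simp_all only:)
        show ?thesis using *(1) dvd_mult[OF *(2)] dvd_mult[OF *(3)] by blast
      next
        case pb: False
        \<comment> \<open>A prime divisor of r that divides neither a nor b can only be the
          additional factor 3 of the ramification invariant.\<close>
        have r3: "r = 3 * a * b" "\<not> 9 dvd a * b\<^sup>2 - 1" "\<not> 9 dvd a * b\<^sup>2 + 1"
          using r \<open>p dvd r\<close> pa pb p by (auto simp: prime_dvd_mult_iff)
        then have "p dvd 3" using \<open>p dvd r\<close> pa pb p by (auto simp: prime_dvd_mult_iff)
        then have p3: "p = 3" using p primes_dvd_imp_eq prime_3_int by blast
        show ?thesis
        proof (cases "k = 1")
          case True
          then show ?thesis using p3 by (simp add: mult.assoc)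
        next
          case False
          then have k: "k = 2" using k2 \<open>k \<noteq> 0\<close> by simp
          have "9 dvd x ^ 3 + a * b\<^sup>2 * y ^ 3 + a\<^sup>2 * b * z ^ 3 - 3 * a * b * x * y * z"
            using pkN k p3 by simp
          from norm_form_mod_9[OF _ _ r3(2,3) this]
          have "3 * 3 dvd 3 * (x\<^sup>2 * y + a * x * z\<^sup>2 + a * b * y\<^sup>2 * z)"
            "3 * 3 dvd 3 * (x\<^sup>2 * z + b * x * y\<^sup>2 + a * b * y * z\<^sup>2)"
            using pa pb p3 by (auto simp only: dvd_mult_cancel_left)
          then show ?thesis using k p3 by (simp add: mult.assoc)
        qed
      qed
    qed
  qed simp
  show "n dvd n + 9 * a * b * x * y * z"
    using dvd_by_prime_powers[OF n(2), of "9 * a * b * x * y * z"] main by simp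
  show "n dvd 3 * (x\<^sup>2 * y + a * x * z\<^sup>2 + a * b * y\<^sup>2 * z)"
    by (rule dvd_by_prime_powers[OF n(2)]) (use main in blast)
  show "n dvd 3 * (x\<^sup>2 * z + b * x * y\<^sup>2 + a * b * y * z\<^sup>2)"
    by (rule dvd_by_prime_powers[OF n(2)]) (use main in blast)
qed

section \<open>Units and invariant ideals\<close>

lemma ring_units_iff:
  "u \<in> ring_units A \<longleftrightarrow> u \<in> A \<and> u \<noteq> 0 \<and> inverse u \<in> A"
proof
  assume "u \<in> ring_units A"
  then obtain v where v: "u \<in> A" "v \<in> A" "u * v = 1" unfolding ring_units_def by blast
  then have "inverse u = v" by (intro inverse_unique)
  then show "u \<in> A \<and> u \<noteq> 0 \<and> inverse u \<in> A" using v by auto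
next
  assume "u \<in> A \<and> u \<noteq> 0 \<and> inverse u \<in> A"
  then show "u \<in> ring_units A" unfolding ring_units_def by (auto intro!: bexI[of _ "inverse u"])
qed

lemma ring_units_inverse: "u \<in> ring_units A \<Longrightarrow> inverse u \<in> ring_units A"
  by (simp add: ring_units_iff)

lemma mult_subgroup_generated_least:
  assumes "1 \<in> H" "\<And>x y. x \<in> H \<Longrightarrow> y \<in> H \<Longrightarrow> x * y \<in> H" "\<And>x. x \<in> H \<Longrightarrow> inverse x \<in> H" "S \<subseteq> H"
  shows "mult_subgroup_generated S \<subseteq> H"
  using assms unfolding mult_subgroup_generated_def by (intro Inter_lower) simp

lemma mult_subgroup_generated_subgroup:
  shows "1 \<in> mult_subgroup_generated S"
    and "x \<in> mult_subgroup_generated S \<Longrightarrow> y \<in> mult_subgroup_generated S \<Longrightarrow> x * y \<in> mult_subgroup_generated S"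
    and "x \<in> mult_subgroup_generated S \<Longrightarrow> inverse x \<in> mult_subgroup_generated S"
    and "x \<in> S \<Longrightarrow> x \<in> mult_subgroup_generated S"
  unfolding mult_subgroup_generated_def by auto

lemma principal_idealI: "v \<in> A \<Longrightarrow> x * v \<in> principal_ideal A x"
  unfolding principal_ideal_def by (rule imageI)

lemma principal_idealE:
  assumes "t \<in> principal_ideal A x"
  obtains v where "v \<in> A" "t = x * v"
  using assms unfolding principal_ideal_def by (elim imageE)

section \<open>Units, invariant elements and trivial factors\<close>

context pure_cubic_closure
begin

abbreviation "EK \<equiv> ring_units OK"
abbreviation "EL \<equiv> ring_units OL"
abbreviation "U0 \<equiv> ring_units O0"

lemma EL_mult: "u \<in> EL \<Longrightarrow> v \<in> EL \<Longrightarrow> u * v \<in> EL"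
  by (simp add: ring_units_iff OL_mult)

lemma EK_mult: "u \<in> EK \<Longrightarrow> v \<in> EK \<Longrightarrow> u * v \<in> EK"
  by (simp add: ring_units_iff OK_mult)

lemma EL_minus: "u \<in> EL \<Longrightarrow> - u \<in> EL"
  by (simp add: ring_units_iff OL_minus)

lemma EL_1: "1 \<in> EL" and EK_1: "1 \<in> EK"
  using OL_of_int[of 1] is_subfieldD(1)[OF K_subfield] by (simp_all add: ring_units_iff OK_iff)

lemma EL_power: "u \<in> EL \<Longrightarrow> u ^ n \<in> EL" and EK_power: "w \<in> EK \<Longrightarrow> w ^ n \<in> EK"
  by (induction n) (auto simp: EL_1 EL_mult EK_1 EK_mult)

lemma EK_sigma: "w \<in> EK \<Longrightarrow> \<sigma> w \<in> EK"
  by (auto simp: ring_units_iff OK_sigma sigma_eq_0 OK_iff[of w] simp flip: sigma_inverse)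

lemma EK_cnj: "w \<in> EK \<Longrightarrow> cnj w \<in> EK"
  by (auto simp: ring_units_iff OK_cnj simp flip: complex_cnj_inverse)

lemma EK_of_real: "u \<in> EL \<Longrightarrow> complex_of_real u \<in> EK"
  by (auto simp: ring_units_iff OK_of_real simp flip: of_real_inverse)

lemma EK_of_real_iff: "u \<in> L \<Longrightarrow> complex_of_real u \<in> EK \<longleftrightarrow> u \<in> EL"
  using L_subset_K is_subfieldD(5)[OF L_subfield]
  by (auto simp: ring_units_iff OK_iff OL_iff algebraic_int_of_real_iff simp flip: of_real_inverse)

text \<open>The inverse is \<open>nm\<close> u times \<open>cp\<close> u, and both orders are closed
  under \<open>cp\<close>.\<close>

lemma unit_of_norm:
  assumes u: "u \<in> L" and n: "\<bar>nm u\<bar> = 1"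
  shows "u \<in> OL \<Longrightarrow> u \<in> EL" and "u \<in> O0 \<Longrightarrow> u \<in> U0"
proof -
  have u0: "u \<noteq> 0" using n by (auto simp: nm_def)
  have "u * (nm u * cp u) = 1"
    using n by (auto simp: nm_def[of u] abs_if split: if_splits)
  then have inv: "inverse u = nm u * cp u" by (rule inverse_unique)
  have "nm u = of_int 1 \<or> nm u = of_int (- 1)" using n by (auto simp: abs_if split: if_splits)
  then have "nm u \<in> O0" using O0_of_int by metis
  show "u \<in> OL \<Longrightarrow> u \<in> EL"
    using u0 \<open>nm u \<in> O0\<close> by (simp add: ring_units_iff inv OL_mult OL_cp O0_subset_OL)
  show "u \<in> O0 \<Longrightarrow> u \<in> U0"
    using u0 \<open>nm u \<in> O0\<close> by (simp add: ring_units_iff inv O0_mult O0_cp)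
qed

lemma norm_of_unit: "u \<in> EL \<Longrightarrow> \<bar>nm u\<bar> = 1"
proof -
  assume u: "u \<in> EL"
  then have L: "u \<in> L" "inverse u \<in> L" "u \<noteq> 0" by (auto simp: ring_units_iff OL_iff)
  have O: "u \<in> OL" "inverse u \<in> OL" using u by (auto simp: ring_units_iff)
  obtain i where i: "nm u = of_int i" using nm_int[OF O(1)] by (elim Ints_cases)
  obtain j where j: "nm (inverse u) = of_int j" using nm_int[OF O(2)] by (elim Ints_cases)
  have "nm u * nm (inverse u) = 1" using L by (simp add: nm_1 flip: nm_mult)
  then have "real_of_int (i * j) = of_int 1" using i j by simp
  then have "i * j = 1" by (simp only: of_int_eq_iff)
  then have "i = 1 \<or> i = -1" by (metis pos_zmult_eq_1_iff_lemma zmult_eq_1_iff)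
  then show ?thesis using i j by auto
qed

text \<open>The ideal generated by \<open>\<alpha>\<close> is invariant under \<open>\<sigma>\<close> iff \<open>\<alpha>\<^sup>3\<close> is a unit times a rational number.\<close>

definition ambiguous :: "real \<Rightarrow> bool" where
  "ambiguous \<alpha> \<longleftrightarrow> \<alpha> \<in> L \<and> \<alpha> \<noteq> 0 \<and> \<alpha> ^ 3 / nm \<alpha> \<in> EL"

lemma sigma_of_nm: "\<alpha> \<in> L \<Longrightarrow> \<sigma> (complex_of_real (nm \<alpha>)) = complex_of_real (nm \<alpha>)"
  by (intro sigma_k0 Rats_in_k0 of_real_Rats nm_Rats)

text \<open>Put q = \<sigma>(\<alpha>) / \<alpha> and e = \<alpha>^3 / \<open>nm\<close> \<alpha>.
  Then e is the inverse of q^2 \<sigma>(q), and q^3 is \<sigma>(e) / e. So if either of them is a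
  unit, so is the other, the root q^3 to q being taken among algebraic integers.\<close>

lemma ambiguous_iff:
  assumes \<alpha>: "\<alpha> \<in> L" "\<alpha> \<noteq> 0"
  shows "ambiguous \<alpha> \<longleftrightarrow> \<sigma> (complex_of_real \<alpha>) / complex_of_real \<alpha> \<in> EK"
proof -
  define w where "w = complex_of_real \<alpha>"
  define e where "e = \<alpha> ^ 3 / nm \<alpha>"
  have w: "w \<in> K" "w \<noteq> 0" "\<sigma> w \<in> K" "\<sigma> w \<noteq> 0" "\<sigma> (\<sigma> w) \<noteq> 0"
    using \<alpha> L_subset_K sigma_K sigma_eq_0 by (auto simp: w_def)
  have nmw: "complex_of_real (nm \<alpha>) = w * \<sigma> w * \<sigma> (\<sigma> w)"
    using \<alpha> by (simp add: rel_norm_L[symmetric] rel_norm_def w_def)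
  have eL: "e \<in> L" 
    unfolding e_def by (intro is_subfieldD(8,9)[OF L_subfield] is_subfield_Rats[OF L_subfield] nm_Rats \<alpha>)
  have ce: "complex_of_real e = w ^ 3 / complex_of_real (nm \<alpha>)" by (simp add: e_def w_def)
  have e_eq: "complex_of_real e = inverse ((\<sigma> w / w) * (\<sigma> (\<sigma> w / w) * (\<sigma> w / w)))"
    using w by (simp add: ce nmw sigma_divide power3_eq_cube field_simps)
  have cube: "(\<sigma> w / w) ^ 3 = \<sigma> (complex_of_real e) / complex_of_real e"
  proof -
    have n0: "complex_of_real (nm \<alpha>) \<noteq> 0" using \<alpha> nm_eq_0 by simp
    have "\<sigma> (complex_of_real e) = \<sigma> w ^ 3 / complex_of_real (nm \<alpha>)"
      unfolding ce using w \<alpha> nm_Rats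
      by (simp add: sigma_divide sigma_power sigma_of_nm is_subfieldD(9)[OF K_subfield]
          is_subfield_Rats[OF K_subfield] of_real_Rats)
    then show ?thesis using n0 w by (simp add: ce power_divide)
  qed
  show ?thesis
  proof
    assume "ambiguous \<alpha>"
    then have "e \<in> EL" by (simp add: ambiguous_def e_def)
    then have eE: "complex_of_real e \<in> EK" by (rule EK_of_real)
    then have "\<sigma> (complex_of_real e) * inverse (complex_of_real e) \<in> EK"
      by (intro EK_mult EK_sigma ring_units_inverse)
    then have c: "(\<sigma> w / w) ^ 3 \<in> EK" unfolding cube by (simp only: field_class.field_divide_inverse)
    have wK: "\<sigma> w / w \<in> K" "inverse (\<sigma> w / w) \<in> K"
      using w is_subfieldD(5,8)[OF K_subfield] by blast+
    have "algebraic_int ((\<sigma> w / w) ^ 3)" "algebraic_int (inverse (\<sigma> w / w) ^ 3)"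
      using c by (simp_all add: ring_units_iff OK_iff power_inverse del: inverse_divide)
    then have "algebraic_int (\<sigma> w / w)" "algebraic_int (inverse (\<sigma> w / w))"
      by (auto elim!: algebraic_int_power_imp simp del: inverse_divide)
    then show "\<sigma> (complex_of_real \<alpha>) / complex_of_real \<alpha> \<in> EK"
      using wK w by (simp add: ring_units_iff OK_iff w_def)
  next
    assume "\<sigma> (complex_of_real \<alpha>) / complex_of_real \<alpha> \<in> EK"
    then have "\<sigma> w / w \<in> EK" by (simp add: w_def)
    then have "complex_of_real e \<in> EK"
      unfolding e_eq by (intro ring_units_inverse EK_mult EK_sigma)
    then show "ambiguous \<alpha>" using \<alpha> eL by (simp add: ambiguous_def EK_of_real_iff flip: e_def)
  qed
qed

text \<open>The two ideal conditions translate into conditions on elements: \<alpha> and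
  \<sigma>(\<alpha>) generate the same ideal iff their quotient is a unit. For \<alpha> = 0 both
  sides fail, because the zero ideal is contained in 2 \<open>OL\<close>.\<close>

lemma principal_factor_iff:
  "principal_factor d \<zeta> \<sigma> \<alpha> \<longleftrightarrow> \<alpha> \<in> OL \<and> ambiguous \<alpha> \<and> (\<forall>m::int. m > 1 \<longrightarrow> \<alpha> / of_int m \<notin> OL)"
proof -
  have sub: "principal_ideal OL \<alpha> \<subseteq> principal_ideal OL (of_int m) \<longleftrightarrow> \<alpha> / of_int m \<in> OL" if "m > 1" for m :: int
  proof
    assume "principal_ideal OL \<alpha> \<subseteq> principal_ideal OL (of_int m)"
    moreover have "\<alpha> \<in> principal_ideal OL \<alpha>"
      using principal_idealI[of 1 OL \<alpha>] OL_of_int[of 1] by simp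
    ultimately obtain v where "v \<in> OL" "\<alpha> = of_int m * v" by (metis principal_idealE subsetD)
    then show "\<alpha> / of_int m \<in> OL" using that by simp
  next
    assume *: "\<alpha> / of_int m \<in> OL"
    show "principal_ideal OL \<alpha> \<subseteq> principal_ideal OL (of_int m)"
    proof
      fix t assume "t \<in> principal_ideal OL \<alpha>"
      then obtain v where v: "v \<in> OL" "t = \<alpha> * v" by (rule principal_idealE)
      then have t: "t = of_int m * (\<alpha> / of_int m * v)" using that by simp
      show "t \<in> principal_ideal OL (of_int m)"
        unfolding t by (rule principal_idealI[OF OL_mult[OF * v(1)]])
    qed
  qed
  define w where "w = complex_of_real \<alpha>"
  have amb: "\<sigma> ` principal_ideal OK w = principal_ideal OK w \<longleftrightarrow> ambiguous \<alpha>" if \<alpha>: "\<alpha> \<in> OL" "\<alpha> \<noteq> 0"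
  proof -
    have wK: "w \<in> K" "w \<noteq> 0" "\<sigma> w \<in> K" "\<sigma> w \<noteq> 0"
      using \<alpha> L_subset_K sigma_eq_0 sigma_K by (auto simp: w_def OL_iff)
    have one: "1 \<in> OK" using is_subfieldD(1)[OF K_subfield] by (simp add: OK_iff)
    have self: "w \<in> principal_ideal OK w"
      using principal_idealI[OF one] by simp
    show ?thesis
    proof
      assume eq: "\<sigma> ` principal_ideal OK w = principal_ideal OK w"
      have "\<sigma> w \<in> principal_ideal OK w" using self eq by blast
      then obtain v where v: "v \<in> OK" "\<sigma> w = w * v" by (rule principal_idealE)
      have "w \<in> \<sigma> ` principal_ideal OK w" using self eq by simp
      then obtain s where s: "w = \<sigma> s" "s \<in> principal_ideal OK w" by (rule imageE)
      obtain t where "t \<in> OK" "s = w * t" using s(2) by (rule principal_idealE)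
      then have t: "t \<in> OK" "w = \<sigma> (w * t)" using s(1) by simp_all
      have tt: "w = \<sigma> w * \<sigma> t" using t wK by (simp add: sigma_mult OK_iff)
      have "\<sigma> w / w = v" using v wK by simp
      moreover have "inverse (\<sigma> w / w) = \<sigma> t" using tt wK
        by (metis inverse_divide nonzero_mult_div_cancel_left)
      ultimately have "\<sigma> w / w \<in> EK" using v t wK OK_sigma by (simp add: ring_units_iff del: inverse_divide)
      then show "ambiguous \<alpha>" using \<alpha> by (simp add: ambiguous_iff OL_iff w_def)
    next
      assume "ambiguous \<alpha>"
      then have u: "\<sigma> w / w \<in> EK" using \<alpha> by (simp add: ambiguous_iff OL_iff w_def)
      then have u': "\<sigma> w / w \<in> OK" "inverse (\<sigma> w / w) \<in> OK" by (auto simp: ring_units_iff simp del: inverse_divide)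
      show "\<sigma> ` principal_ideal OK w = principal_ideal OK w"
      proof
        show "\<sigma> ` principal_ideal OK w \<subseteq> principal_ideal OK w"
        proof
          fix s assume "s \<in> \<sigma> ` principal_ideal OK w"
          then obtain r where r: "s = \<sigma> r" "r \<in> principal_ideal OK w" by (rule imageE)
          obtain v where "v \<in> OK" "r = w * v" using r(2) by (rule principal_idealE)
          then have v: "v \<in> OK" "s = \<sigma> (w * v)" using r(1) by simp_all
          then have s: "s = w * (\<sigma> w / w * \<sigma> v)" using wK by (simp add: sigma_mult OK_iff)
          show "s \<in> principal_ideal OK w"
            unfolding s by (rule principal_idealI[OF OK_mult[OF u'(1) OK_sigma[OF v(1)]]])
        qed
        show "principal_ideal OK w \<subseteq> \<sigma> ` principal_ideal OK w"
        proof
          fix s assume "s \<in> principal_ideal OK w"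
          then obtain v where v: "v \<in> OK" "s = w * v" by (rule principal_idealE)
          \<comment> \<open>The double \<sigma> is the inverse of \<sigma>, so this is the cofactor
            that \<sigma> sends to v divided by the unit.\<close>
          define t where "t = \<sigma> (\<sigma> (inverse (\<sigma> w / w) * v))"
          have t: "t \<in> OK" unfolding t_def by (intro OK_sigma OK_mult u' v)
          have "inverse (\<sigma> w / w) * v \<in> K" using u' v OK_mult OK_iff by blast
          then have "\<sigma> t = inverse (\<sigma> w / w) * v" unfolding t_def by (rule sigma_3)
          then have "\<sigma> (w * t) = s" using v t wK by (simp add: sigma_mult OK_iff)
          then show "s \<in> \<sigma> ` principal_ideal OK w"
            using imageI[OF principal_idealI[OF t, of w], of \<sigma>] by (simp only:)
        qed
      qed
    qed
  qed
  show ?thesis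
  proof (cases "\<alpha> = 0")
    case True
    have "0 / of_int 2 \<in> OL" using OL_of_int[of 0] by simp
    then have "principal_ideal OL 0 \<subseteq> principal_ideal OL (of_int 2)" using sub[of 2] True by simp
    then have "\<not> principal_factor d \<zeta> \<sigma> 0"
      unfolding principal_factor_def Let_def by (metis one_less_numeral_iff semiring_norm(76))
    then show ?thesis using True by (simp add: ambiguous_def)
  next
    case False
    then show ?thesis unfolding principal_factor_def Let_def using sub amb by (auto simp: w_def)
  qed
qed

text \<open>The non-zero elements of the three lines on which \<sigma> acts by a cube root of unity.
  They form the group generated by the non-zero rationals and \<open>D\<close>, since D^2 = b
  E.\<close>

definition homog :: "real \<Rightarrow> bool" where
  "homog s \<longleftrightarrow> (\<exists>y e. y \<in> \<rat> \<and> y \<noteq> 0 \<and> e \<in> {1, D, E} \<and> s = y * e)"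

lemma homogI: "y \<in> \<rat> \<Longrightarrow> y \<noteq> 0 \<Longrightarrow> e \<in> {1, D, E} \<Longrightarrow> homog (y * e)"
  unfolding homog_def by blast

lemma homogE:
  assumes "homog s"
  obtains y e where "s = y * e" "y \<in> \<rat>" "y \<noteq> 0" "e \<in> {1, D, E}"
  using assms unfolding homog_def by blast

lemma homog_mult: "homog s \<Longrightarrow> homog t \<Longrightarrow> homog (s * t)"
proof (elim homogE)
  fix y e y' e' assume s: "s = y * e" "y \<in> \<rat>" "y \<noteq> 0" "e \<in> {1, D, E}"
    and t: "t = y' * e'" "y' \<in> \<rat>" "y' \<noteq> 0" "e' \<in> {1, D, E}"
  have "\<exists>c f. c \<in> \<rat> \<and> c \<noteq> 0 \<and> f \<in> {1, D, E} \<and> e * e' = c * f"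
  proof -
    have *: "\<exists>c f. c \<in> \<rat> \<and> c \<noteq> 0 \<and> f \<in> {1, D, E} \<and> x = c * f"
      if "x = c * f" "c \<in> \<rat>" "c \<noteq> 0" "f \<in> {1, D, E}" for x c f :: real using that by blast
    show ?thesis
      using s(4) t(4) *[of "e * e'" 1 e] *[of "e * e'" 1 e'] *[of "e * e'" "real b" E] *[of "e * e'" "real a" D]
        *[of "e * e'" "real a * real b" 1] D_D E_E D_E ab_pos
      by (auto simp: mult.commute)
  qed
  then obtain c f where c: "c \<in> \<rat>" "c \<noteq> 0" "f \<in> {1, D, E}" "e * e' = c * f" by blast
  have "s * t = (y * y' * c) * f" using s t c(4) by Groebner_Basis.algebra
  then show "homog (s * t)" using s(2,3) t(2,3) c(1-3) by (simp only:) (rule homogI; simp)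
qed

lemma homog_1: "homog 1" using homogI[of 1 1] by simp

lemma homog_of_Rats: "y \<in> \<rat> \<Longrightarrow> y \<noteq> 0 \<Longrightarrow> homog y" using homogI[of y 1] by simp

lemma homog_D: "homog D" and homog_E: "homog E" using homogI[of 1 D] homogI[of 1 E] by simp_all

lemma homog_nonzero: "homog s \<Longrightarrow> s \<noteq> 0"
  using D_gt_1 E_gt_1 by (auto elim!: homogE)

lemma homog_cube_Rats: "homog s \<Longrightarrow> s ^ 3 \<in> \<rat>"
  by (auto elim!: homogE simp: power_mult_distrib D_cubed E_cubed)

lemma homog_inverse: "homog s \<Longrightarrow> homog (inverse s)"
proof -
  assume s: "homog s"
  have "inverse s = inverse (s ^ 3) * (s * s)"
    using homog_nonzero[OF s] by (simp add: power3_eq_cube field_simps)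
  moreover have "homog (inverse (s ^ 3))"
    using homog_of_Rats[of "inverse (s ^ 3)"] homog_cube_Rats[OF s] homog_nonzero[OF s] by simp
  ultimately show ?thesis using s homog_mult by metis
qed

lemma homog_in_L: "homog s \<Longrightarrow> s \<in> L"
  using is_subfield_Rats[OF L_subfield] is_subfieldD(4)[OF L_subfield] D_in_L E_in_L
    is_subfieldD(1)[OF L_subfield]
  by (auto elim!: homogE)

lemma nm_homog: "homog s \<Longrightarrow> nm s = s ^ 3"
proof (elim homogE)
  fix y e assume s: "s = y * e" "y \<in> \<rat>" "y \<noteq> 0" "e \<in> {1, D, E}"
  have "s = el y 0 0 \<or> s = el 0 y 0 \<or> s = el 0 0 y" using s by (auto simp: el_def)
  moreover have "nm (el y 0 0) = (el y 0 0) ^ 3" "nm (el 0 y 0) = (el 0 y 0) ^ 3" "nm (el 0 0 y) = (el 0 0 y) ^ 3"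
    using s(2) by (simp_all add: nm_el nf_def) (simp_all add: el_def power_mult_distrib D_cubed E_cubed)
  ultimately show ?thesis by auto
qed

definition trivial_factors :: "real set" where
  "trivial_factors = mult_subgroup_generated (EL \<union> (\<rat> - {0}) \<union> {D})"

text \<open>Units and homogeneous elements are each closed under products and inverses, hence so is
  the set of their products. In the other direction, \<open>E\<close> is generated as D^2 /
  b.\<close>

lemma trivial_factors_eq: "trivial_factors = {u * s | u s. u \<in> EL \<and> homog s}" (is "_ = ?A")
proof
  have inA: "u * s \<in> ?A" if "u \<in> EL" "homog s" for u s using that by blast
  show "trivial_factors \<subseteq> ?A"
    unfolding trivial_factors_def
  proof (rule mult_subgroup_generated_least)
    show "1 \<in> ?A" using inA[OF EL_1 homog_1] by simp
    show "x * y \<in> ?A" if xy: "x \<in> ?A" "y \<in> ?A" for x y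
    proof -
      obtain u s v t where "x = u * s" "y = v * t" and *: "u \<in> EL" "homog s" "v \<in> EL" "homog t"
        using xy by blast
      then have eq: "x * y = (u * v) * (s * t)" by simp
      have "u * v \<in> EL" "homog (s * t)" using * EL_mult homog_mult by blast+
      then show ?thesis unfolding eq by (rule inA)
    qed
    show "inverse x \<in> ?A" if x: "x \<in> ?A" for x
    proof -
      obtain u s where "x = u * s" and *: "u \<in> EL" "homog s" using x by blast
      then have eq: "inverse x = inverse u * inverse s" by simp
      have "inverse u \<in> EL" "homog (inverse s)" using * ring_units_inverse homog_inverse by blast+
      then show ?thesis unfolding eq by (rule inA)
    qed
    have "x \<in> ?A" if "x \<in> EL" for x using inA[OF that homog_1] by simp
    moreover have "x \<in> ?A" if "x \<in> \<rat> - {0}" for x using inA[OF EL_1 homog_of_Rats[of x]] that by simp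
    moreover have "D \<in> ?A" using inA[OF EL_1 homog_D] by simp
    ultimately show "EL \<union> (\<rat> - {0}) \<union> {D} \<subseteq> ?A" by blast
  qed
  note gen = mult_subgroup_generated_subgroup[where S = "EL \<union> (\<rat> - {0}) \<union> {D}", folded trivial_factors_def]
  have rat: "y \<in> trivial_factors" if "y \<in> \<rat>" "y \<noteq> 0" for y using gen(4)[of y] that by simp
  have D: "D \<in> trivial_factors" using gen(4)[of D] by simp
  have "D * D * inverse (real b) \<in> trivial_factors"
    by (intro gen(2,3) D rat) (use ab_pos in auto)
  moreover have "D * D * inverse (real b) = E" using D_D ab_pos by (simp add: field_simps)
  ultimately have E: "E \<in> trivial_factors" by simp
  show "?A \<subseteq> trivial_factors"
  proof clarify
    fix u s assume u: "u \<in> EL" and "homog s"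
    then obtain y e where s: "s = y * e" "y \<in> \<rat>" "y \<noteq> 0" "e \<in> {1, D, E}" by (elim homogE)
    have "e \<in> trivial_factors" using s(4) D E gen(1) by auto
    then have "s \<in> trivial_factors" unfolding s(1) using gen(2) rat s by blast
    moreover have "u \<in> trivial_factors" using gen(4)[of u] u by blast
    ultimately show "u * s \<in> trivial_factors" using gen(2) by blast
  qed
qed

lemma nontrivial_iff: "nontrivial_principal_factor d \<zeta> \<sigma> \<alpha> \<longleftrightarrow> principal_factor d \<zeta> \<sigma> \<alpha> \<and> \<alpha> \<notin> trivial_factors"
  by (simp add: nontrivial_principal_factor_def trivial_factors_def)

section \<open>Lattice minima whose norm divides the square of \<open>R\<close>\<close>

abbreviation "R \<equiv> int (ram_invariant d a b)"

lemma prime_not_dvd_both: "prime (p :: int) \<Longrightarrow> \<not> (p dvd int a \<and> p dvd int b)"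
proof
  assume p: "prime p" and "p dvd int a \<and> p dvd int b"
  moreover have "coprime (int a) (int b)" using coprime_ab by simp
  ultimately have "is_unit p" using coprime_common_divisor by blast
  then show False using p not_prime_unit by blast
qed

lemma three_dvd_d: "3 dvd d \<longleftrightarrow> 3 dvd a \<or> 3 dvd b"
proof -
  have "prime (3 :: nat)" by simp
  then show ?thesis unfolding d_eq by (simp add: prime_dvd_mult_iff prime_dvd_power_iff)
qed

lemma R_cases:
  "R = int a * int b \<or> (R = 3 * int a * int b \<and> \<not> 9 dvd int a * (int b)\<^sup>2 - 1 \<and> \<not> 9 dvd int a * (int b)\<^sup>2 + 1)"
proof (cases "d mod 9 \<in> {2, 4, 5, 7}")
  case True
  have "int d = int a * (int b)\<^sup>2" by (simp add: d_eq)
  moreover have "\<not> 9 dvd int d - 1" using True by simp presburger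
  moreover have "\<not> 9 dvd int d + 1" using True by simp presburger
  ultimately show ?thesis using True by (simp add: ram_invariant_def)
next
  case False
  then show ?thesis by (simp add: ram_invariant_def)
qed

lemma R_squarefree: "squarefree (ram_invariant d a b)"
proof -
  have ab: "squarefree (a * b)" using coprime_ab squarefree_a squarefree_b by (rule squarefree_mult_coprime)
  show ?thesis
  proof (cases "d mod 9 \<in> {2, 4, 5, 7}")
    case True
    then have "d mod 9 = 2 \<or> d mod 9 = 4 \<or> d mod 9 = 5 \<or> d mod 9 = 7" by simp
    then have "\<not> 3 dvd d" by presburger
    then have "\<not> 3 dvd a * b" using three_dvd_d by (simp add: prime_dvd_mult_iff)
    then have "coprime 3 (a * b)" by (intro prime_imp_coprime) simp_all
    moreover have "squarefree (3 :: nat)" by (rule squarefree_prime) simp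
    ultimately have "squarefree (3 * (a * b))" using ab squarefree_mult_coprime[of 3 "a * b"] by blast
    then show ?thesis using True by (simp add: ram_invariant_def mult.assoc)
  qed (use ab in \<open>simp add: ram_invariant_def\<close>)
qed

lemma el_power3: "el x y z ^ 3 = el (nf x y z + 9 * real a * real b * x * y * z)
  (3 * (x\<^sup>2 * y + real a * x * z\<^sup>2 + real a * real b * y\<^sup>2 * z))
  (3 * (x\<^sup>2 * z + real b * x * y\<^sup>2 + real a * real b * y * z\<^sup>2))"
  unfolding el_def nf_def of_nat_id using D_D E_E D_E by Groebner_Basis.algebra

text \<open>All primes dividing \<open>R\<close> are totally ramified, so an element whose norm is
  built from them generates an ideal whose cube is the ideal of a rational number. The integral form
  of this is \<open>norm_form_cube_dvd\<close>.\<close>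

lemma O0_cube_div_norm:
  assumes u: "u \<in> O0" and n: "nm u = of_int n" "n \<noteq> 0" "n dvd R\<^sup>2"
  shows "u ^ 3 / nm u \<in> O0"
proof -
  obtain x y z where xyz: "u = el (of_int x) (of_int y) (of_int z)" using u by (rule O0E)
  have "real_of_int n = nf (of_int x) (of_int y) (of_int z)" using n(1) by (simp add: xyz nm_el)
  also have "\<dots> = real_of_int (nf x y z)" by (simp add: nf_def)
  finally have n_nf: "n = nf x y z" by (simp only: of_int_eq_iff)
  then have n_eq: "n = x ^ 3 + int a * (int b)\<^sup>2 * y ^ 3 + (int a)\<^sup>2 * int b * z ^ 3 - 3 * int a * int b * x * y * z"
    by (simp add: nf_def)
  note dvds = norm_form_cube_dvd[OF squarefree_int_prime[OF squarefree_a] squarefree_int_prime[OF squarefree_b]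
      squarefree_int_prime[OF R_squarefree] prime_not_dvd_both R_cases n_eq n(2) n(3)]
  obtain c0 where c0: "n + 9 * int a * int b * x * y * z = n * c0" using dvds(1) by blast
  obtain c1 where c1: "3 * (x\<^sup>2 * y + int a * x * z\<^sup>2 + int a * int b * y\<^sup>2 * z) = n * c1" using dvds(2) by blast
  obtain c2 where c2: "3 * (x\<^sup>2 * z + int b * x * y\<^sup>2 + int a * int b * y * z\<^sup>2) = n * c2" using dvds(3) by blast
  have "u ^ 3 = el (of_int (n + 9 * int a * int b * x * y * z))
      (of_int (3 * (x\<^sup>2 * y + int a * x * z\<^sup>2 + int a * int b * y\<^sup>2 * z)))
      (of_int (3 * (x\<^sup>2 * z + int b * x * y\<^sup>2 + int a * int b * y * z\<^sup>2)))"
    unfolding xyz el_power3 n_nf by (simp add: nf_def)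
  also have "\<dots> = of_int n * el (of_int c0) (of_int c1) (of_int c2)"
    unfolding c0 c1 c2 by (simp add: el_scale)
  finally have "u ^ 3 / nm u = el (of_int c0) (of_int c1) (of_int c2)" using n by simp
  then show ?thesis by (simp add: O0I)
qed

lemma norm_1_unit_cube:
  assumes "u \<in> L" "u \<noteq> 0"
  shows "u ^ 3 / nm u \<in> L" and "nm (u ^ 3 / nm u) = 1"
proof -
  have Q: "inverse (nm u) \<in> \<rat>" "nm u \<noteq> 0" using assms nm_Rats nm_eq_0 by auto
  have L: "u ^ 3 \<in> L" "inverse (nm u) \<in> L"
    using assms Q is_subfieldD(9)[OF L_subfield] is_subfield_Rats[OF L_subfield] by blast+
  have eq: "u ^ 3 / nm u = u ^ 3 * inverse (nm u)" by (simp add: field_simps)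
  show "u ^ 3 / nm u \<in> L" unfolding eq using L by (rule is_subfieldD(4)[OF L_subfield])
  have "nm (inverse (nm u)) = inverse (nm u) ^ 3" using Q by (intro nm_homog homog_of_Rats) auto
  then show "nm (u ^ 3 / nm u) = 1"
    unfolding eq using L assms Q by (simp add: nm_mult nm_power power_inverse)
qed

lemma cube_dvd_R_square:
  assumes "m > (1::int)" shows "\<not> m ^ 3 dvd R\<^sup>2"
proof
  assume dvd: "m ^ 3 dvd R\<^sup>2"
  obtain p where p: "prime p" "p dvd m"
    using assms prime_divisor_exists[of m] by auto
  have "p ^ 3 dvd m ^ 3" using p(2) by (rule dvd_power_same)
  then have "p ^ 3 dvd R\<^sup>2" using dvd by (rule dvd_trans)
  then show False using prime_cube_dvd_square[OF p(1) squarefree_int_prime[OF R_squarefree p(1)]] by blast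
qed

lemma basis_cube:
  assumes "e \<in> {1, D, E}"
  obtains N :: nat where "e ^ 3 = real N" "cubefree N" "3 dvd N \<Longrightarrow> 3 dvd d" "e \<in> O0" "e \<ge> 1"
    "e = 1 \<or> e > 1"
proof -
  have "cubefree 1" unfolding cubefree_def using not_prime_1 by (auto simp: is_unit_power_iff)
  have a2b: "3 dvd a\<^sup>2 * b \<longleftrightarrow> 3 dvd d"
    by (simp add: three_dvd_d prime_dvd_mult_iff prime_dvd_power_iff)
  consider "e = 1" | "e = D" | "e = E" using assms by blast
  then show thesis
  proof cases
    case 1
    then show thesis using that[of 1] \<open>cubefree 1\<close> O0_of_int[of 1] by simp
  next
    case 2
    then show thesis using that[of d] d_cubefree D_cubed O0_D D_gt_1 by (simp add: d_eq)
  next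
    case 3
    then show thesis using that[of "a\<^sup>2 * b"] a2b_cubefree a2b E_cubed O0_E E_gt_1 by simp
  qed
qed

text \<open>3 v always lies in \<open>O0\<close>, so v is a Bezout combination of 3 v and N
  v.\<close>

lemma OL_prime_to_3_O0:
  assumes v: "v \<in> OL" and N: "\<not> 3 dvd N" and vN: "v * of_int N \<in> O0"
  shows "v \<in> O0"
proof -
  have "coprime N 3" using N by (metis coprime_commute prime_3_int prime_imp_coprime)
  then obtain s t where st: "N * s + 3 * t = 1"
    by (metis bezout_int coprime_imp_gcd_eq_1 mult.commute)
  then have "real_of_int N * of_int s + 3 * of_int t = 1"
    by (metis of_int_1 of_int_add of_int_mult of_int_numeral)
  then have "v = of_int s * (v * of_int N) + of_int t * (3 * v)" by Groebner_Basis.algebra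
  also have "\<dots> \<in> O0" by (intro O0_add O0_mult O0_of_int vN OL_triple v)
  finally show ?thesis .
qed

lemma O0_abs: "u \<in> O0 \<Longrightarrow> \<bar>u\<bar> \<in> O0" and EL_abs: "u \<in> EL \<Longrightarrow> \<bar>u\<bar> \<in> EL"
  using O0_minus EL_minus by (auto simp: abs_if)

lemma nm_minus: "u \<in> L \<Longrightarrow> nm (- u) = - nm u"
  by (simp add: nm_def cp_def sigma_minus L_subset_K)

text \<open>\<theta> is primitive because no cube divides the square of \<open>R\<close>, and
  invariant by ramification. If it were trivial, \<theta> = u y e with a unit u, a rational y and e
  among 1, \<open>D\<close>, \<open>E\<close>, then primitivity would leave y = +-1. For e = 1 this
  makes \<theta> a unit; otherwise the absolute value of u is smaller than \<theta> at both places,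
  contradicting minimality.\<close>

lemma lattice_minimum_imp_type_beta:
  assumes min: "\<theta> \<in> lattice_minima \<sigma> O0" and nonunit: "\<theta> \<notin> U0"
    and norm: "norm_dvd \<sigma> \<theta> (R\<^sup>2)"
  shows "type_beta d \<zeta> \<sigma>"
proof -
  have \<theta>: "\<theta> \<in> O0" "\<theta> > 0" using min by (auto simp: lattice_minima_def)
  have \<theta>L: "\<theta> \<in> L" "\<theta> \<in> OL" using \<theta> O0_in_L O0_subset_OL by auto
  obtain n where n: "rel_norm \<sigma> (complex_of_real \<theta>) = of_int n" "n dvd R\<^sup>2"
    using norm unfolding norm_dvd_def by blast
  have "complex_of_real (nm \<theta>) = complex_of_real (of_int n)" using n(1) rel_norm_L[OF \<theta>L(1)] by simp
  then have nm: "nm \<theta> = of_int n" by (simp only: of_real_eq_iff)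
  have n0: "n \<noteq> 0" using nm nm_pos[OF \<theta>L(1) \<theta>(2)] by auto
  have prim: "\<theta> / of_int m \<notin> OL" if m: "m > 1" for m :: int
  proof
    assume O: "\<theta> / of_int m \<in> OL"
    then obtain k where k: "nm (\<theta> / of_int m) = of_int k" using nm_int by (auto elim: Ints_cases)
    have "nm (of_int m :: real) = of_int m ^ 3" using m by (intro nm_homog homog_of_Rats) auto
    moreover have "nm \<theta> = nm (of_int m) * nm (\<theta> / of_int m)"
      using O m is_subfield_of_int[OF L_subfield] by (subst nm_mult[symmetric]) (auto simp: OL_iff)
    ultimately have "real_of_int n = real_of_int (m ^ 3 * k)" using k nm by simp
    then have "n = m ^ 3 * k" by (simp only: of_int_eq_iff)
    then have "m ^ 3 dvd R\<^sup>2" using n(2) by auto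
    then show False using cube_dvd_R_square[OF m] by blast
  qed
  have unit3: "\<theta> ^ 3 / nm \<theta> \<in> EL"
  proof (rule unit_of_norm(1))
    show "\<theta> ^ 3 / nm \<theta> \<in> L" "\<bar>nm (\<theta> ^ 3 / nm \<theta>)\<bar> = 1" using norm_1_unit_cube[of \<theta>] \<theta> \<theta>L by auto
    show "\<theta> ^ 3 / nm \<theta> \<in> OL" using O0_cube_div_norm[OF \<theta>(1) nm n0 n(2)] O0_subset_OL by blast
  qed
  then have "ambiguous \<theta>" using \<theta> \<theta>L by (simp add: ambiguous_def)
  then have pf: "principal_factor d \<zeta> \<sigma> \<theta>" using prim \<theta>L by (simp add: principal_factor_iff)
  have "\<theta> \<notin> trivial_factors"
  proof
    assume "\<theta> \<in> trivial_factors"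
    then obtain u s where us: "\<theta> = u * s" "u \<in> EL" "homog s" unfolding trivial_factors_eq by blast
    obtain y e where ye: "s = y * e" "y \<in> \<rat>" "y \<noteq> 0" "e \<in> {1, D, E}" using us(3) by (rule homogE)
    obtain N where N: "e ^ 3 = real N" "cubefree N" "3 dvd N \<Longrightarrow> 3 dvd d" "e \<in> O0" "e \<ge> 1" "e = 1 \<or> e > 1"
      by (rule basis_cube[OF ye(4)]) (rule that)
    have u: "u \<in> OL" "inverse u \<in> OL" "u \<noteq> 0" using us(2) by (auto simp: ring_units_iff)
    have "inverse u * \<theta> \<in> OL" using u \<theta>L OL_mult by blast
    then have sOL: "s \<in> OL" using us u by (simp flip: mult.assoc)
    have "s ^ 3 \<in> \<int>"
      using sOL homog_cube_Rats[OF us(3)] by (intro rational_algebraic_int_is_int algebraic_int_power) (auto simp: OL_iff)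
    then have "y \<in> \<int>" using cubefree_rational[OF N(2) ye(2)] N(1) by (simp add: ye(1) power_mult_distrib mult.commute)
    then obtain m where m: "y = of_int m" by (elim Ints_cases)
    have "\<bar>m\<bar> \<le> 1"
    proof (rule ccontr)
      assume "\<not> \<bar>m\<bar> \<le> 1"
      then have m1: "\<bar>m\<bar> > 1" by simp
      have ue: "u * e \<in> OL" using u N(4) O0_subset_OL OL_mult by blast
      have "\<theta> / of_int \<bar>m\<bar> = u * e \<or> \<theta> / of_int \<bar>m\<bar> = - (u * e)"
        using m1 by (cases "m > 0") (auto simp: us(1) ye(1) m)
      then have "\<theta> / of_int \<bar>m\<bar> \<in> OL" using ue OL_minus by auto
      then show False using prim[OF m1] by blast
    qed
    then have "m = 1 \<or> m = -1" using ye(3) m by auto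
    then have "\<bar>y\<bar> = 1" using m by auto
    define v where "v = \<bar>u\<bar>"
    have \<theta>v: "\<theta> = v * e"
    proof -
      have "\<theta> = \<bar>u\<bar> * \<bar>y\<bar> * \<bar>e\<bar>" using \<theta>(2) by (simp add: us(1) ye(1) abs_mult mult.assoc[symmetric] flip: abs_mult)
      then show ?thesis using \<open>\<bar>y\<bar> = 1\<close> N(5) by (simp add: v_def)
    qed
    have vE: "v \<in> EL" using us(2) EL_abs by (simp add: v_def)
    then have vOL: "v \<in> OL" "v \<in> L" by (auto simp: ring_units_iff OL_iff)
    have v0: "v > 0" using u by (simp add: v_def)
    \<comment> \<open>The competitor must lie in \<open>O0\<close>, not only in the maximal order.
      For d = +-1 mod 9 this follows because v e^3 = \<theta> e^2 lies in \<open>O0\<close> and e^3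
      is prime to 3.\<close>
    have vO0: "v \<in> O0"
    proof (cases "d mod 9 \<in> {1, 8}")
      case False
      then show ?thesis using vOL OL_eq_O0 by simp
    next
      case True
      then have "d mod 9 = 1 \<or> d mod 9 = 8" by simp
      then have "\<not> 3 dvd d" by presburger
      then have "\<not> 3 dvd int N" using N(3) by presburger
      moreover have "v * of_int (int N) = \<theta> * e * e" using \<theta>v N(1) by (simp add: power3_eq_cube flip: N(1))
      then have "v * of_int (int N) \<in> O0" using \<theta> N(4) O0_mult by simp
      ultimately show ?thesis using vOL OL_prime_to_3_O0 by blast
    qed
    then have vU: "v \<in> U0" using unit_of_norm(2)[OF vOL(2)] norm_of_unit[OF vE] by blast
    then have "e > 1" using nonunit \<theta>v N(6) by auto
    have eL: "e \<in> L" using N(4) O0_in_L by blast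
    have "nm e = e ^ 3" using ye(4) homog_1 homog_D homog_E nm_homog by auto
    then have "cp e = e * e" using \<open>e > 1\<close> by (simp add: nm_def power3_eq_cube)
    then have "cp e > 1" using \<open>e > 1\<close> by (simp add: less_1_mult)
    moreover have "cp v > 0" using cp_pos vOL v0 by simp
    ultimately have "cp v < cp \<theta>" using cp_mult[OF vOL(2) eL] by (simp add: \<theta>v)
    moreover have "v < \<theta>" using v0 \<open>e > 1\<close> by (simp add: \<theta>v)
    ultimately have "v = 0"
      using min vO0 v0 vOL(2) \<theta>L unfolding lattice_minima_def by (simp add: conj_prod_L)
    then show False using v0 by simp
  qed
  then show ?thesis using pf unfolding type_beta_def nontrivial_iff by blast
qed

end

section \<open>Lattice minima\<close>

text \<open>Since \<open>27 disc = - w\<^sup>2\<close> for the discriminant \<open>disc\<close> of \<open>X\<^sup>3 - x X\<^sup>2 + s X - n\<close>, it is divisible by 3.\<close>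

lemma char_poly_mod_3:
  fixes a b x y z s n :: int
  assumes s: "x\<^sup>2 - a * b * y * z = 3 * s"
    and n: "x ^ 3 + a * b\<^sup>2 * y ^ 3 + a\<^sup>2 * b * z ^ 3 - 3 * a * b * x * y * z = 27 * n"
    and x: "\<not> 3 dvd x" and n3: "\<not> 3 dvd n"
  shows "3 dvd x\<^sup>2 - 2 * s"
proof -
  define w where "w = a * b * (b * y ^ 3 - a * z ^ 3)"
  define disc where "disc = x\<^sup>2 * s\<^sup>2 - 4 * s ^ 3 - 4 * x ^ 3 * n + 18 * x * s * n - 27 * n\<^sup>2"
  have "27 * disc = - w\<^sup>2"
  proof -
    have "27 * (27 * disc) = 27 * (3 * x\<^sup>2 * (3 * s)\<^sup>2 - 4 * (3 * s) ^ 3 - 4 * x ^ 3 * (27 * n) + 6 * x * (3 * s) * (27 * n) - (27 * n)\<^sup>2)"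
      unfolding disc_def by Groebner_Basis.algebra
    also have "3 * x\<^sup>2 * (3 * s)\<^sup>2 - 4 * (3 * s) ^ 3 - 4 * x ^ 3 * (27 * n) + 6 * x * (3 * s) * (27 * n) - (27 * n)\<^sup>2 = - w\<^sup>2"
      unfolding s[symmetric] n[symmetric] w_def by Groebner_Basis.algebra
    finally show ?thesis by simp
  qed
  then have w2: "w\<^sup>2 = 27 * (- disc)" by simp
  then have "3 dvd w\<^sup>2" by presburger
  then have "3 dvd w" by (rule three_dvd_cube)
  then obtain v where v: "w = 3 * v" by blast
  have "9 * v\<^sup>2 = 9 * (3 * (- disc))" using w2 unfolding v by Groebner_Basis.algebra
  then have v2: "v\<^sup>2 = 3 * (- disc)" by simp
  then have "3 dvd v\<^sup>2" by presburger
  then have "3 dvd v" by (rule three_dvd_cube)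
  then obtain u where u: "v = 3 * u" by blast
  have "3 * (- disc) = 9 * u\<^sup>2" using v2 unfolding u by Groebner_Basis.algebra
  then have disc3: "3 dvd disc" by presburger
  obtain c1 where c1: "s ^ 3 - s = 3 * c1" using cube_mod_3 by blast
  obtain c2 where c2: "x ^ 3 - x = 3 * c2" using cube_mod_3 by blast
  have "x mod 3 = 1 \<or> x mod 3 = 2" using x by presburger
  then obtain x' where "x = 1 + 3 * x' \<or> x = 2 + 3 * x'" by (metis add.commute mult_div_mod_eq)
  then obtain c3 where c3: "x\<^sup>2 - 1 = 3 * c3"
  proof (elim disjE)
    assume "x = 1 + 3 * x'"
    then have "x\<^sup>2 - 1 = 3 * (2 * x' + 3 * x'\<^sup>2)" by Groebner_Basis.algebra
    then show thesis by (rule that)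
  next
    assume "x = 2 + 3 * x'"
    then have "x\<^sup>2 - 1 = 3 * (1 + 4 * x' + 3 * x'\<^sup>2)" by Groebner_Basis.algebra
    then show thesis by (rule that)
  qed
  obtain e where e: "disc = 3 * e" using disc3 by blast
  \<comment> \<open>Modulo 3 the discriminant is s^2 - s - x n. As it vanishes and x n does not, s
    must be 2 modulo 3, and x^2 - 2 s is then 1 - 4.\<close>
  have key: "s * (s - 1) - x * n = 3 * (e - c3 * s\<^sup>2 + s ^ 3 + c1 + x ^ 3 * n + c2 * n - 6 * x * s * n + 9 * n\<^sup>2)"
    using e c1 c2 c3 unfolding disc_def by Groebner_Basis.algebra
  have "\<not> 3 dvd s * (s - 1)"
  proof
    assume "3 dvd s * (s - 1)"
    then obtain r where "s * (s - 1) = 3 * r" by blast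
    then have "x * n = 3 * (r - (e - c3 * s\<^sup>2 + s ^ 3 + c1 + x ^ 3 * n + c2 * n - 6 * x * s * n + 9 * n\<^sup>2))"
      using key by simp
    then have "3 dvd x * n" by simp
    then show False using x n3 by (simp add: prime_dvd_mult_iff prime_3_int)
  qed
  then have "\<not> 3 dvd s" "\<not> 3 dvd s - 1" by auto
  then have "s mod 3 = 2" by presburger
  then show ?thesis using c3 by presburger
qed

text \<open>For d = +-1 mod 9, sign changes turn the form into x^3 + Y^3 + Z^3 - 3 x Y Z modulo 9.
  This has the factor x + Y + Z, which agrees with the form modulo 3, and the cofactor is then
  divisible by 3 too.\<close>

lemma norm_form_dvd_3_imp_9:
  fixes a b x y z :: int
  assumes a: "\<not> 3 dvd a" and b: "\<not> 3 dvd b" and d: "9 dvd a * b\<^sup>2 - 1 \<or> 9 dvd a * b\<^sup>2 + 1"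
    and N: "3 dvd x ^ 3 + a * b\<^sup>2 * y ^ 3 + a\<^sup>2 * b * z ^ 3 - 3 * a * b * x * y * z"
  shows "9 dvd x ^ 3 + a * b\<^sup>2 * y ^ 3 + a\<^sup>2 * b * z ^ 3 - 3 * a * b * x * y * z"
proof -
  have sgn: "\<exists>e k. (e = 1 \<or> e = -1) \<and> u = e + 3 * k" if "\<not> 3 dvd u" for u :: int
  proof -
    have "(\<exists>k. u = 1 + 3 * k) \<or> (\<exists>k. u = -1 + 3 * k)" using that by presburger
    then show ?thesis by metis
  qed
  obtain t where t: "t = 1 \<or> t = -1" and tb: "\<exists>k. b = t + 3 * k" using sgn[OF b] by blast
  obtain s r where s: "s = 1 \<or> s = -1" and r: "a * b\<^sup>2 = s + 9 * r"
  proof -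
    have *: "\<exists>k. a * b\<^sup>2 = c + 9 * k" if "9 dvd a * b\<^sup>2 - c" for c
      using that by (metis add.commute diff_add_cancel dvdE)
    show thesis
      using d
    proof
      assume "9 dvd a * b\<^sup>2 - 1"
      then show thesis using *[of 1] that[of 1] by blast
    next
      assume "9 dvd a * b\<^sup>2 + 1"
      then show thesis using *[of "-1"] that[of "-1"] by auto
    qed
  qed
  obtain k where k: "b = t + 3 * k" using tb by blast
  obtain e h where e: "e = 1 \<or> e = -1" and h: "a = e + 3 * h" using sgn[OF a] by blast
  have ttt: "t * t = 1" "s * s = 1" "e * e = 1" using t s e by auto
  have es: "e = s"
  proof -
    have "e + 3 * h + 3 * ((2 * t * k + 3 * k\<^sup>2) * (e + 3 * h)) = s + 9 * r"
      using r ttt unfolding h k by Groebner_Basis.algebra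
    then have "e mod 3 = s mod 3" by presburger
    then show ?thesis using e s by auto
  qed
  have ab: "a * b = s * t + 3 * (h * t + k * a)" unfolding h k es by Groebner_Basis.algebra
  define g where "g = h * t + k * a"
  have ab': "a * b = s * t + 3 * g" using ab by (simp add: g_def)
  have a2b: "\<exists>q. a\<^sup>2 * b = t + 9 * q"
  proof -
    have "(s + 9 * r) * (a\<^sup>2 * b) = (s * t + 3 * g) ^ 3"
      unfolding r[symmetric] ab'[symmetric] by Groebner_Basis.algebra
    then have "a\<^sup>2 * b = t + 9 * (g * s * (1 + 3 * s * t * g + 3 * g\<^sup>2) - s * r * (a\<^sup>2 * b))"
      using ttt by Groebner_Basis.algebra
    then show ?thesis by blast
  qed
  then obtain q where q: "a\<^sup>2 * b = t + 9 * q" by blast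
  define Y Z where "Y = s * y" and "Z = t * z"
  have eq: "x ^ 3 + a * b\<^sup>2 * y ^ 3 + a\<^sup>2 * b * z ^ 3 - 3 * a * b * x * y * z
    = x ^ 3 + Y ^ 3 + Z ^ 3 - 3 * x * Y * Z + 9 * (r * y ^ 3 + q * z ^ 3 - g * x * y * z)"
  proof -
    have "x ^ 3 + a * b\<^sup>2 * y ^ 3 + a\<^sup>2 * b * z ^ 3 - 3 * a * b * x * y * z
      = x ^ 3 + (a * b\<^sup>2) * y ^ 3 + (a\<^sup>2 * b) * z ^ 3 - 3 * (a * b) * x * y * z" by Groebner_Basis.algebra
    also have "\<dots> = x ^ 3 + (s + 9 * r) * y ^ 3 + (t + 9 * q) * z ^ 3 - 3 * (s * t + 3 * g) * x * y * z"
      by (simp only: r q ab')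
    also have "\<dots> = x ^ 3 + Y ^ 3 + Z ^ 3 - 3 * x * Y * Z + 9 * (r * y ^ 3 + q * z ^ 3 - g * x * y * z)"
      unfolding Y_def Z_def using ttt by Groebner_Basis.algebra
    finally show ?thesis .
  qed
  obtain n where n: "x ^ 3 + a * b\<^sup>2 * y ^ 3 + a\<^sup>2 * b * z ^ 3 - 3 * a * b * x * y * z = 3 * n" using N by blast
  obtain c1 where c1: "x ^ 3 - x = 3 * c1" using cube_mod_3 by blast
  obtain c2 where c2: "Y ^ 3 - Y = 3 * c2" using cube_mod_3 by blast
  obtain c3 where c3: "Z ^ 3 - Z = 3 * c3" using cube_mod_3 by blast
  define w where "w = n - c1 - c2 - c3 + x * Y * Z - 3 * (r * y ^ 3 + q * z ^ 3 - g * x * y * z)"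
  have "x + Y + Z = 3 * w" using n eq c1 c2 c3 unfolding w_def by Groebner_Basis.algebra
  then have "x ^ 3 + Y ^ 3 + Z ^ 3 - 3 * x * Y * Z = 9 * (w * (3 * w\<^sup>2 - (x * Y + Y * Z + Z * x)))"
    by Groebner_Basis.algebra
  then show ?thesis unfolding eq by presburger
qed

text \<open>Cubes change the valuation by multiples of 3. If m and m' were both prime to 3, the
  valuations of A and B would have to agree modulo 3.\<close>

lemma valuation_3_distinct:
  fixes m m' A B X Y :: int
  assumes eq: "A * (3 ^ v * m) * X ^ 3 = B * (3 ^ v * m') * Y ^ 3" and nz: "A \<noteq> 0" "B \<noteq> 0" "X \<noteq> 0" "Y \<noteq> 0"
    and AB: "multiplicity 3 A mod 3 \<noteq> multiplicity 3 B mod 3"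
  shows "3 dvd m \<or> 3 dvd m'"
proof (rule ccontr)
  assume *: "\<not> ?thesis"
  then have m: "multiplicity 3 m = 0" "multiplicity 3 m' = 0" "m \<noteq> 0" "m' \<noteq> 0"
    by (auto simp: not_dvd_imp_multiplicity_0)
  have "3 ^ v * (A * m * X ^ 3) = 3 ^ v * (B * m' * Y ^ 3)" using eq by (simp add: mult_ac)
  then have "A * m * X ^ 3 = B * m' * Y ^ 3" by simp
  then have "multiplicity 3 (A * m * X ^ 3) = multiplicity 3 (B * m' * Y ^ 3)" by simp
  then have "multiplicity 3 A + 3 * multiplicity 3 X = multiplicity 3 B + 3 * multiplicity 3 Y"
    using nz m by (simp add: prime_elem_multiplicity_mult_distrib prime_elem_multiplicity_power_distrib prime_3_int)
  then show False using AB by presburger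
qed

text \<open>The common power of 3 is raised one step at a time. If 3^v divides the three numbers, it
  divides t as well, since t^3 is their product. The quotients then have a sum divisible by 3, and
  at most one of them is prime to 3; hence none is.\<close>

lemma dvd_27_of_valuations:
  fixes m0 m1 m2 t :: int
  assumes t: "t ^ 3 = m0 * m1 * m2" and sum: "27 dvd m0 + m1 + m2 - 3 * t"
    and d01: "\<And>v u w. m0 = 3 ^ v * u \<Longrightarrow> m1 = 3 ^ v * w \<Longrightarrow> 3 dvd u \<or> 3 dvd w"
    and d02: "\<And>v u w. m0 = 3 ^ v * u \<Longrightarrow> m2 = 3 ^ v * w \<Longrightarrow> 3 dvd u \<or> 3 dvd w"
    and d12: "\<And>v u w. m1 = 3 ^ v * u \<Longrightarrow> m2 = 3 ^ v * w \<Longrightarrow> 3 dvd u \<or> 3 dvd w"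
  shows "27 dvd m0 \<and> 27 dvd m1 \<and> 27 dvd m2"
proof -
  have "v \<le> 3 \<Longrightarrow> 3 ^ v dvd m0 \<and> 3 ^ v dvd m1 \<and> 3 ^ v dvd m2" for v :: nat
  proof (induction v)
    case (Suc v)
    then have dv: "3 ^ v dvd m0" "3 ^ v dvd m1" "3 ^ v dvd m2" by auto
    have "(3 ^ v) ^ 3 dvd m0 * m1 * m2"
      unfolding power3_eq_cube by (intro mult_dvd_mono dv)
    then have "(3 ^ v) ^ 3 dvd t ^ 3" by (simp only: t)
    then have "3 ^ v dvd t" by (simp only: pow_divides_pow_iff zero_less_numeral)
    then obtain t' where t': "t = 3 ^ v * t'" by blast
    obtain u0 where u0: "m0 = 3 ^ v * u0" using dv by blast
    obtain u1 where u1: "m1 = 3 ^ v * u1" using dv by blast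
    obtain u2 where u2: "m2 = 3 ^ v * u2" using dv by blast
    have "3 ^ Suc v dvd (3::int) ^ 3" using Suc.prems by (intro le_imp_power_dvd)
    then have "3 ^ Suc v dvd m0 + m1 + m2 - 3 * t" using sum by (auto intro: dvd_trans)
    moreover have "m0 + m1 + m2 - 3 * t = 3 ^ v * (u0 + u1 + u2 - 3 * t')"
      by (simp add: u0 u1 u2 t' algebra_simps)
    ultimately have "3 ^ v * 3 dvd 3 ^ v * (u0 + u1 + u2 - 3 * t')" by (simp add: mult.commute)
    then have s: "3 dvd u0 + u1 + u2 - 3 * t'" by simp
    have "3 dvd u0 \<or> 3 dvd u1" "3 dvd u0 \<or> 3 dvd u2" "3 dvd u1 \<or> 3 dvd u2"
      using d01[OF u0 u1] d02[OF u0 u2] d12[OF u1 u2] by auto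
    then have "3 dvd u0 \<and> 3 dvd u1 \<and> 3 dvd u2" using s by presburger
    then show ?case by (auto simp: u0 u1 u2 intro: mult_dvd_mono)
  qed simp
  from this[of 3] show ?thesis by simp
qed

text \<open>If \<open>n\<close> is cube-free and a prime outside \<open>ab\<close> divided it, then it would divide all coordinates
  of the adjoint to so high a power that its cube divides \<open>n\<close>.\<close>

lemma dvd_coprime_prime_contradiction:
  fixes n p h0 h1 h2 A B C :: int
  assumes p: "prime p" "p dvd n" "\<not> p ^ 3 dvd n" and A: "\<not> p dvd A" and B: "\<not> p dvd B"
    and h: "n\<^sup>2 dvd h0 ^ 3" "n\<^sup>2 dvd A * h1 ^ 3" "n\<^sup>2 dvd B * h2 ^ 3"
    and n: "n\<^sup>2 = h0 ^ 3 + A * h1 ^ 3 + B * h2 ^ 3 - 3 * C * h0 * h1 * h2"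
  shows False
proof -
  have p0: "p \<noteq> 0" using p(1) by auto
  have step: "p ^ Suc k dvd g" if k: "k \<le> 1" and pk: "(p ^ Suc k)\<^sup>2 dvd M * g ^ 3" and M: "\<not> p dvd M" and g: "p ^ k dvd g" for k g M
  proof -
    obtain c where c: "g = p ^ k * c" using g by blast
    have "p ^ 1 dvd p ^ (2 - k)" using k by (intro le_imp_power_dvd) simp
    have e: "p ^ k * (p ^ k) * p ^ k * p dvd (p ^ Suc k)\<^sup>2"
    proof -
      \<comment> \<open>The inequality 3 k + 1 \<le> 2 (k + 1) amounts to k \<le> 1, so the descent
        allows exactly the two rounds below.\<close>
      have "p ^ (3 * k + 1) dvd p ^ (2 * Suc k)" using k by (intro le_imp_power_dvd) simp
      then show ?thesis by (simp add: power_mult power_add power2_eq_square power3_eq_cube mult_ac flip: power_mult_distrib)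
    qed
    have "(p ^ k) ^ 3 * p dvd (p ^ k) ^ 3 * (M * c ^ 3)"
      using dvd_trans[OF e pk] by (simp add: c power_mult_distrib power3_eq_cube mult_ac)
    then have "p dvd M * c ^ 3" using p0 by simp
    then have "p dvd c" using M p(1) by (meson prime_dvd_mult_iff prime_dvd_power)
    then show ?thesis by (auto simp: c intro: mult_dvd_mono)
  qed
  have one: "\<not> p dvd 1" using p(1) by auto
  \<comment> \<open>First round: p divides the coordinates, so p^3 divides n^2 and p^2 divides n.
    Second round: p^2 divides the coordinates, so p^6 divides n^2, contradicting that n has no
    factor p^3.\<close>
  have pn: "(p ^ Suc 0)\<^sup>2 dvd n\<^sup>2" using p(2) by (simp add: dvd_power_same)
  have "p ^ Suc 0 dvd h0" "p ^ Suc 0 dvd h1" "p ^ Suc 0 dvd h2"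
    using step[of 0 1 h0] step[of 0 A h1] step[of 0 B h2] dvd_trans[OF pn h(1)] dvd_trans[OF pn h(2)]
      dvd_trans[OF pn h(3)] one A B by simp_all
  then obtain g0 g1 g2 where g: "h0 = p * g0" "h1 = p * g1" "h2 = p * g2" by (auto simp: dvd_def)
  have "n\<^sup>2 = p ^ 3 * (g0 ^ 3 + A * g1 ^ 3 + B * g2 ^ 3 - 3 * C * g0 * g1 * g2)"
    unfolding n g by Groebner_Basis.algebra
  then have "p ^ 3 dvd n\<^sup>2" by simp
  then have pn2: "p\<^sup>2 dvd n" using prime_cube_dvd_square[OF p(1), of n] by blast
  then have pn4: "(p ^ Suc 1)\<^sup>2 dvd n\<^sup>2" using dvd_power_same[OF pn2, of 2] by (simp add: power2_eq_square)
  have "p ^ Suc 1 dvd h0" "p ^ Suc 1 dvd h1" "p ^ Suc 1 dvd h2"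
    using step[of 1 1 h0] step[of 1 A h1] step[of 1 B h2] dvd_trans[OF pn4 h(1)] dvd_trans[OF pn4 h(2)]
      dvd_trans[OF pn4 h(3)] one A B g by simp_all
  then obtain f0 f1 f2 where f: "h0 = p\<^sup>2 * f0" "h1 = p\<^sup>2 * f1" "h2 = p\<^sup>2 * f2"
    by (auto simp: dvd_def power2_eq_square)
  have "n\<^sup>2 = (p ^ 3)\<^sup>2 * (f0 ^ 3 + A * f1 ^ 3 + B * f2 ^ 3 - 3 * C * f0 * f1 * f2)"
    unfolding n f by Groebner_Basis.algebra
  then have "(p ^ 3)\<^sup>2 dvd n\<^sup>2" by simp
  then have "p ^ 3 dvd n" by (simp only: pow_divides_pow_iff zero_less_numeral)
  then show False using p(3) by simp
qed

section \<open>Components of quotients by an invariant element\<close>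

context pure_cubic_closure
begin

text \<open>Projection to an eigenspace of \<sigma>: the sum of the conjugates, weighted by powers
  of the inverse eigenvalue w, is three times the component.\<close>

lemma homog_components:
  assumes "x \<in> \<rat>" "y \<in> \<rat>" "z \<in> \<rat>" and g: "g \<in> {x, y * D, z * E}"
  obtains w where "w \<in> {1, \<zeta>, \<zeta> * \<zeta>}"
    and "complex_of_real (3 * g) = complex_of_real (el x y z) + w * \<sigma> (complex_of_real (el x y z))
      + w * w * \<sigma> (\<sigma> (complex_of_real (el x y z)))"
proof -
  have k: "complex_of_real x \<in> k0" "complex_of_real y \<in> k0" "complex_of_real z \<in> k0"
    using assms Rats_in_k0 of_real_Rats by blast+
  consider "g = x" | "g = y * D" | "g = z * E" using g by blast
  then show thesis
  proof cases
    case 1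
    show thesis
      by (rule that[of 1], simp, unfold of_real_el, unfold sigma_sigma_kel[OF k], unfold sigma_kel[OF k],
          unfold kel_def of_real_mult of_real_numeral 1)
        (use zeta_zeta in Groebner_Basis.algebra)
  next
    case 2
    show thesis
      by (rule that[of "\<zeta> * \<zeta>"], simp, unfold of_real_el, unfold sigma_sigma_kel[OF k], unfold sigma_kel[OF k],
          unfold kel_def of_real_mult of_real_numeral 2)
        (use zeta_zeta in Groebner_Basis.algebra)
  next
    case 3
    show thesis
      by (rule that[of \<zeta>], simp, unfold of_real_el, unfold sigma_sigma_kel[OF k], unfold sigma_kel[OF k],
          unfold kel_def of_real_mult of_real_numeral 3)
        (use zeta_zeta in Groebner_Basis.algebra)
  qed
qed

lemma zeta_alg_int: "algebraic_int \<zeta>"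
  by (rule algebraic_int_power_imp[of \<zeta> 3]) (simp_all add: zeta_cubed)

lemma component_cube_Rats:
  assumes "x \<in> \<rat>" "y \<in> \<rat>" "z \<in> \<rat>" and "g \<in> {x, y * D, z * E}"
  shows "g ^ 3 \<in> \<rat>"
  using assms by (auto simp: power_mult_distrib D_cubed E_cubed)

text \<open>Multiply the twisted sum for 3 g by \<alpha>: each conjugate of the quotient becomes a
  conjugate of the integral product times a unit such as \<alpha> / \<sigma>(\<alpha>). So 3 g
  \<alpha> is integral; its cube, divided by the unit \<alpha>^3 / \<open>nm\<close> \<alpha>, is
  the claimed rational number.\<close>

lemma component_cube_27:
  assumes amb: "ambiguous \<alpha>" and xyz: "x \<in> \<rat>" "y \<in> \<rat>" "z \<in> \<rat>" and prod: "el x y z * \<alpha> \<in> OL"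
    and g: "g \<in> {x, y * D, z * E}"
  shows "27 * nm \<alpha> * g ^ 3 \<in> \<int>"
proof -
  have \<alpha>: "\<alpha> \<in> L" "\<alpha> \<noteq> 0" "\<alpha> ^ 3 / nm \<alpha> \<in> EL" using amb by (auto simp: ambiguous_def)
  define c where "c = complex_of_real \<alpha>"
  define t where "t = complex_of_real (el x y z)"
  have K: "c \<in> K" "t \<in> K" "c \<noteq> 0" "\<sigma> c \<noteq> 0" "\<sigma> (\<sigma> c) \<noteq> 0"
    using \<alpha> xyz el_in_L L_subset_K sigma_K sigma_eq_0 by (auto simp: c_def t_def)
  have tc: "t * c \<in> OK" using OK_of_real[OF prod] by (simp add: t_def c_def)
  have u: "\<sigma> c / c \<in> EK" using amb ambiguous_iff[OF \<alpha>(1,2)] by (simp add: c_def)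
  then have iu: "c / \<sigma> c \<in> OK" using ring_units_inverse[OF u] by (simp add: ring_units_iff)
  have "\<sigma> (c / \<sigma> c) * (c / \<sigma> c) \<in> OK" by (intro OK_mult OK_sigma iu)
  then have iuu: "c / \<sigma> (\<sigma> c) \<in> OK" using K by (simp add: sigma_divide sigma_K)
  obtain w where w: "w \<in> {1, \<zeta>, \<zeta> * \<zeta>}" and eq: "complex_of_real (3 * g) = t + w * \<sigma> t + w * w * \<sigma> (\<sigma> t)"
    unfolding t_def using homog_components[OF xyz g] by blast
  have wO: "w \<in> OK"
    using w zeta_alg_int K_subfield by (auto simp: OK_iff algebraic_int_mult is_subfieldD)
  have "complex_of_real (3 * g) * c = t * c + w * (\<sigma> (t * c) * (c / \<sigma> c)) + w * w * (\<sigma> (\<sigma> (t * c)) * (c / \<sigma> (\<sigma> c)))"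
    unfolding eq using K by (simp add: sigma_mult sigma_K algebra_simps)
  also have "\<dots> \<in> OK" by (intro OK_add OK_mult OK_sigma tc wO iu iuu)
  finally have "algebraic_int (complex_of_real (3 * g * \<alpha>))" by (simp add: OK_iff c_def)
  then have "algebraic_int ((3 * g * \<alpha>) ^ 3)" by (simp only: algebraic_int_of_real_iff algebraic_int_power)
  moreover have "algebraic_int (inverse (\<alpha> ^ 3 / nm \<alpha>))" using \<alpha>(3) by (auto simp: ring_units_iff OL_iff)
  ultimately have "algebraic_int ((3 * g * \<alpha>) ^ 3 * inverse (\<alpha> ^ 3 / nm \<alpha>))" by (rule algebraic_int_mult)
  moreover have "(3 * g * \<alpha>) ^ 3 * inverse (\<alpha> ^ 3 / nm \<alpha>) = 27 * nm \<alpha> * g ^ 3"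
    using \<alpha>(2) nm_eq_0[OF \<alpha>(1)] by (simp add: power_mult_distrib field_simps)
  moreover have "27 * nm \<alpha> * g ^ 3 \<in> \<rat>"
    using component_cube_Rats[OF xyz g] nm_Rats[OF \<alpha>(1)] by simp
  ultimately show ?thesis by (metis rational_algebraic_int_is_int)
qed

text \<open>Exactly one of a and b has valuation 1 at 3, the other 0. Hence the summands x^3, d y^3
  and a^2 b z^3 of the norm have pairwise incongruent valuations modulo 3; the last two are compared
  after dividing by ab.\<close>

lemma multiplicity_3_ab:
  assumes "3 dvd d"
  shows "multiplicity 3 (int a * (int b)\<^sup>2) mod 3 \<noteq> 0" "multiplicity 3 ((int a)\<^sup>2 * int b) mod 3 \<noteq> 0"
    "multiplicity 3 (int a) mod 3 \<noteq> multiplicity 3 (int b) mod 3"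
proof -
  have m1: "multiplicity 3 n = 1" if "3 dvd n" "\<not> 9 dvd n" for n :: int
    using that by (intro multiplicity_eqI) auto
  have nz: "int a \<noteq> 0" "int b \<noteq> 0" using ab_pos by auto
  have m0: "multiplicity 3 n = 0" if "\<not> 3 dvd n" for n :: int
    using that by (rule not_dvd_imp_multiplicity_0)
  have "3 dvd int a \<or> 3 dvd int b" using assms three_dvd_d by presburger
  then have "(multiplicity 3 (int a) = 1 \<and> multiplicity 3 (int b) = 0) \<or>
      (multiplicity 3 (int a) = 0 \<and> multiplicity 3 (int b) = 1)"
    using m1 m0 not_9_dvd not_3_dvd_both by blast
  then show "multiplicity 3 (int a * (int b)\<^sup>2) mod 3 \<noteq> 0" "multiplicity 3 ((int a)\<^sup>2 * int b) mod 3 \<noteq> 0"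
    "multiplicity 3 (int a) mod 3 \<noteq> multiplicity 3 (int b) mod 3"
    using nz by (auto simp: prime_elem_multiplicity_mult_distrib prime_elem_multiplicity_power_distrib prime_3_int)
qed

lemma rat_common_ratio:
  assumes "x \<in> \<rat>" "y \<in> \<rat>" "x \<noteq> 0" "y \<noteq> (0::real)"
  obtains X Y :: int where "X \<noteq> 0" "Y \<noteq> 0" "x * of_int Y = y * of_int X"
proof -
  have "x / y \<in> \<rat>" using assms by simp
  then obtain p q :: int where pq: "q > 0" "x / y = of_int p / of_int q" by (auto elim: Rats_cases')
  then have "p \<noteq> 0" using assms by auto
  then show thesis using that[of p q] pq assms by (simp add: field_simps)
qed

text \<open>Clearing the common denominator of x / y reduces this to
  \<open>valuation_3_distinct\<close>; if x or y is zero, so is u or w.\<close>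

lemma valuations_from_rationals:
  assumes xy: "x \<in> \<rat>" "y \<in> \<rat>" and nz: "A \<noteq> 0" "B \<noteq> 0" "c \<noteq> 0"
    and m: "c * real_of_int A * x ^ 3 = of_int m" and m': "c * real_of_int B * y ^ 3 = of_int m'"
    and AB: "multiplicity 3 A mod 3 \<noteq> multiplicity 3 B mod 3"
    and mu: "m = 3 ^ v * u" "m' = 3 ^ v * w"
  shows "3 dvd u \<or> 3 dvd w"
proof (cases "x = 0 \<or> y = 0")
  case True
  then have "m = 0 \<or> m' = 0" using m m' by auto
  then have "u = 0 \<or> w = 0" using mu by auto
  then show ?thesis by auto
next
  case False
  then obtain X Y :: int where XY: "X \<noteq> 0" "Y \<noteq> 0" "x * of_int Y = y * of_int X"
    using rat_common_ratio[of x y] xy by blast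
  have "real_of_int (B * m * Y ^ 3) = real_of_int (A * m' * X ^ 3)"
    using XY(3) unfolding of_int_mult of_int_power m[symmetric] m'[symmetric] by Groebner_Basis.algebra
  then have "B * (3 ^ v * u) * Y ^ 3 = A * (3 ^ v * w) * X ^ 3" by (simp only: of_int_eq_iff mu)
  then show ?thesis using valuation_3_distinct[of B v u Y A w X] nz XY AB by auto
qed

text \<open>This removes the factor 27 of \<open>component_cube_27\<close>. If 3 divides d, the
  three numbers 27 \<open>nm\<close> \<alpha> g^3 satisfy the hypotheses of
  \<open>dvd_27_of_valuations\<close>, their combined divisibility coming from the norm of the
  product. If 3 does not divide n, a power of n also clears the denominator, and it is coprime to
  27.\<close>

lemma component_cube_int:
  assumes amb: "ambiguous \<alpha>" and \<alpha>: "\<alpha> \<in> O0" and n: "nm \<alpha> = of_int n" and three: "3 dvd d \<or> \<not> 3 dvd n"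
    and xyz: "x \<in> \<rat>" "y \<in> \<rat>" "z \<in> \<rat>" and prod: "el x y z * \<alpha> \<in> O0"
    and g: "g \<in> {x, y * D, z * E}"
  shows "nm \<alpha> * g ^ 3 \<in> \<int>"
proof -
  have 27: "27 * nm \<alpha> * g ^ 3 \<in> \<int>" if "g \<in> {x, y * D, z * E}" for g
    using component_cube_27[OF amb xyz _ that] prod O0_subset_OL by blast
  have \<alpha>L: "\<alpha> \<in> L" "\<alpha> \<noteq> 0" using amb by (auto simp: ambiguous_def)
  have n0: "n \<noteq> 0" using n nm_eq_0 \<alpha>L by auto
  show ?thesis
  proof (cases "3 dvd d")
    case True
    obtain m0 where m0: "27 * nm \<alpha> * x ^ 3 = of_int m0" using 27[of x] by (auto elim: Ints_cases)
    obtain m1 where m1: "27 * nm \<alpha> * (y * D) ^ 3 = of_int m1" using 27[of "y * D"] by (auto elim: Ints_cases)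
    obtain m2 where m2: "27 * nm \<alpha> * (z * E) ^ 3 = of_int m2" using 27[of "z * E"] by (auto elim: Ints_cases)
    \<comment> \<open>The cube root of m0 m1 m2; it is rational because D E = ab, and hence an
      integer.\<close>
    define s where "s = 27 * nm \<alpha> * (x * (y * D) * (z * E))"
    have s3: "s ^ 3 = of_int (m0 * m1 * m2)"
      unfolding of_int_mult m0[symmetric] m1[symmetric] m2[symmetric] s_def by Groebner_Basis.algebra
    have "s = 27 * nm \<alpha> * (x * y * z * (D * E))" unfolding s_def by Groebner_Basis.algebra
    then have "s \<in> \<rat>" using D_E xyz nm_Rats \<alpha>L by simp
    moreover have "s ^ 3 \<in> \<int>" by (simp only: s3 Ints_of_int)
    ultimately have "s \<in> \<int>" by (rule Rats_power_imp_root3)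
    then obtain t where t: "s = of_int t" by (elim Ints_cases)
    have t3: "t ^ 3 = m0 * m1 * m2" using s3 unfolding t by (simp only: of_int_eq_iff flip: of_int_power)
    obtain k where k: "nm (el x y z * \<alpha>) = of_int k" using nm_int[OF O0_subset_OL[OF prod]] by (elim Ints_cases)
    have "of_int (m0 + m1 + m2 - 3 * t) = 27 * nm \<alpha> * nf x y z"
    proof -
      have "27 * nm \<alpha> * nf x y z = 27 * nm \<alpha> * (x ^ 3 + (y * D) ^ 3 + (z * E) ^ 3 - 3 * x * (y * D) * (z * E))"
        unfolding nf_def using D_cubed E_cubed D_E by Groebner_Basis.algebra
      also have "\<dots> = 27 * nm \<alpha> * x ^ 3 + 27 * nm \<alpha> * (y * D) ^ 3 + 27 * nm \<alpha> * (z * E) ^ 3 - 3 * s"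
        unfolding s_def by Groebner_Basis.algebra
      finally show ?thesis unfolding m0 m1 m2 t by simp
    qed
    also have "\<dots> = 27 * of_int k"
      using k xyz \<alpha>L el_in_L by (simp add: nm_mult nm_el mult.commute)
    also have "\<dots> = of_int (27 * k)" by simp
    finally have "m0 + m1 + m2 - 3 * t = 27 * k" by (simp only: of_int_eq_iff)
    then have sum: "27 dvd m0 + m1 + m2 - 3 * t" by simp
    have c: "27 * nm \<alpha> * real_of_int 1 * x ^ 3 = of_int m0"
      "27 * nm \<alpha> * real_of_int (int a * (int b)\<^sup>2) * y ^ 3 = of_int m1"
      "27 * nm \<alpha> * real_of_int ((int a)\<^sup>2 * int b) * z ^ 3 = of_int m2"
      using m0 m1 m2 by (simp_all add: power_mult_distrib D_cubed E_cubed mult_ac)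
    \<comment> \<open>The factor ab is moved into the constant, so that b y^3 is compared with a
      z^3.\<close>
    have cc: "(27 * nm \<alpha> * real a * real b) * real_of_int (int b) * y ^ 3 = of_int m1"
      "(27 * nm \<alpha> * real a * real b) * real_of_int (int a) * z ^ 3 = of_int m2"
      using c by (simp_all add: power2_eq_square mult_ac)
    have nz: "27 * nm \<alpha> \<noteq> 0" "27 * nm \<alpha> * real a * real b \<noteq> 0" "int a * (int b)\<^sup>2 \<noteq> 0" "(int a)\<^sup>2 * int b \<noteq> 0"
      "int a \<noteq> 0" "int b \<noteq> 0"
      using n n0 ab_pos by auto
    note mult = multiplicity_3_ab[OF True]
    have m1mod: "multiplicity 3 (1::int) mod 3 = 0" by simp
    have "27 dvd m0 \<and> 27 dvd m1 \<and> 27 dvd m2"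
    proof (rule dvd_27_of_valuations[OF t3 sum])
      fix v u w
      show "3 dvd u \<or> 3 dvd w" if "m0 = 3 ^ v * u" "m1 = 3 ^ v * w"
        by (rule valuations_from_rationals[OF xyz(1,2) one_neq_zero nz(3,1) c(1,2) _ that]) (use mult m1mod in metis)
      show "3 dvd u \<or> 3 dvd w" if "m0 = 3 ^ v * u" "m2 = 3 ^ v * w"
        by (rule valuations_from_rationals[OF xyz(1,3) one_neq_zero nz(4,1) c(1,3) _ that]) (use mult m1mod in metis)
      show "3 dvd u \<or> 3 dvd w" if "m1 = 3 ^ v * u" "m2 = 3 ^ v * w"
        by (rule valuations_from_rationals[OF xyz(2,3) nz(6,5,2) cc _ that]) (use mult in metis)
    qed
    then obtain k0 k1 k2 where "m0 = 27 * k0" "m1 = 27 * k1" "m2 = 27 * k2" by (auto simp: dvd_def)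
    then have "nm \<alpha> * x ^ 3 = of_int k0" "nm \<alpha> * (y * D) ^ 3 = of_int k1" "nm \<alpha> * (z * E) ^ 3 = of_int k2"
      using m0 m1 m2 by simp_all
    then show ?thesis using g by auto
  next
    case False
    then have n3: "\<not> 3 dvd n" using three by blast
    \<comment> \<open>Multiplication by \<open>cp\<close> \<alpha> replaces \<alpha> by its norm, so
      n times the quotient has integer coordinates.\<close>
    have "(el x y z * \<alpha>) * cp \<alpha> \<in> O0" by (rule O0_mult[OF prod O0_cp[OF \<alpha>]])
    moreover have "(el x y z * \<alpha>) * cp \<alpha> = el x y z * of_int n"
      by (simp only: mult.assoc n[unfolded nm_def])
    ultimately have "el (of_int n * x) (of_int n * y) (of_int n * z) \<in> O0"
      by (simp only: el_scale mult.commute[of "el x y z"])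
    then obtain X Y Z :: int where "el (of_int n * x) (of_int n * y) (of_int n * z) = el (of_int X) (of_int Y) (of_int Z)"
      by (rule O0E)
    then have XYZ: "of_int n * x = of_int X" "of_int n * y = of_int Y" "of_int n * z = of_int Z"
      using xyz by (simp_all add: el_inject)
    have "(of_int n * x) ^ 3 \<in> \<int>" unfolding XYZ by simp
    moreover have "(of_int n * (y * D)) ^ 3 \<in> \<int>"
      unfolding mult.assoc[symmetric] XYZ by (simp add: power_mult_distrib D_cubed)
    moreover have "(of_int n * (z * E)) ^ 3 \<in> \<int>"
      unfolding mult.assoc[symmetric] XYZ by (simp add: power_mult_distrib E_cubed)
    ultimately have "(of_int n * g) ^ 3 \<in> \<int>" using g by auto
    moreover have "of_int n * of_int n * (nm \<alpha> * g ^ 3) = (of_int n * g) ^ 3"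
      unfolding n by Groebner_Basis.algebra
    ultimately have n2: "of_int n * of_int n * (nm \<alpha> * g ^ 3) \<in> \<int>" by (simp only:)
    have "coprime (3 :: int) n" using n3 by (intro prime_imp_coprime prime_3_int)
    then have "coprime (n * n) ((3 :: int) ^ 3)"
      by (simp only: coprime_power_right_iff coprime_mult_left_iff coprime_commute[of n 3] simp_thms)
    then have "coprime (n * n) 27" by simp
    then have "gcd (n * n) 27 = 1" by (rule coprime_imp_gcd_eq_1)
    then obtain s t where "s * (n * n) + t * 27 = 1" using bezout_int[of "n * n" 27] by auto
    then have "real_of_int (s * (n * n) + t * 27) = real_of_int 1" by (simp only:)
    then have st: "of_int s * (of_int n * of_int n) + of_int t * 27 = (1::real)"
      by (simp only: of_int_add of_int_mult of_int_numeral of_int_1)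
    have "nm \<alpha> * g ^ 3 = of_int s * (of_int n * of_int n * (nm \<alpha> * g ^ 3)) + of_int t * (27 * nm \<alpha> * g ^ 3)"
      using st by Groebner_Basis.algebra
    also have "\<dots> \<in> \<int>" using n2 27[OF g] by simp
    finally show ?thesis .
  qed
qed

lemma norm_el_int: "nm (el (of_int x) (of_int y) (of_int z)) =
    of_int (x ^ 3 + int a * (int b)\<^sup>2 * y ^ 3 + (int a)\<^sup>2 * int b * z ^ 3 - 3 * int a * int b * x * y * z)"
  by (simp add: nm_el nf_def)

section \<open>Non-trivial invariant elements of least norm\<close>

lemma ambiguous_mult_homog:
  assumes amb: "ambiguous \<alpha>" and s: "homog s"
  shows "ambiguous (\<alpha> * s)" and "(\<alpha> * s) ^ 3 / nm (\<alpha> * s) = \<alpha> ^ 3 / nm \<alpha>"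
proof -
  have \<alpha>: "\<alpha> \<in> L" "\<alpha> \<noteq> 0" using amb by (auto simp: ambiguous_def)
  have sL: "s \<in> L" "s \<noteq> 0" using s homog_in_L homog_nonzero by auto
  show eq: "(\<alpha> * s) ^ 3 / nm (\<alpha> * s) = \<alpha> ^ 3 / nm \<alpha>"
    using \<alpha> sL by (simp add: nm_mult nm_homog[OF s] power_mult_distrib)
  show "ambiguous (\<alpha> * s)"
    using amb \<alpha> sL is_subfieldD(4)[OF L_subfield] by (simp add: ambiguous_def eq)
qed

lemma ambiguous_power:
  assumes amb: "ambiguous \<alpha>"
  shows "ambiguous (\<alpha> ^ n)"
proof -
  have \<alpha>: "\<alpha> \<in> L" "\<alpha> \<noteq> 0" using amb by (auto simp: ambiguous_def)
  have "(\<alpha> ^ n) ^ 3 / nm (\<alpha> ^ n) = (\<alpha> ^ 3 / nm \<alpha>) ^ n"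
    using \<alpha> by (simp add: nm_power power_divide mult.commute flip: power_mult)
  then show ?thesis using amb \<alpha> is_subfieldD(9)[OF L_subfield] EL_power by (simp add: ambiguous_def)
qed

text \<open>The cube of \<alpha> is its norm times a unit.\<close>

lemma ambiguous_integral:
  assumes amb: "ambiguous \<alpha>" and n: "nm \<alpha> \<in> \<int>"
  shows "\<alpha> \<in> OL"
proof -
  have \<alpha>: "\<alpha> \<in> L" "\<alpha> \<noteq> 0" "\<alpha> ^ 3 / nm \<alpha> \<in> EL" using amb by (auto simp: ambiguous_def)
  have "algebraic_int (\<alpha> ^ 3 / nm \<alpha>)" using \<alpha>(3) unfolding ring_units_iff OL_iff by blast
  then have "algebraic_int (nm \<alpha> * (\<alpha> ^ 3 / nm \<alpha>))"
    by (rule algebraic_int_mult[OF int_imp_algebraic_int[OF n]])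
  then have "algebraic_int (\<alpha> ^ 3)" using nm_eq_0 \<alpha> by simp
  then show ?thesis using \<alpha> algebraic_int_power_imp[of \<alpha> 3] by (simp add: OL_iff)
qed

lemma trivial_mult_iff:
  assumes "s \<in> trivial_factors" "s \<noteq> 0"
  shows "\<alpha> * s \<in> trivial_factors \<longleftrightarrow> \<alpha> \<in> trivial_factors"
proof -
  note gen = mult_subgroup_generated_subgroup[where S = "EL \<union> (\<rat> - {0}) \<union> {D}", folded trivial_factors_def]
  have eq: "\<alpha> * s * inverse s = \<alpha>" using assms by simp
  show ?thesis
  proof
    assume "\<alpha> * s \<in> trivial_factors"
    then have "\<alpha> * s * inverse s \<in> trivial_factors" using gen(3)[OF assms(1)] by (rule gen(2))
    then show "\<alpha> \<in> trivial_factors" unfolding eq .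
  next
    assume "\<alpha> \<in> trivial_factors"
    then show "\<alpha> * s \<in> trivial_factors" using assms(1) by (rule gen(2))
  qed
qed

lemma trivial_factorsI: "u \<in> EL \<Longrightarrow> homog s \<Longrightarrow> u * s \<in> trivial_factors"
  unfolding trivial_factors_eq by blast

lemma homog_trivial: "homog s \<Longrightarrow> s \<in> trivial_factors"
  using trivial_factorsI[OF EL_1] by simp

lemma EL_trivial: "u \<in> EL \<Longrightarrow> u \<in> trivial_factors"
  using trivial_factorsI[OF _ homog_1] by simp

lemma component_homog:
  assumes "x \<in> \<rat>" "y \<in> \<rat>" "z \<in> \<rat>" "g \<in> {x, y * D, z * E}" "g \<noteq> 0"
  shows "homog g"
  using assms homogI[of x 1] homogI[of y D] homogI[of z E] by auto

lemma homog_abs: "homog s \<Longrightarrow> homog \<bar>s\<bar>"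
  using homog_mult[of s "-1"] homog_of_Rats[of "-1"] by (auto simp: abs_if)

text \<open>The elements among which one of least norm is chosen. The last clause supplies the
  hypothesis on 3 by which \<open>component_cube_int\<close> removes the factor 27.\<close>

definition candidate :: "real \<Rightarrow> nat \<Rightarrow> bool" where
  "candidate \<alpha> n \<longleftrightarrow> \<alpha> \<in> O0 \<and> 0 < \<alpha> \<and> ambiguous \<alpha> \<and> \<alpha> \<notin> trivial_factors \<and> nm \<alpha> = real n \<and>
     (3 dvd d \<or> \<not> 3 dvd n)"

lemma homog_cube_equation:
  assumes g: "homog g" and k: "real n * g ^ 3 = real k"
  obtains p q :: int and e N where "g = of_int p / of_int q * e" "q > 0" "coprime p q" "e \<in> O0"
    "3 dvd N \<Longrightarrow> 3 dvd d" "int n * p ^ 3 * int N = int k * q ^ 3"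
proof -
  obtain y e where ye: "g = y * e" "y \<in> \<rat>" "y \<noteq> 0" "e \<in> {1, D, E}" using g by (rule homogE)
  obtain N where N: "e ^ 3 = real N" "e \<in> O0" "3 dvd N \<Longrightarrow> 3 dvd d"
    by (rule basis_cube[OF ye(4)]) (rule that)
  obtain p q :: int where pq: "q > 0" "coprime p q" "y = of_int p / of_int q"
    using ye(2) by (auto elim: Rats_cases')
  have "real n * of_int p ^ 3 * real N = real k * of_int q ^ 3"
    using k pq(1) N(1) by (simp add: ye(1) pq(3) power_mult_distrib power_divide field_simps)
  then have "real_of_int (int n * p ^ 3 * int N) = real_of_int (int k * q ^ 3)" by simp
  then have "int n * p ^ 3 * int N = int k * q ^ 3" by (simp only: of_int_eq_iff)
  then show thesis using that[of p q e N] ye(1) pq N by simp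
qed

text \<open>Homogeneous factors change neither invariance nor non-triviality, and the new norm is k.
  The remaining point is membership in \<open>O0\<close> when 3 does not divide d: the denominator q
  of g is then prime to 3, because n and the cube of the basis element are.\<close>

lemma candidate_scale:
  assumes c: "candidate \<alpha> n" and d: "d mod 9 \<in> {0, 3, 6, 1, 8}" and g: "homog g" "0 < g"
    and k: "real n * g ^ 3 = real k" and k3: "3 dvd d \<or> \<not> 3 dvd k"
  shows "candidate (\<alpha> * g) k"
proof -
  have \<alpha>: "\<alpha> \<in> O0" "0 < \<alpha>" "ambiguous \<alpha>" "\<alpha> \<notin> trivial_factors" "nm \<alpha> = real n" "3 dvd d \<or> \<not> 3 dvd n"
    using c by (auto simp: candidate_def)
  have amb: "ambiguous (\<alpha> * g)" using ambiguous_mult_homog \<alpha>(3) g by blast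
  have nm: "nm (\<alpha> * g) = real k"
    using \<alpha>(1,5) g O0_in_L homog_in_L k by (simp add: nm_mult nm_homog)
  have OL: "\<alpha> * g \<in> OL" using ambiguous_integral[OF amb] by (simp add: nm)
  have triv: "\<alpha> * g \<notin> trivial_factors" using trivial_mult_iff[OF homog_trivial[OF g(1)]] \<alpha>(4) g(2) by simp
  have "\<alpha> * g \<in> O0"
  proof (cases "3 dvd d")
    case True
    then have "d mod 9 \<noteq> 1" "d mod 9 \<noteq> 8" by presburger+
    then show ?thesis using OL OL_eq_O0 by auto
  next
    case False
    then have n3: "\<not> 3 dvd int n" using \<alpha>(6) by presburger
    obtain p q :: int and e N where pq: "g = of_int p / of_int q * e" "q > 0" "coprime p q" "e \<in> O0"
      "3 dvd N \<Longrightarrow> 3 dvd d" "int n * p ^ 3 * int N = int k * q ^ 3"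
      by (rule homog_cube_equation[OF g(1) k]) (rule that)
    have "\<not> 3 dvd q"
    proof
      assume q3: "3 dvd q"
      then have p3: "\<not> 3 dvd p" using pq(3) by (meson coprime_common_divisor not_prime_unit prime_3_int)
      have "3 dvd int n * p ^ 3 * int N" unfolding pq(6) using q3 by (simp add: power3_eq_cube)
      then have "3 dvd int N" using n3 p3 three_dvd_cube prime_dvd_mult_iff[OF prime_3_int] by blast
      then have "3 dvd N" by presburger
      then show False using pq(5) False by blast
    qed
    moreover have eq: "\<alpha> * g * of_int q = of_int p * (\<alpha> * e)" using pq(1,2) by simp
    have "\<alpha> * g * of_int q \<in> O0" unfolding eq by (intro O0_mult O0_of_int \<alpha> pq)
    ultimately show ?thesis using OL_prime_to_3_O0[OF OL] by blast
  qed
  then show ?thesis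
    using \<alpha> amb nm triv k3 g by (simp add: candidate_def)
qed

text \<open>\<alpha> g has norm k, so minimality gives n \<le> k unless k violates the clause on 3.
  In that case 3 divides the numerator of g, 27 divides k, and the induction passes to g / 3, which
  proves even more.\<close>

lemma minimal_candidate_homog_ge_1:
  assumes c: "candidate \<alpha> n" and d: "d mod 9 \<in> {0, 3, 6, 1, 8}"
    and min: "\<forall>\<beta> m. candidate \<beta> m \<longrightarrow> n \<le> m"
  shows "homog g \<Longrightarrow> 0 < g \<Longrightarrow> real n * g ^ 3 = real k \<Longrightarrow> 1 \<le> g"
proof (induction k arbitrary: g rule: less_induct)
  case (less k)
  have n: "0 < real n" using c nm_pos[of \<alpha>] O0_in_L[of \<alpha>] by (simp add: candidate_def)
  show ?case
  proof (cases "3 dvd d \<or> \<not> 3 dvd k")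
    case True
    have "n \<le> k" using min candidate_scale[OF c d less.prems True] by blast
    then have "1 * real n \<le> g ^ 3 * real n" using less.prems(3) by (simp add: mult.commute)
    then have "1 \<le> g ^ 3" using n by simp
    show ?thesis
    proof (rule ccontr)
      assume "\<not> 1 \<le> g"
      then have "g ^ 3 < 1" using less.prems(2) by (simp add: power_less_one_iff)
      then show False using \<open>1 \<le> g ^ 3\<close> by simp
    qed
  next
    case False
    have "3 dvd d \<or> \<not> 3 dvd n" using c unfolding candidate_def by blast
    then have n3: "\<not> 3 dvd int n" using False by presburger
    obtain p q :: int and e N where pq: "g = of_int p / of_int q * e" "q > 0" "coprime p q" "e \<in> O0"
      "3 dvd N \<Longrightarrow> 3 dvd d" "int n * p ^ 3 * int N = int k * q ^ 3"
      by (rule homog_cube_equation[OF less.prems(1,3)]) (rule that)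
    have N3: "\<not> 3 dvd int N" using pq(5) False by presburger
    have "3 dvd int k" using False by presburger
    then have "3 dvd int n * p ^ 3 * int N" unfolding pq(6) by (rule dvd_mult2)
    then have p3: "3 dvd p" using n3 N3 three_dvd_cube prime_dvd_mult_iff[OF prime_3_int] by blast
    then have q3: "\<not> 3 dvd q" using pq(3) by (meson coprime_common_divisor not_prime_unit prime_3_int)
    then have "coprime (3::int) q" by (intro prime_imp_coprime prime_3_int)
    then have cop: "coprime ((3::int) ^ 3) (q ^ 3)"
      by (simp only: coprime_power_left_iff coprime_power_right_iff simp_thms)
    have "(3::int) ^ 3 dvd int k * q ^ 3"
      unfolding pq(6)[symmetric] by (intro dvd_mult2 dvd_mult dvd_power_same p3)
    then have "(3::int) ^ 3 dvd int k" using cop coprime_dvd_mult_left_iff by blast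
    then have "27 dvd int k" by simp
    then have "27 dvd k" by presburger
    then obtain j where j: "k = 27 * j" by blast
    have g3: "homog (g / 3)" using homog_mult[OF less.prems(1) homog_of_Rats[of "1/3"]] by simp
    have "0 < real n * g ^ 3" using n less.prems(2) by (intro mult_pos_pos zero_less_power)
    then have "0 < real k" using less.prems(3) by simp
    then have "j < k" using j by simp
    moreover have "real n * (g / 3) ^ 3 = real j" using less.prems(3) j by (simp add: power_divide)
    ultimately have "1 \<le> g / 3" using less.IH[of j "g / 3"] g3 less.prems(2) by simp
    then show ?thesis by simp
  qed
qed

lemma cmod_3_sum_less:
  assumes "cmod w = 1" "cmod t < 1" "cmod u < 1" "cmod v < 1"
  shows "cmod (t + w * u + w * w * v) < 3"
proof -
  have "cmod (t + w * u + w * w * v) \<le> cmod t + cmod (w * u) + cmod (w * w * v)"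
    by (meson norm_triangle_mono norm_triangle_ineq order_refl)
  also have "\<dots> < 3" using assms by (simp add: norm_mult)
  finally show ?thesis .
qed

lemma minimal_candidate_lattice_minimum:
  assumes c: "candidate \<alpha> n" and d: "d mod 9 \<in> {0, 3, 6, 1, 8}"
    and min: "\<forall>\<beta> m. candidate \<beta> m \<longrightarrow> n \<le> m"
  shows "\<alpha> \<in> lattice_minima \<sigma> O0"
proof -
  have \<alpha>: "\<alpha> \<in> O0" "0 < \<alpha>" "ambiguous \<alpha>" "nm \<alpha> = real n" "3 dvd d \<or> \<not> 3 dvd n"
    using c by (auto simp: candidate_def)
  have \<alpha>L: "\<alpha> \<in> L" using \<alpha> O0_in_L by blast
  have n: "0 < real n" using nm_pos[OF \<alpha>L \<alpha>(2)] \<alpha>(4) by simp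
  have "\<beta> = 0" if \<beta>: "\<beta> \<in> O0" "conj_prod \<sigma> \<beta> < conj_prod \<sigma> \<alpha>" "0 \<le> \<beta>" "\<beta> < \<alpha>" for \<beta>
  proof -
    define \<gamma> where "\<gamma> = \<beta> / \<alpha>"
    have \<beta>L: "\<beta> \<in> L" using \<beta> O0_in_L by blast
    have \<gamma>L: "\<gamma> \<in> L" unfolding \<gamma>_def using \<beta>L \<alpha>L by (rule is_subfieldD(8)[OF L_subfield])
    have \<beta>_eq: "\<gamma> * \<alpha> = \<beta>" using \<alpha>(2) by (simp add: \<gamma>_def)
    obtain x y z where xyz: "\<gamma> = el x y z" "x \<in> \<rat>" "y \<in> \<rat>" "z \<in> \<rat>" using \<gamma>L by (rule L_cases)
    have "cp \<gamma> * cp \<alpha> < 1 * cp \<alpha>"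
      using \<beta>(2) \<beta>_eq \<beta>L \<alpha>L \<gamma>L by (simp add: conj_prod_L flip: cp_mult)
    then have "cp \<gamma> < 1" using cp_pos[OF \<alpha>L] \<alpha>(2) by simp
    then have s1: "cmod (\<sigma> (complex_of_real \<gamma>)) < 1" by (simp add: cp_def power_less_one_iff abs_square_less_1)
    then have s2: "cmod (\<sigma> (\<sigma> (complex_of_real \<gamma>))) < 1" using sigma_sigma_L[OF \<gamma>L] by simp
    have "\<bar>\<gamma>\<bar> < 1" using \<beta>(3,4) \<alpha>(2) by (simp add: \<gamma>_def)
    then have s0: "cmod (complex_of_real \<gamma>) < 1" by (simp only: norm_of_real)
    have zero: "g = 0" if g: "g \<in> {x, y * D, z * E}" for g
    proof (rule ccontr)
      assume g0: "g \<noteq> 0"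
      have hg: "homog \<bar>g\<bar>" using component_homog[OF xyz(2-4) g g0] by (rule homog_abs)
      have "nm \<alpha> * g ^ 3 \<in> \<int>"
      proof (rule component_cube_int[OF \<alpha>(3,1) _ _ xyz(2-4) _ g])
        show "nm \<alpha> = of_int (int n)" using \<alpha>(4) by simp
        show "3 dvd d \<or> \<not> 3 dvd int n" using \<alpha>(5) by presburger
        show "el x y z * \<alpha> \<in> O0" using \<beta>_eq \<beta>(1) xyz(1) by simp
      qed
      then obtain j where j: "real n * g ^ 3 = of_int j" using \<alpha>(4) by (auto elim: Ints_cases)
      have "real n * \<bar>g\<bar> ^ 3 = \<bar>real n * g ^ 3\<bar>" by (simp add: abs_mult power_abs)
      also have "\<dots> = real (nat \<bar>j\<bar>)" using j by simp
      finally have "real n * \<bar>g\<bar> ^ 3 = real (nat \<bar>j\<bar>)" .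
      moreover have "0 < \<bar>g\<bar>" using g0 by simp
      ultimately have "1 \<le> \<bar>g\<bar>" by (intro minimal_candidate_homog_ge_1[OF c d min hg])
      obtain w where w: "w \<in> {1, \<zeta>, \<zeta> * \<zeta>}" and eq: "complex_of_real (3 * g) = complex_of_real \<gamma> + w * \<sigma> (complex_of_real \<gamma>)
          + w * w * \<sigma> (\<sigma> (complex_of_real \<gamma>))"
        unfolding xyz(1) using homog_components[OF xyz(2-4) g] by blast
      have "cmod w = 1" using w cmod_zeta by (auto simp: norm_mult)
      then have "cmod (complex_of_real (3 * g)) < 3" unfolding eq using s0 s1 s2 by (rule cmod_3_sum_less)
      then have "\<bar>g\<bar> < 1" by (simp add: norm_mult)
      then show False using \<open>1 \<le> \<bar>g\<bar>\<close> by simp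
    qed
    have "x = 0" "y * D = 0" "z * E = 0" by (rule zero; simp)+
    then have "\<gamma> = 0" by (simp only: xyz(1) el_def add_0)
    then show ?thesis using \<beta>_eq by simp
  qed
  then show ?thesis using \<alpha> unfolding lattice_minima_def by blast
qed

text \<open>n is cube-free: a factor p^3 would admit the scaling g = 1 / p, which is less than 1.
  For a prime divisor outside ab, the components of 1 / \<alpha> give the divisibilities of
  \<open>dvd_coprime_prime_contradiction\<close>, with h0, h1, h2 the coordinates of the
  adjoint.\<close>

lemma minimal_candidate_norm:
  assumes c: "candidate \<alpha> n" and d: "d mod 9 \<in> {0, 3, 6, 1, 8}"
    and min: "\<forall>\<beta> m. candidate \<beta> m \<longrightarrow> n \<le> m"
  shows "int n dvd R\<^sup>2"
proof -
  have \<alpha>: "\<alpha> \<in> O0" "0 < \<alpha>" "ambiguous \<alpha>" "nm \<alpha> = real n" "3 dvd d \<or> \<not> 3 dvd n"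
    using c by (auto simp: candidate_def)
  have \<alpha>L: "\<alpha> \<in> L" using \<alpha> O0_in_L by blast
  have n: "0 < real n" using nm_pos[OF \<alpha>L \<alpha>(2)] \<alpha>(4) by simp
  have nmn: "nm \<alpha> = of_int (int n)" using \<alpha>(4) by simp
  have n3: "3 dvd d \<or> \<not> 3 dvd int n" using \<alpha>(5) by presburger
  have R: "R = int a * int b" using d by (auto simp: ram_invariant_def)
  have cf: "\<not> p ^ 3 dvd int n" if p: "prime p" for p :: int
  proof
    assume "p ^ 3 dvd int n"
    then obtain j where j: "int n = p ^ 3 * j" by blast
    have p1: "p > 1" using p by (simp add: prime_gt_1_int)
    have nj: "real n = of_int p ^ 3 * of_int j"
      by (metis j of_int_mult of_int_of_nat_eq of_int_power)
    then have "0 < of_int p ^ 3 * real_of_int j" using n by simp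
    then have "0 < j" using p1 by (simp add: zero_less_mult_iff)
    have "homog (1 / of_int p)" using p1 by (intro homog_of_Rats) auto
    moreover have "real n * (1 / of_int p) ^ 3 = real (nat j)" using nj p1 \<open>0 < j\<close> by (simp add: power_divide)
    moreover have "0 < 1 / real_of_int p" using p1 by simp
    ultimately have "1 \<le> 1 / real_of_int p" by (intro minimal_candidate_homog_ge_1[OF c d min])
    then show False using p1 by simp
  qed
  have pab: "p dvd int a * int b" if p: "prime p" "p dvd int n" for p
  proof (rule ccontr)
    assume np: "\<not> p dvd int a * int b"
    then have pa: "\<not> p dvd int a" "\<not> p dvd int b" by auto
    obtain h0 h1 h2 :: int where h: "cp \<alpha> = el (of_int h0) (of_int h1) (of_int h2)"
      using O0_cp[OF \<alpha>(1)] by (rule O0E)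
    have cpn: "cp \<alpha> = real n / \<alpha>" using \<alpha>(2,4) by (simp add: nm_def field_simps)
    \<comment> \<open>This quotient is 1 / \<alpha>, so its product with \<alpha> is 1 and
      \<open>component_cube_int\<close> applies.\<close>
    have one: "el (of_int h0 / real n) (of_int h1 / real n) (of_int h2 / real n) * \<alpha> \<in> O0"
    proof -
      have "el (of_int h0 / real n) (of_int h1 / real n) (of_int h2 / real n) = (1 / real n) * cp \<alpha>"
        by (simp add: h el_scale)
      then have "el (of_int h0 / real n) (of_int h1 / real n) (of_int h2 / real n) * \<alpha> = 1"
        using n \<alpha>(2) by (simp add: cpn)
      then show ?thesis using O0_of_int[of 1] by simp
    qed
    have rat: "real_of_int h0 / real n \<in> \<rat>" "real_of_int h1 / real n \<in> \<rat>" "real_of_int h2 / real n \<in> \<rat>"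
      by auto
    note comp = component_cube_int[OF \<alpha>(3,1) nmn n3 rat one]
    have sq: "(int n)\<^sup>2 dvd N * m ^ 3" if I: "nm \<alpha> * (of_int m / real n * e) ^ 3 \<in> \<int>" and e: "e ^ 3 = real_of_int N" for m N :: int and e
    proof -
      obtain j where "nm \<alpha> * (of_int m / real n * e) ^ 3 = of_int j" using I by (elim Ints_cases)
      moreover define q where "q = real_of_int m / real n"
      ultimately have qj: "real n * (q * e) ^ 3 = of_int j" and qm: "q * real n = of_int m" using n \<alpha>(4) by simp_all
      have "real_of_int N * of_int m ^ 3 = (real n)\<^sup>2 * of_int j"
        unfolding qj[symmetric] qm[symmetric] e[symmetric] by Groebner_Basis.algebra
      then have "real_of_int (N * m ^ 3) = real_of_int ((int n)\<^sup>2 * j)"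
        by (simp only: of_int_mult of_int_power of_int_of_nat_eq)
      then have "N * m ^ 3 = (int n)\<^sup>2 * j" by (simp only: of_int_eq_iff)
      then show ?thesis by simp
    qed
    have h0: "(int n)\<^sup>2 dvd h0 ^ 3" using sq[of h0 1 1] comp[of "of_int h0 / real n"] by simp
    have h1: "(int n)\<^sup>2 dvd (int a * (int b)\<^sup>2) * h1 ^ 3"
      by (rule sq[of h1 D]) (use comp[of "of_int h1 / real n * D"] D_cubed in simp_all)
    have h2: "(int n)\<^sup>2 dvd ((int a)\<^sup>2 * int b) * h2 ^ 3"
      by (rule sq[of h2 E]) (use comp[of "of_int h2 / real n * E"] E_cubed in simp_all)
    have nc: "nm \<alpha> * nm (cp \<alpha>) = real n ^ 3"
    proof -
      have "nm \<alpha> * nm (cp \<alpha>) = nm (\<alpha> * cp \<alpha>)" using \<alpha>L cp_in_L by (simp add: nm_mult)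
      also have "\<alpha> * cp \<alpha> = real n" using \<alpha>(4) by (simp add: nm_def)
      also have "nm (real n) = real n ^ 3" using n by (intro nm_homog homog_of_Rats) auto
      finally show ?thesis .
    qed
    then have "nm (cp \<alpha>) = (real n)\<^sup>2" using n \<alpha>(4) by (simp add: power2_eq_square power3_eq_cube)
    then have "real_of_int ((int n)\<^sup>2) = real_of_int (h0 ^ 3 + int a * (int b)\<^sup>2 * h1 ^ 3 + (int a)\<^sup>2 * int b * h2 ^ 3
        - 3 * int a * int b * h0 * h1 * h2)"
      unfolding h norm_el_int by simp
    then have "(int n)\<^sup>2 = h0 ^ 3 + int a * (int b)\<^sup>2 * h1 ^ 3 + (int a)\<^sup>2 * int b * h2 ^ 3
        - 3 * int a * int b * h0 * h1 * h2" by (simp only: of_int_eq_iff)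
    then have nn: "(int n)\<^sup>2 = h0 ^ 3 + (int a * (int b)\<^sup>2) * h1 ^ 3 + ((int a)\<^sup>2 * int b) * h2 ^ 3
        - 3 * (int a * int b) * h0 * h1 * h2" by (simp add: mult.assoc)
    have "\<not> p dvd int a * (int b)\<^sup>2" "\<not> p dvd (int a)\<^sup>2 * int b"
      using pa p(1) prime_dvd_power by (auto simp: prime_dvd_mult_iff)
    then show False using dvd_coprime_prime_contradiction[OF p cf[OF p(1)] _ _ h0 h1 h2 nn] by blast
  qed
  show ?thesis
  proof (rule dvd_by_prime_powers)
    show "int n \<noteq> 0" using n by simp
    fix p :: int and k assume p: "prime p" and pk: "p ^ k dvd int n"
    show "p ^ k dvd R\<^sup>2"
    proof (cases "k = 0")
      case False
      have "k \<le> 2"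
      proof (rule ccontr)
        assume "\<not> k \<le> 2"
        then have "p ^ 3 dvd p ^ k" by (intro le_imp_power_dvd) simp
        then show False using cf[OF p] pk dvd_trans by blast
      qed
      have "p dvd p ^ k" using False by simp
      then have "p dvd R" using pab[OF p] pk dvd_trans R by metis
      then have "p\<^sup>2 dvd R\<^sup>2" by (rule dvd_power_same)
      moreover have "p ^ k dvd p\<^sup>2" using \<open>k \<le> 2\<close> by (rule le_imp_power_dvd)
      ultimately show ?thesis by (rule dvd_trans[rotated])
    qed simp
  qed
qed

section \<open>The prime 3 when d is +-1 modulo 9\<close>

lemma not_3_dvd_ab:
  assumes "\<not> 3 dvd d"
  shows "\<not> 3 dvd int a" "\<not> 3 dvd int b"
  using assms three_dvd_d by presburger+

text \<open>Modulo 3 the cube of the trace is the sum of the cubes of the conjugates, and each of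
  these is the norm n times a unit.\<close>

lemma ambiguous_trace_dvd:
  assumes amb: "ambiguous \<alpha>" and \<alpha>: "\<alpha> = el (of_int x / 3) (of_int y / 3) (of_int z / 3)" "\<alpha> \<in> OL"
    and n: "nm \<alpha> = of_int n" "3 dvd n"
  shows "3 dvd x"
proof -
  have \<alpha>L: "\<alpha> \<in> L" "\<alpha> \<noteq> 0" using amb by (auto simp: ambiguous_def)
  define c e where "c = complex_of_real \<alpha>" and "e = complex_of_real (\<alpha> ^ 3 / nm \<alpha>)"
  have cO: "c \<in> OK" using OK_of_real \<alpha> by (simp add: c_def)
  have cK: "c \<in> K" "\<sigma> c \<in> K" using cO OK_iff sigma_K by auto
  have eO: "e \<in> OK" using amb OK_of_real unfolding e_def ambiguous_def ring_units_iff by blast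
  have n0: "nm \<alpha> \<noteq> 0" using nm_eq_0 \<alpha>L by simp
  obtain m where m: "n = 3 * m" using n(2) by blast
  have c3: "c ^ 3 = of_int (3 * m) * e"
  proof -
    have "\<alpha> ^ 3 = nm \<alpha> * (\<alpha> ^ 3 / nm \<alpha>)" using n0 by simp
    then have "complex_of_real (\<alpha> ^ 3) = complex_of_real (nm \<alpha>) * e" unfolding e_def by (metis of_real_mult)
    then show ?thesis by (simp add: c_def n(1) m)
  qed
  have nK: "of_int (3 * m) \<in> K" "e \<in> K" using is_subfield_of_int[OF K_subfield] eO OK_iff by blast+
  have s3: "\<sigma> c ^ 3 = of_int (3 * m) * \<sigma> e"
    unfolding sigma_power[OF cK(1), symmetric] c3 sigma_mult[OF nK] sigma_of_int ..
  have ss3: "\<sigma> (\<sigma> c) ^ 3 = of_int (3 * m) * \<sigma> (\<sigma> e)"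
    unfolding sigma_power[OF cK(2), symmetric] s3 sigma_mult[OF nK(1) sigma_K[OF nK(2)]] sigma_of_int ..
  have tr: "complex_of_real (of_int x) = c + \<sigma> c + \<sigma> (\<sigma> c)"
  proof -
    have r: "real_of_int x / 3 \<in> \<rat>" "real_of_int y / 3 \<in> \<rat>" "real_of_int z / 3 \<in> \<rat>" by auto
    then have k: "complex_of_real (of_int x / 3) \<in> k0" "complex_of_real (of_int y / 3) \<in> k0" "complex_of_real (of_int z / 3) \<in> k0"
      using Rats_in_k0 of_real_Rats by blast+
    have "c + \<sigma> c + \<sigma> (\<sigma> c) = 3 * complex_of_real (of_int x / 3)"
      unfolding c_def \<alpha>(1) of_real_el unfolding sigma_sigma_kel[OF k] unfolding sigma_kel[OF k] unfolding kel_def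
      using zeta_zeta by Groebner_Basis.algebra
    then show ?thesis by simp
  qed
  \<comment> \<open>One third of the expansion of the cube of the trace. It is visibly an algebraic
    integer, and as a rational number an integer.\<close>
  define t where "t = of_int m * (e + \<sigma> e + \<sigma> (\<sigma> e)) + c * c * \<sigma> c + c * \<sigma> c * \<sigma> c + c * c * \<sigma> (\<sigma> c)
    + c * \<sigma> (\<sigma> c) * \<sigma> (\<sigma> c) + \<sigma> c * \<sigma> c * \<sigma> (\<sigma> c) + \<sigma> c * \<sigma> (\<sigma> c) * \<sigma> (\<sigma> c) + of_int 2 * c * \<sigma> c * \<sigma> (\<sigma> c)"
  have iO: "of_int j \<in> OK" for j using is_subfield_of_int[OF K_subfield] by (simp add: OK_iff)
  have "t \<in> OK" unfolding t_def by (intro OK_add OK_mult OK_sigma iO cO eO)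
  have "complex_of_real (of_int x) ^ 3 = 3 * t"
  proof -
    have "complex_of_real (of_int x) ^ 3 = c ^ 3 + \<sigma> c ^ 3 + \<sigma> (\<sigma> c) ^ 3 + 3 * (c * c * \<sigma> c + c * \<sigma> c * \<sigma> c + c * c * \<sigma> (\<sigma> c)
      + c * \<sigma> (\<sigma> c) * \<sigma> (\<sigma> c) + \<sigma> c * \<sigma> c * \<sigma> (\<sigma> c) + \<sigma> c * \<sigma> (\<sigma> c) * \<sigma> (\<sigma> c) + 2 * c * \<sigma> c * \<sigma> (\<sigma> c))"
      unfolding tr by Groebner_Basis.algebra
    also have "\<dots> = 3 * t"
      unfolding c3 s3 ss3 t_def of_int_mult of_int_numeral by Groebner_Basis.algebra
    finally show ?thesis .
  qed
  then have "t = complex_of_real (of_int x ^ 3 / 3)" by simp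
  moreover have "algebraic_int t" using \<open>t \<in> OK\<close> OK_iff by blast
  ultimately have "algebraic_int (complex_of_real (of_int x ^ 3 / 3))" by (simp only:)
  then have "algebraic_int (real_of_int x ^ 3 / 3)" by (simp only: algebraic_int_of_real_iff)
  then have "real_of_int x ^ 3 / 3 \<in> \<int>" by (rule rational_algebraic_int_is_int) auto
  then obtain j where "real_of_int x ^ 3 / 3 = of_int j" by (elim Ints_cases)
  then have "real_of_int (x ^ 3) = real_of_int (3 * j)" by simp
  then have "x ^ 3 = 3 * j" by (simp only: of_int_eq_iff)
  then have "3 dvd x ^ 3" by simp
  then show ?thesis by (rule three_dvd_cube)
qed

text \<open>Since 3 divides the trace, \<alpha> lies in \<open>O0\<close>, and there the norm form
  is never divisible by 3 exactly once.\<close>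

lemma ambiguous_norm_dvd_9:
  assumes d9: "d mod 9 \<in> {1, 8}" and amb: "ambiguous \<alpha>" and n: "nm \<alpha> = of_int n" "3 dvd n"
  shows "9 dvd n"
proof -
  have \<alpha>: "\<alpha> \<in> OL" using ambiguous_integral[OF amb] n by simp
  obtain x y z where xyz: "\<alpha> = el (of_int x / 3) (of_int y / 3) (of_int z / 3)"
    using \<alpha> by (rule OL_thirds)
  have "3 dvd x" by (rule ambiguous_trace_dvd[OF amb xyz \<alpha> n])
  then have "\<alpha> \<in> O0" using OL_trace_3_imp_O0[of x y z] \<alpha> unfolding xyz by blast
  then obtain u v w where uvw: "\<alpha> = el (of_int u) (of_int v) (of_int w)" by (rule O0E)
  have "real_of_int n = real_of_int (u ^ 3 + int a * (int b)\<^sup>2 * v ^ 3 + (int a)\<^sup>2 * int b * w ^ 3 - 3 * int a * int b * u * v * w)"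
    using n(1) unfolding uvw norm_el_int by simp
  then have eq: "n = u ^ 3 + int a * (int b)\<^sup>2 * v ^ 3 + (int a)\<^sup>2 * int b * w ^ 3 - 3 * int a * int b * u * v * w"
    by (simp only: of_int_eq_iff)
  have "d mod 9 = 1 \<or> d mod 9 = 8" using d9 by simp
  then have d3: "\<not> 3 dvd d" and "9 dvd int d - 1 \<or> 9 dvd int d + 1" by presburger+
  then have d': "9 dvd int a * (int b)\<^sup>2 - 1 \<or> 9 dvd int a * (int b)\<^sup>2 + 1" by (simp add: d_eq)
  show ?thesis
    using norm_form_dvd_3_imp_9[OF not_3_dvd_ab[OF d3] d', of u v w] n(2) unfolding eq by blast
qed

text \<open>If 3 divides n, so does 9. The same applied to \<alpha>^2 / 3, which is invariant with
  norm n^2 / 27, yields 27, and then \<alpha> / 3 is integral, contradicting primitivity.\<close>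

lemma principal_factor_norm_not_dvd_3:
  assumes d9: "d mod 9 \<in> {1, 8}" and pf: "principal_factor d \<zeta> \<sigma> \<alpha>" and n: "nm \<alpha> = of_int n"
  shows "\<not> 3 dvd n"
proof
  assume n3: "3 dvd n"
  have amb: "ambiguous \<alpha>" and prim: "\<And>m::int. m > 1 \<Longrightarrow> \<alpha> / of_int m \<notin> OL" and \<alpha>: "\<alpha> \<in> OL"
    using pf by (auto simp: principal_factor_iff)
  have \<alpha>L: "\<alpha> \<in> L" using \<alpha> OL_iff by blast
  have third: "homog (1 / 3)" by (rule homog_of_Rats) auto
  have n27: "\<not> 27 dvd n"
  proof
    assume "27 dvd n"
    then obtain k where k: "n = 27 * k" by blast
    have "ambiguous (\<alpha> * (1 / 3))" using ambiguous_mult_homog(1)[OF amb third] .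
    moreover have "nm (\<alpha> * (1 / 3)) = of_int k"
      unfolding nm_mult[OF \<alpha>L homog_in_L[OF third]] nm_homog[OF third] n k by (simp add: power_divide)
    ultimately have "\<alpha> * (1 / 3) \<in> OL" by (intro ambiguous_integral) auto
    then show False using prim[of 3] by simp
  qed
  have "9 dvd n" by (rule ambiguous_norm_dvd_9[OF d9 amb n n3])
  then obtain k where k: "n = 9 * k" by blast
  define \<beta> where "\<beta> = \<alpha>\<^sup>2 * (1 / 3)"
  have "ambiguous \<beta>" unfolding \<beta>_def by (intro ambiguous_mult_homog(1) ambiguous_power amb third)
  moreover have "nm \<beta> = of_int (3 * k\<^sup>2)"
    unfolding \<beta>_def nm_mult[OF is_subfieldD(9)[OF L_subfield \<alpha>L] homog_in_L[OF third]] nm_homog[OF third]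
      nm_power[OF \<alpha>L] n k by (simp add: power_divide power_mult_distrib)
  ultimately have "9 dvd 3 * k\<^sup>2" by (rule ambiguous_norm_dvd_9[OF d9]) simp
  then have "3 dvd k\<^sup>2" by presburger
  then have "3 dvd k" by (rule three_dvd_cube)
  then have "27 dvd n" unfolding k by presburger
  then show False using n27 by blast
qed

text \<open>If the trace x is prime to 3, the trace x^2 - 2 s of the square is divisible by 3 by
  \<open>char_poly_mod_3\<close>, and integral elements with such a trace lie in
  \<open>O0\<close>.\<close>

lemma square_in_O0:
  assumes \<alpha>: "\<alpha> \<in> OL" and n: "nm \<alpha> = of_int n" and n3: "\<not> 3 dvd n"
  shows "\<alpha>\<^sup>2 \<in> O0"
proof -
  obtain x y z where xyz: "\<alpha> = el (of_int x / 3) (of_int y / 3) (of_int z / 3)"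
    "3 dvd x\<^sup>2 - int a * int b * y * z"
    using \<alpha> by (rule OL_thirds)
  show ?thesis
  proof (cases "3 dvd x")
    case True
    then have "\<alpha> \<in> O0" using OL_trace_3_imp_O0[of x y z] \<alpha> unfolding xyz(1) by blast
    then show ?thesis by (simp add: power2_eq_square O0_mult)
  next
    case False
    obtain s where s: "x\<^sup>2 - int a * int b * y * z = 3 * s" using xyz(2) by blast
    have "27 * nm \<alpha> = real_of_int (x ^ 3 + int a * (int b)\<^sup>2 * y ^ 3 + (int a)\<^sup>2 * int b * z ^ 3 - 3 * int a * int b * x * y * z)"
    proof -
      have three: "homog 3" by (rule homog_of_Rats) auto
      have "\<alpha> \<in> L" using \<alpha> OL_iff by blast
      then have "nm (3 * \<alpha>) = 27 * nm \<alpha>" using homog_in_L[OF three] by (simp add: nm_mult nm_homog[OF three])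
      moreover have "3 * \<alpha> = el (of_int x) (of_int y) (of_int z)" unfolding xyz(1) el_scale by simp
      ultimately show ?thesis by (simp only: norm_el_int)
    qed
    then have "real_of_int (x ^ 3 + int a * (int b)\<^sup>2 * y ^ 3 + (int a)\<^sup>2 * int b * z ^ 3 - 3 * int a * int b * x * y * z)
      = real_of_int (27 * n)" using n by simp
    then have N: "x ^ 3 + int a * (int b)\<^sup>2 * y ^ 3 + (int a)\<^sup>2 * int b * z ^ 3 - 3 * int a * int b * x * y * z = 27 * n"
      by (simp only: of_int_eq_iff)
    have 3: "3 dvd x\<^sup>2 - 2 * s" by (rule char_poly_mod_3[OF s N False n3])
    have sq: "\<alpha>\<^sup>2 \<in> OL" using \<alpha> by (simp add: OL_power)
    obtain u v w where uvw: "\<alpha>\<^sup>2 = el (of_int u / 3) (of_int v / 3) (of_int w / 3)" using sq by (rule OL_thirds)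
    have "\<alpha>\<^sup>2 = el (of_int x / 3 * (of_int x / 3) + real a * real b * (of_int y / 3 * (of_int z / 3) + of_int z / 3 * (of_int y / 3)))
      (of_int x / 3 * (of_int y / 3) + of_int y / 3 * (of_int x / 3) + real a * (of_int z / 3) * (of_int z / 3))
      (of_int x / 3 * (of_int z / 3) + of_int z / 3 * (of_int x / 3) + real b * (of_int y / 3) * (of_int y / 3))"
      unfolding xyz(1) power2_eq_square el_mult ..
    then have u: "real_of_int u / 3 = of_int x / 3 * (of_int x / 3) + real a * real b * (of_int y / 3 * (of_int z / 3) + of_int z / 3 * (of_int y / 3))"
      unfolding uvw by (subst (asm) el_inject) auto
    have "real_of_int (3 * u) = 9 * (real_of_int u / 3)" by simp
    also have "\<dots> = of_int x * of_int x + 2 * (real a * real b * of_int y * of_int z)"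
      unfolding u by (simp add: distrib_left)
    also have "\<dots> = real_of_int (x\<^sup>2 + 2 * (int a * int b * y * z))" by (simp add: power2_eq_square)
    finally have "real_of_int (3 * u) = real_of_int (x\<^sup>2 + 2 * (int a * int b * y * z))" .
    then have "3 * u = x\<^sup>2 + 2 * (int a * int b * y * z)" by (simp only: of_int_eq_iff)
    then have "3 * u = 3 * (x\<^sup>2 - 2 * s)" using s by simp
    then have "u = x\<^sup>2 - 2 * s" by (simp only: mult_cancel_left) simp
    then have "3 dvd u" using 3 by simp
    then show ?thesis using OL_trace_3_imp_O0[of u v w] sq unfolding uvw by blast
  qed
qed

text \<open>For d = +-1 mod 9 a principal factor may lie outside \<open>O0\<close> and is replaced
  by its square. The square is again non-trivial, because the cube of \<alpha> is a unit times a
  rational number.\<close>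

lemma exists_candidate:
  assumes beta: "type_beta d \<zeta> \<sigma>" and d9: "d mod 9 \<in> {0, 3, 6, 1, 8}"
  shows "\<exists>\<alpha> n. candidate \<alpha> n"
proof -
  obtain \<alpha> where pf: "principal_factor d \<zeta> \<sigma> \<alpha>" and triv: "\<alpha> \<notin> trivial_factors"
    using beta unfolding type_beta_def nontrivial_iff by blast
  have amb: "ambiguous \<alpha>" and \<alpha>: "\<alpha> \<in> OL" using pf by (auto simp: principal_factor_iff)
  have \<alpha>L: "\<alpha> \<in> L" "\<alpha> \<noteq> 0" using amb by (auto simp: ambiguous_def)
  have build: "\<exists>\<alpha> n. candidate \<alpha> n" if \<beta>: "\<beta> \<in> O0" "ambiguous \<beta>" "\<beta> \<notin> trivial_factors"
      and m: "nm \<beta> = of_int m" "3 dvd d \<or> \<not> 3 dvd m" for \<beta> m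
  proof -
    have \<beta>L: "\<beta> \<in> L" "\<beta> \<noteq> 0" using \<beta> by (auto simp: ambiguous_def)
    define s where "s = sgn \<beta>"
    have s: "s = 1 \<or> s = -1" using \<beta>L by (simp add: s_def sgn_if)
    then have hs: "homog s" using homog_of_Rats[of s] by auto
    have abs: "\<bar>\<beta>\<bar> = \<beta> * s" by (simp add: s_def abs_sgn)
    have pos: "0 < \<bar>\<beta>\<bar>" using \<beta>L by simp
    have "ambiguous \<bar>\<beta>\<bar>" unfolding abs by (rule ambiguous_mult_homog(1)[OF \<beta>(2) hs])
    moreover have "\<bar>\<beta>\<bar> \<notin> trivial_factors"
      unfolding abs using trivial_mult_iff[OF homog_trivial[OF hs]] homog_nonzero[OF hs] \<beta>(3) by simp
    moreover have "\<bar>\<beta>\<bar> \<in> O0" using O0_abs \<beta> by blast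
    moreover have nmabs: "nm \<bar>\<beta>\<bar> = real (nat \<bar>m\<bar>)"
    proof -
      have "nm \<bar>\<beta>\<bar> = of_int m \<or> nm \<bar>\<beta>\<bar> = - of_int m" using m(1) nm_minus[OF \<beta>L(1)] by (auto simp: abs_if)
      moreover have "nm \<bar>\<beta>\<bar> > 0" using nm_pos[OF _ pos] \<open>\<bar>\<beta>\<bar> \<in> O0\<close> O0_in_L by blast
      ultimately show ?thesis by auto
    qed
    moreover have "int 3 dvd int (nat \<bar>m\<bar>) \<longleftrightarrow> 3 dvd m" by simp
    then have "3 dvd d \<or> \<not> 3 dvd nat \<bar>m\<bar>" using m(2) by (simp only: int_dvd_int_iff)
    ultimately show ?thesis using pos unfolding candidate_def by blast
  qed
  obtain n where n: "nm \<alpha> = of_int n" using nm_int[OF \<alpha>] by (elim Ints_cases)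
  show ?thesis
  proof (cases "d mod 9 \<in> {1, 8}")
    case False
    then have "d mod 9 = 0 \<or> d mod 9 = 3 \<or> d mod 9 = 6" using d9 by auto
    then have "3 dvd d" by presburger
    then show ?thesis using build[OF _ amb triv n] \<alpha> OL_eq_O0[OF False] by simp
  next
    case True
    have n3: "\<not> 3 dvd n" by (rule principal_factor_norm_not_dvd_3[OF True pf n])
    have "\<alpha>\<^sup>2 \<in> O0" by (rule square_in_O0[OF \<alpha> n n3])
    moreover have "ambiguous (\<alpha>\<^sup>2)" by (rule ambiguous_power[OF amb])
    moreover have "nm (\<alpha>\<^sup>2) = of_int (n\<^sup>2)" using \<alpha>L n by (simp add: nm_power)
    moreover have "\<not> 3 dvd n\<^sup>2" using n3 three_dvd_cube by blast
    moreover have "\<alpha>\<^sup>2 \<notin> trivial_factors"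
    proof
      assume t2: "\<alpha>\<^sup>2 \<in> trivial_factors"
      have "\<alpha> ^ 3 / nm \<alpha> * nm \<alpha> \<in> trivial_factors"
        using amb nm_Rats[OF \<alpha>L(1)] nm_eq_0 \<alpha>L unfolding ambiguous_def
        by (intro trivial_factorsI homog_of_Rats) auto
      then have "\<alpha> * \<alpha>\<^sup>2 \<in> trivial_factors" using nm_eq_0 \<alpha>L by (simp add: power2_eq_square power3_eq_cube mult.assoc)
      then show False using trivial_mult_iff[OF t2] triv \<alpha>L by simp
    qed
    ultimately show ?thesis using build by blast
  qed
qed

section \<open>Transfer to one period of the chain\<close>

lemma U0_norm: "u \<in> U0 \<Longrightarrow> 0 < u \<Longrightarrow> nm u = 1"
proof -
  assume u: "u \<in> U0" "0 < u"
  then have "u \<in> EL" using O0_subset_OL by (auto simp: ring_units_iff)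
  then have "\<bar>nm u\<bar> = 1" by (rule norm_of_unit)
  moreover have "0 < nm u" using u nm_pos O0_in_L by (auto simp: ring_units_iff)
  ultimately show ?thesis by simp
qed

lemma U0_power_int: "u \<in> U0 \<Longrightarrow> u powi k \<in> U0"
proof -
  assume u: "u \<in> U0"
  have pow: "w ^ n \<in> O0" if "w \<in> O0" for w n
    using that O0_of_int[of 1] by (induction n) (auto intro: O0_mult)
  show ?thesis
    using u pow by (auto simp: ring_units_iff power_int_def simp flip: power_inverse)
qed

lemma lattice_minimum_mult_unit:
  assumes min: "\<alpha> \<in> lattice_minima \<sigma> O0" and u: "u \<in> U0" "0 < u"
  shows "\<alpha> * u \<in> lattice_minima \<sigma> O0"
proof -
  have \<alpha>: "\<alpha> \<in> O0" "0 < \<alpha>" using min by (auto simp: lattice_minima_def)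
  have uO: "u \<in> O0" "inverse u \<in> O0" using u by (auto simp: ring_units_iff)
  have L: "u \<in> L" "inverse u \<in> L" "\<alpha> \<in> L" "\<alpha> * u \<in> L" using uO \<alpha> O0_in_L O0_mult by blast+
  have cpu: "cp (inverse u) > 0" using cp_pos[OF L(2)] u by simp
  have "\<beta> = 0" if \<beta>: "\<beta> \<in> O0" "conj_prod \<sigma> \<beta> < conj_prod \<sigma> (\<alpha> * u)" "0 \<le> \<beta>" "\<beta> < \<alpha> * u" for \<beta>
  proof -
    define \<gamma> where "\<gamma> = \<beta> * inverse u"
    have \<gamma>: "\<gamma> \<in> O0" unfolding \<gamma>_def by (rule O0_mult[OF \<beta>(1) uO(2)])
    have \<beta>L: "\<beta> \<in> L" using \<beta> O0_in_L by blast
    have "cp \<beta> * cp (inverse u) < cp (\<alpha> * u) * cp (inverse u)"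
      using \<beta>(2) cpu \<beta>L L by (simp add: conj_prod_L)
    then have "cp (\<beta> * inverse u) < cp (\<alpha> * u * inverse u)" using \<beta>L L by (simp only: cp_mult)
    moreover have "\<alpha> * u * inverse u = \<alpha>" using u(2) by (simp add: mult.assoc)
    ultimately have "cp \<gamma> < cp \<alpha>" by (simp only: \<gamma>_def)
    then have "conj_prod \<sigma> \<gamma> < conj_prod \<sigma> \<alpha>" using L(3) O0_in_L[OF \<gamma>] by (simp add: conj_prod_L)
    moreover have "0 \<le> \<gamma>" "\<gamma> < \<alpha>" using \<beta>(3,4) u by (simp_all add: \<gamma>_def field_simps)
    ultimately have "\<gamma> = 0" using min \<gamma> unfolding lattice_minima_def by blast
    then show ?thesis using u by (simp add: \<gamma>_def)
  qed
  then show ?thesis using O0_mult[OF \<alpha>(1) uO(1)] \<alpha>(2) u(2) unfolding lattice_minima_def by simp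
qed

lemma type_beta_imp_chain:
  assumes chain: "chain_of_minima \<sigma> O0 \<theta>" and per: "primitive_period_length O0 \<theta> l"
    and beta: "type_beta d \<zeta> \<sigma>" and d9: "d mod 9 \<in> {0, 3, 6, 1, 8}"
  shows "\<exists>j\<in>{1..int l - 1}. norm_dvd \<sigma> (\<theta> j) (R\<^sup>2)"
proof -
  define P where "P = (\<lambda>n. \<exists>\<alpha>. candidate \<alpha> n)"
  obtain \<alpha>0 n0 where "candidate \<alpha>0 n0" using exists_candidate[OF beta d9] by blast
  then have "P n0" unfolding P_def by blast
  then have P: "P (Least P)" by (rule LeastI)
  define n where "n = Least P"
  obtain \<alpha> where c: "candidate \<alpha> n" using P unfolding n_def P_def by blast
  have min: "\<forall>\<beta> m. candidate \<beta> m \<longrightarrow> n \<le> m"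
    unfolding n_def by (metis Least_le P_def)
  have lm: "\<alpha> \<in> lattice_minima \<sigma> O0" by (rule minimal_candidate_lattice_minimum[OF c d9 min])
  have nR: "int n dvd R\<^sup>2" by (rule minimal_candidate_norm[OF c d9 min])
  have \<alpha>: "0 < \<alpha>" "\<alpha> \<notin> trivial_factors" "nm \<alpha> = real n" "\<alpha> \<in> O0" using c by (auto simp: candidate_def)
  define \<epsilon> where "\<epsilon> = \<theta> (int l)"
  have \<epsilon>: "\<epsilon> \<in> U0" "1 < \<epsilon>" using per by (auto simp: primitive_period_length_def \<epsilon>_def)
  \<comment> \<open>Dividing by this power of \<epsilon> moves \<alpha> into the interval from 1 to
    \<epsilon>, \<epsilon> excluded; the value 1 is impossible because \<alpha> is not a
    unit.\<close>
  define k where "k = \<lfloor>log \<epsilon> \<alpha>\<rfloor>"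
  define u where "u = \<epsilon> powi (- k)"
  have u: "u \<in> U0" "0 < u" using U0_power_int[OF \<epsilon>(1)] \<epsilon>(2) by (simp_all add: u_def)
  have pw: "\<epsilon> powr of_int k = \<epsilon> powi k" using \<epsilon>(2) by (simp add: powr_real_of_int')
  have "\<epsilon> powi k \<le> \<alpha>" using \<epsilon>(2) \<alpha>(1) unfolding pw[symmetric] by (simp add: k_def powr_le_iff)
  then have ge: "1 \<le> \<alpha> * u" using \<epsilon>(2) by (simp add: u_def power_int_minus field_simps)
  have "\<alpha> < \<epsilon> powr (of_int k + 1)" using \<epsilon>(2) \<alpha>(1) by (simp add: k_def less_powr_iff)
  then have "\<alpha> < \<epsilon> powi k * \<epsilon>" using \<epsilon>(2) pw by (simp add: powr_add)
  then have lt: "\<alpha> * u < \<epsilon>" using \<epsilon>(2) by (simp add: u_def power_int_minus field_simps)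
  have "\<alpha> * u \<noteq> 1"
  proof
    assume "\<alpha> * u = 1"
    then have "\<alpha> = inverse u" by (metis inverse_unique mult.commute)
    then have "\<alpha> \<in> EL" using u(1) O0_subset_OL unfolding ring_units_iff by (metis inverse_inverse_eq inverse_nonzero_iff_nonzero)
    then show False using EL_trivial \<alpha>(2) by blast
  qed
  then have gt: "1 < \<alpha> * u" using ge by simp
  have "\<alpha> * u \<in> range \<theta>" using lattice_minimum_mult_unit[OF lm u] chain by (simp add: chain_of_minima_def)
  then obtain j where j: "\<alpha> * u = \<theta> j" by blast
  have mono: "strict_mono \<theta>" "\<theta> 0 = 1" using chain by (auto simp: chain_of_minima_def)
  have "\<theta> 0 < \<theta> j" "\<theta> j < \<theta> (int l)" using gt lt j mono(2) by (simp_all add: \<epsilon>_def)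
  then have "0 < j" "j < int l" using mono(1) by (simp_all add: strict_mono_less)
  moreover have "norm_dvd \<sigma> (\<theta> j) (R\<^sup>2)"
  proof -
    have L: "\<alpha> \<in> L" "u \<in> L" using \<alpha> u O0_in_L by (auto simp: ring_units_iff)
    have "nm (\<theta> j) = real n" unfolding j[symmetric] using L U0_norm[OF u] \<alpha>(3) by (simp add: nm_mult)
    moreover have "\<theta> j \<in> L" unfolding j[symmetric] by (rule is_subfieldD(4)[OF L_subfield L])
    ultimately have "rel_norm \<sigma> (complex_of_real (\<theta> j)) = of_int (int n)"
      by (simp add: rel_norm_L)
    then show ?thesis using nR unfolding norm_dvd_def by blast
  qed
  ultimately show ?thesis by (intro bexI[of _ j]) auto
qed

text \<open>Strictly between 1 and the least unit above 1 there are no units, so the minimum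
  \<theta> j meets the hypotheses of \<open>lattice_minimum_imp_type_beta\<close>.\<close>

lemma chain_imp_type_beta:
  assumes chain: "chain_of_minima \<sigma> O0 \<theta>" and per: "primitive_period_length O0 \<theta> l"
    and j: "j \<in> {1..int l - 1}" and norm: "norm_dvd \<sigma> (\<theta> j) (R\<^sup>2)"
  shows "type_beta d \<zeta> \<sigma>"
proof (rule lattice_minimum_imp_type_beta[OF _ _ norm])
  show "\<theta> j \<in> lattice_minima \<sigma> O0" using chain by (auto simp: chain_of_minima_def)
  have mono: "strict_mono \<theta>" "\<theta> 0 = 1" using chain by (auto simp: chain_of_minima_def)
  have "\<theta> 0 < \<theta> j" "\<theta> j < \<theta> (int l)" using j mono(1) by (simp_all add: strict_mono_less)
  then show "\<theta> j \<notin> U0" using per mono(2) unfolding primitive_period_length_def by fastforce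
qed

end

section \<open>Relative norms of units\<close>

lemma algebraic_int_of_nat [simp]: "algebraic_int (of_nat n :: 'a::field_char_0)"
  by (rule int_imp_algebraic_int) simp

text \<open>Congruence modulo p in the ring of all algebraic integers, which spares the choice of a
  prime ideal above p.\<close>

definition alg_cong :: "nat \<Rightarrow> complex \<Rightarrow> complex \<Rightarrow> bool" where
  "alg_cong p w t \<longleftrightarrow> algebraic_int ((w - t) / of_nat p)"

lemma alg_cong_refl: "alg_cong p w w"
  by (simp add: alg_cong_def)

lemma alg_cong_sym: "alg_cong p w t \<Longrightarrow> alg_cong p t w"
  unfolding alg_cong_def by (metis algebraic_int_minus minus_diff_eq minus_divide_left)

lemma alg_cong_trans: "alg_cong p w t \<Longrightarrow> alg_cong p t u \<Longrightarrow> alg_cong p w u"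
  unfolding alg_cong_def using algebraic_int_add[of "(w - t) / of_nat p" "(t - u) / of_nat p"]
  by (simp add: add_divide_distrib[symmetric])

lemma alg_cong_add: "alg_cong p w t \<Longrightarrow> alg_cong p w' t' \<Longrightarrow> alg_cong p (w + w') (t + t')"
  unfolding alg_cong_def using algebraic_int_add[of "(w - t) / of_nat p" "(w' - t') / of_nat p"]
  by (simp add: add_divide_distrib[symmetric] algebra_simps)

lemma alg_cong_mult:
  assumes "alg_cong p w t" "alg_cong p w' t'" "algebraic_int w" "algebraic_int t'"
  shows "alg_cong p (w * w') (t * t')"
proof -
  have "(w * w' - t * t') / of_nat p = w * ((w' - t') / of_nat p) + t' * ((w - t) / of_nat p)"
    by (simp add: add_divide_distrib[symmetric] algebra_simps)
  then show ?thesis using assms unfolding alg_cong_def by (simp only: algebraic_int_add algebraic_int_mult)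
qed

lemma alg_cong_power:
  assumes "alg_cong p w t" "algebraic_int w" "algebraic_int t"
  shows "alg_cong p (w ^ n) (t ^ n)"
  by (induction n) (auto intro!: alg_cong_mult assms alg_cong_refl algebraic_int_power)

lemma alg_cong_0: "algebraic_int c \<Longrightarrow> p \<noteq> 0 \<Longrightarrow> alg_cong p (of_nat p * c) 0"
  by (simp add: alg_cong_def)

lemma alg_cong_sum_0: "(\<And>i. i \<in> I \<Longrightarrow> alg_cong p (f i) 0) \<Longrightarrow> alg_cong p (\<Sum>i\<in>I. f i) 0"
proof (induction I rule: infinite_finite_induct)
  case (insert i I)
  then have "alg_cong p (f i + sum f I) (0 + 0)" by (intro alg_cong_add) auto
  then show ?case using insert by simp
qed (auto simp: alg_cong_refl)

lemma alg_cong_add_power_prime: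
  assumes p: "prime p" and s: "algebraic_int s" and t: "algebraic_int t"
  shows "alg_cong p ((s + t) ^ p) (s ^ p + t ^ p)"
proof -
  have p0: "0 < p" using p by (simp add: prime_gt_0_nat)
  have mid: "alg_cong p (\<Sum>k\<in>{1..<p}. of_nat (p choose k) * s ^ k * t ^ (p - k)) 0"
  proof (rule alg_cong_sum_0)
    fix k assume "k \<in> {1..<p}"
    then have "p dvd p choose k" using p by (intro dvd_choose_prime) auto
    then obtain c where c: "p choose k = p * c" by blast
    have "algebraic_int (of_nat c * s ^ k * t ^ (p - k))"
      by (intro algebraic_int_mult algebraic_int_power algebraic_int_of_nat s t)
    then have "alg_cong p (of_nat p * (of_nat c * s ^ k * t ^ (p - k))) 0" using p0 by (intro alg_cong_0) auto
    then show "alg_cong p (of_nat (p choose k) * s ^ k * t ^ (p - k)) 0" by (simp add: c mult.assoc)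
  qed
  have "{..p} = insert 0 (insert p {1..<p})" using p0 by auto
  then have "(s + t) ^ p = (s ^ p + t ^ p) + (\<Sum>k\<in>{1..<p}. of_nat (p choose k) * s ^ k * t ^ (p - k))"
    using p0 by (simp add: binomial_ring add.assoc add.commute)
  then show ?thesis using alg_cong_add[OF alg_cong_refl[of p "s ^ p + t ^ p"] mid] by simp
qed

lemma alg_cong_nat_power_prime:
  assumes p: "prime p"
  shows "alg_cong p (of_nat n ^ p) (of_nat n)"
proof (induction n)
  case 0
  have "0 < p" using p by (rule prime_gt_0_nat)
  then show ?case by (simp add: alg_cong_refl zero_power)
next
  case (Suc n)
  have "alg_cong p ((of_nat n + 1) ^ p) (of_nat n ^ p + 1 ^ p)"
    by (rule alg_cong_add_power_prime[OF p]) auto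
  moreover have "alg_cong p (of_nat n ^ p + 1 ^ p) (of_nat n + 1)"
    using alg_cong_add[OF Suc alg_cong_refl[of p 1]] by simp
  ultimately have "alg_cong p ((of_nat n + 1) ^ p) (of_nat n + 1)" by (rule alg_cong_trans)
  then show ?case by (simp add: add.commute)
qed

lemma square_mod_9:
  fixes n :: nat
  shows "(\<And>p. prime p \<Longrightarrow> p dvd n \<Longrightarrow> p\<^sup>2 mod 9 = 1) \<Longrightarrow> n \<noteq> 0 \<Longrightarrow> n\<^sup>2 mod 9 = 1"
proof (induction n rule: prime_divisors_induct)
  case (factor p n)
  have "p\<^sup>2 mod 9 = 1" using factor by simp
  moreover have "n\<^sup>2 mod 9 = 1" using factor by (intro factor.IH) auto
  ultimately have "(p\<^sup>2 * n\<^sup>2) mod 9 = 1" by (simp add: mod_mult_eq[symmetric, of "p\<^sup>2"])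
  then show ?case by (simp add: power_mult_distrib)
qed auto

context pure_cubic_closure
begin

text \<open>If the squares of all prime divisors were 1 modulo 9, so would be d^2, which is 4 or 7
  here.\<close>

lemma prime_divisor_not_pm_1:
  assumes "d mod 9 \<in> {2, 4, 5, 7}"
  obtains p where "prime p" "p dvd d" "p \<noteq> 3" "p\<^sup>2 mod 9 \<noteq> 1"
proof -
  have "d mod 9 = 2 \<or> d mod 9 = 4 \<or> d mod 9 = 5 \<or> d mod 9 = 7" using assms by simp
  then have d3: "\<not> 3 dvd d" by presburger
  have "d\<^sup>2 mod 9 = (d mod 9)\<^sup>2 mod 9" by (simp add: power_mod)
  then have "d\<^sup>2 mod 9 \<noteq> 1" using assms by auto
  then obtain p where "prime p" "p dvd d" "p\<^sup>2 mod 9 \<noteq> 1" using square_mod_9[of d] d_ge by fastforce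
  then show thesis using that[of p] d3 by metis
qed

lemma zeta_power_mod_3: "\<zeta> ^ n = \<zeta> ^ (n mod 3)"
proof -
  have "\<zeta> ^ n = \<zeta> ^ (3 * (n div 3) + n mod 3)" by simp
  also have "\<dots> = \<zeta> ^ (n mod 3)" by (simp only: power_add power_mult zeta_cubed power_one mult_1)
  finally show ?thesis .
qed

text \<open>Z and its complex conjugate form a linear system for u and v with determinant \<zeta>^2
  - \<zeta>, whose square is -3. This is the origin of the factor 3.\<close>

lemma OK_coordinates:
  assumes Z: "Z \<in> OK"
  obtains u v where "3 * Z = complex_of_real u + complex_of_real v * \<zeta>" "u \<in> OL" "v \<in> OL"
proof -
  have "Z \<in> K" using Z OK_iff by blast
  then obtain u v where uv: "Z = complex_of_real u + complex_of_real v * \<zeta>" "u \<in> L" "v \<in> L"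
    unfolding K_eq by (rule zeta_extE)
  have cnjZ: "cnj Z = complex_of_real u + complex_of_real v * (\<zeta> * \<zeta>)" by (simp add: uv(1) cnj_zeta)
  have zO: "\<zeta> \<in> OK" "- 1 \<in> OK"
    using zeta_alg_int is_subfield_of_int[OF K_subfield, of "-1"] by (simp_all add: OK_iff)
  have "complex_of_real (3 * v) = (Z + (- 1) * cnj Z) * ((\<zeta> * \<zeta>) + (- 1) * \<zeta>)"
    unfolding uv(1) cnjZ of_real_mult of_real_numeral cnjZ[unfolded uv(1)] using zeta_zeta by Groebner_Basis.algebra
  also have "\<dots> \<in> OK" by (intro OK_mult OK_add OK_cnj zO Z)
  finally have v: "3 * v \<in> OL"
    using uv is_subfieldD(4)[OF L_subfield is_subfield_of_int[OF L_subfield, of 3]]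
    by (simp add: OK_iff OL_iff algebraic_int_of_real_iff del: of_real_mult)
  have "complex_of_real (3 * u) = (\<zeta> * \<zeta> * Z + (- 1) * \<zeta> * cnj Z) * (\<zeta> + (- 1) * (\<zeta> * \<zeta>))"
    unfolding uv(1) cnjZ[unfolded uv(1)] of_real_mult of_real_numeral using zeta_zeta by Groebner_Basis.algebra
  also have "\<dots> \<in> OK" by (intro OK_mult OK_add OK_cnj zO Z)
  finally have u: "3 * u \<in> OL"
    using uv is_subfieldD(4)[OF L_subfield is_subfield_of_int[OF L_subfield, of 3]]
    by (simp add: OK_iff OL_iff algebraic_int_of_real_iff del: of_real_mult)
  have "3 * Z = complex_of_real (3 * u) + complex_of_real (3 * v) * \<zeta>"
    by (simp add: uv(1) algebra_simps)
  then show thesis using u v by (rule that)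
qed

text \<open>A prime dividing \<open>d\<close> is totally ramified over the cyclotomic field, so that modulo a prime
  above it every norm is a cube; but \<open>\<zeta>\<close> is a cube modulo \<open>p \<noteq> 3\<close> only if 9 divides \<open>p\<^sup>2 - 1\<close>.\<close>

lemma no_norm_zeta:
  assumes d9: "d mod 9 \<in> {2, 4, 5, 7}" and Z: "Z \<in> OK"
  shows "rel_norm \<sigma> Z \<noteq> \<zeta>"
proof
  assume norm: "rel_norm \<sigma> Z = \<zeta>"
  have not1: "d mod 9 \<notin> {1, 8}" using d9 by auto
  obtain p where p: "prime p" "p dvd d" "p \<noteq> 3" "p\<^sup>2 mod 9 \<noteq> 1"
    by (rule prime_divisor_not_pm_1[OF d9])
  have p0: "p \<noteq> 0" using p(1) by auto
  obtain u v where uv: "3 * Z = complex_of_real u + complex_of_real v * \<zeta>" "u \<in> OL" "v \<in> OL"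
    by (rule OK_coordinates[OF Z])
  have uvO: "u \<in> O0" "v \<in> O0" using uv OL_eq_O0[OF not1] by auto
  obtain x y z where u: "u = el (of_int x) (of_int y) (of_int z)" using uvO(1) by (rule O0E)
  obtain x' y' z' where v: "v = el (of_int x') (of_int y') (of_int z')" using uvO(2) by (rule O0E)
  define X Y W where "X = of_int x + of_int x' * \<zeta>" and "Y = of_int y + of_int y' * \<zeta>" and "W = of_int z + of_int z' * \<zeta>"
  have k: "X \<in> k0" "Y \<in> k0" "W \<in> k0"
    unfolding X_def Y_def W_def
    by (intro is_subfieldD(4,7)[OF k0_subfield] is_subfield_of_int[OF k0_subfield] zeta_in_k0)+
  have alg: "algebraic_int X" "algebraic_int Y" "algebraic_int W"
    unfolding X_def Y_def W_def by (intro algebraic_int_add algebraic_int_mult algebraic_int_of_int zeta_alg_int)+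
  have Z3: "3 * Z = kel X Y W"
    unfolding uv(1) u v of_real_el by (simp add: kel_def X_def Y_def W_def algebra_simps)
  \<comment> \<open>Only 3 Z is known to have integral coordinates, so the norm to be studied is 27
    \<zeta>.\<close>
  have "nf X Y W = rel_norm \<sigma> (3 * Z)" by (simp only: Z3 rel_norm_kel[OF k])
  also have "\<dots> = rel_norm \<sigma> (of_int 3) * rel_norm \<sigma> Z"
    using rel_norm_mult[OF is_subfield_of_int[OF K_subfield, of 3]] Z OK_iff by simp
  also have "rel_norm \<sigma> (of_int 3) = 27" unfolding rel_norm_def sigma_of_int by simp
  finally have nf: "nf X Y W = 27 * \<zeta>" using norm by simp
  have pab: "p dvd a * b"
    using p(1,2) unfolding d_eq by (metis dvd_mult dvd_mult2 prime_dvd_mult_iff prime_dvd_power)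
  then obtain c where c: "a * b = p * c" by blast
  then have cc: "of_nat a * of_nat b = (of_nat p * of_nat c :: complex)" by (metis of_nat_mult)
  \<comment> \<open>Every other term of the norm form carries the factor ab, which p
    divides.\<close>
  have X3: "alg_cong p (X ^ 3) (27 * \<zeta>)"
  proof -
    have "27 * \<zeta> = X ^ 3 + (of_nat a * of_nat b) * (of_nat b * Y ^ 3 + of_nat a * W ^ 3 - of_nat 3 * X * Y * W)"
      unfolding nf[symmetric] nf_def of_nat_numeral by Groebner_Basis.algebra
    then have "27 * \<zeta> = X ^ 3 + of_nat p * (of_nat c * (of_nat b * Y ^ 3 + of_nat a * W ^ 3 - of_nat 3 * X * Y * W))"
      by (simp only: cc mult.assoc)
    moreover have "alg_cong p (of_nat p * (of_nat c * (of_nat b * Y ^ 3 + of_nat a * W ^ 3 - of_nat 3 * X * Y * W))) 0"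
      by (intro alg_cong_0 p0 algebraic_int_mult algebraic_int_add algebraic_int_diff algebraic_int_power
          algebraic_int_of_nat alg)
    ultimately have "alg_cong p (27 * \<zeta>) (X ^ 3)"
      using alg_cong_add[OF alg_cong_refl[of p "X ^ 3"]] by fastforce
    then show ?thesis by (rule alg_cong_sym)
  qed
  \<comment> \<open>Natural representatives of the coordinates modulo p, to which Fermat's little
    theorem applies.\<close>
  define n n' where "n = nat (x mod int p)" and "n' = nat (x' mod int p)"
  have red: "alg_cong p (of_int i) (of_nat (nat (i mod int p)))" for i
  proof -
    have "i = int (nat (i mod int p)) + int p * (i div int p)" using p0 by simp
    then have "of_int i = of_nat (nat (i mod int p)) + of_nat p * (of_int (i div int p) :: complex)"
      by (metis of_int_add of_int_mult of_int_of_nat_eq)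
    moreover have "alg_cong p (of_nat p * of_int (i div int p)) 0" by (intro alg_cong_0 p0 algebraic_int_of_int)
    ultimately show ?thesis using alg_cong_add[OF alg_cong_refl[of p "of_nat (nat (i mod int p))"]] by fastforce
  qed
  define X0 where "X0 = of_nat n + of_nat n' * \<zeta>"
  have X0: "alg_cong p X X0"
    unfolding X_def X0_def n_def n'_def
    by (intro alg_cong_add alg_cong_mult red alg_cong_refl algebraic_int_of_int zeta_alg_int)
  have alg0: "algebraic_int (of_nat n + of_nat n' * t)" if "algebraic_int t" for t :: complex
    using that by (intro algebraic_int_add algebraic_int_mult algebraic_int_of_nat)
  have frob: "alg_cong p ((of_nat n + of_nat n' * t) ^ p) (of_nat n + of_nat n' * t ^ p)" if t: "algebraic_int t" for t
  proof -
    have "alg_cong p ((of_nat n + of_nat n' * t) ^ p) (of_nat n ^ p + (of_nat n' * t) ^ p)"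
      by (intro alg_cong_add_power_prime p(1) algebraic_int_mult algebraic_int_of_nat t)
    moreover have "alg_cong p (of_nat n ^ p + of_nat n' ^ p * t ^ p) (of_nat n + of_nat n' * t ^ p)"
      by (intro alg_cong_add alg_cong_mult alg_cong_nat_power_prime p(1) alg_cong_refl algebraic_int_power
          algebraic_int_of_nat t)
    ultimately show ?thesis unfolding power_mult_distrib by (rule alg_cong_trans)
  qed
  have twice: "w ^ (p\<^sup>2) = (w ^ p) ^ p" for w :: complex by (simp add: power2_eq_square power_mult)
  have p2: "p\<^sup>2 mod 3 = 1"
  proof -
    have "\<not> 3 dvd p" using p(1,3) primes_dvd_imp_eq[of 3 p] by auto
    then have "p mod 3 = 1 \<or> p mod 3 = 2" by presburger
    then show ?thesis by (auto simp: power_mod[of p 3 2, symmetric])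
  qed
  \<comment> \<open>Applying the Frobenius map twice fixes the natural coordinates modulo p, and it
    fixes \<zeta> because p^2 is 1 modulo 3.\<close>
  have "alg_cong p (X0 ^ (p\<^sup>2)) ((of_nat n + of_nat n' * \<zeta> ^ p) ^ p)"
    unfolding twice X0_def
    by (intro alg_cong_power frob zeta_alg_int algebraic_int_power alg0)
  moreover have "alg_cong p ((of_nat n + of_nat n' * \<zeta> ^ p) ^ p) X0"
  proof -
    have "(\<zeta> ^ p) ^ p = \<zeta>" using zeta_power_mod_3[of "p\<^sup>2"] p2 twice[of \<zeta>] by simp
    then show ?thesis using frob[OF algebraic_int_power[OF zeta_alg_int, of p]] unfolding X0_def by simp
  qed
  ultimately have F0: "alg_cong p (X0 ^ (p\<^sup>2)) X0" by (rule alg_cong_trans)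
  have X0alg: "algebraic_int X0" unfolding X0_def by (intro alg0 zeta_alg_int)
  have F: "alg_cong p (X ^ (p\<^sup>2)) X"
    by (rule alg_cong_trans[OF alg_cong_power[OF X0 alg(1) X0alg] alg_cong_trans[OF F0 alg_cong_sym[OF X0]]])
  \<comment> \<open>Since p^2 = 3 m + 1, raising the congruence for X^3 to the power m compares X
    with (27 \<zeta>)^m X, while 3 times 27^m is 3^(p^2), which is congruent to 3. Together they say
    that \<zeta>^m is 1 modulo p up to factors prime to p.\<close>
  define m where "m = p\<^sup>2 div 3"
  have pm: "p\<^sup>2 = 3 * m + 1" unfolding m_def using p2 by presburger
  have three: "alg_cong p (3 * 27 ^ m) 3"
  proof -
    have "alg_cong p ((of_nat 3 ^ p) ^ p) (of_nat 3 ^ p)"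
      by (intro alg_cong_power alg_cong_nat_power_prime p(1) algebraic_int_power algebraic_int_of_nat)
    then have "alg_cong p ((of_nat 3 ^ p) ^ p) (of_nat 3)"
      using alg_cong_nat_power_prime[OF p(1), of 3] by (rule alg_cong_trans)
    then have "alg_cong p (3 ^ (3 * m + 1)) 3" by (simp only: twice[symmetric] pm of_nat_numeral)
    moreover have "(3::complex) ^ (3 * m + 1) = 3 * 27 ^ m" by (simp add: power_mult)
    ultimately show ?thesis by simp
  qed
  have zm: "algebraic_int (\<zeta> ^ m)" by (intro algebraic_int_power zeta_alg_int)
  have 27: "algebraic_int (27 * \<zeta>)" "algebraic_int (3 :: complex)"
    using algebraic_int_mult[OF algebraic_int_of_nat[of 27] zeta_alg_int] algebraic_int_of_nat[of 3] by simp_all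
  have "alg_cong p ((X ^ 3) ^ m * X) ((27 * \<zeta>) ^ m * X)"
    by (intro alg_cong_mult alg_cong_power X3 alg_cong_refl algebraic_int_power alg 27)
  moreover have "(X ^ 3) ^ m * X = X ^ (p\<^sup>2)" by (simp add: pm power_mult)
  ultimately have A: "alg_cong p X ((27 * \<zeta>) ^ m * X)" using alg_cong_trans[OF alg_cong_sym[OF F]] by simp
  \<comment> \<open>Multiplying by X^2 turns X into X^3, which is known to be 27 \<zeta>; this
    replaces cancelling X.\<close>
  have "alg_cong p (X * X\<^sup>2) ((27 * \<zeta>) ^ m * X * X\<^sup>2)"
    by (intro alg_cong_mult A alg_cong_refl algebraic_int_power alg)
  then have "alg_cong p (X ^ 3) ((27 * \<zeta>) ^ m * X ^ 3)" by (simp add: power2_eq_square power3_eq_cube mult.assoc)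
  moreover have "alg_cong p ((27 * \<zeta>) ^ m * X ^ 3) ((27 * \<zeta>) ^ m * (27 * \<zeta>))"
    by (intro alg_cong_mult alg_cong_refl X3 algebraic_int_power 27)
  ultimately have "alg_cong p (27 * \<zeta>) ((27 * \<zeta>) ^ m * (27 * \<zeta>))"
    by (rule alg_cong_trans[OF alg_cong_trans[OF alg_cong_sym[OF X3]]])
  then have S1: "alg_cong p (3 * (27 * \<zeta>)) (3 * ((27 * \<zeta>) ^ m * (27 * \<zeta>)))"
    by (rule alg_cong_mult[OF alg_cong_refl _ 27(2) algebraic_int_mult[OF algebraic_int_power[OF 27(1)] 27(1)]])
  have S2: "alg_cong p (3 * 27 ^ m * (\<zeta> ^ m * (27 * \<zeta>))) (3 * (\<zeta> ^ m * (27 * \<zeta>)))"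
    by (rule alg_cong_mult[OF three alg_cong_refl _ algebraic_int_mult[OF zm 27(1)]])
      (use algebraic_int_of_nat[of "3 * 27 ^ m"] in simp)
  have eq: "3 * ((27 * \<zeta>) ^ m * (27 * \<zeta>)) = 3 * 27 ^ m * (\<zeta> ^ m * (27 * \<zeta>))"
    by (simp only: power_mult_distrib mult_ac)
  have "alg_cong p (3 * (27 * \<zeta>)) (3 * (\<zeta> ^ m * (27 * \<zeta>)))"
    by (rule alg_cong_trans[OF S1[unfolded eq] S2])
  \<comment> \<open>As 3 does not divide m, (1 - \<zeta>^m)(1 - \<zeta>^(2 m)) = 3. The extra factor
    thus makes the difference equal to 81 times 3 = 243, a power of 3 that p would have to
    divide.\<close>
  then have I: "algebraic_int ((3 * (27 * \<zeta>) - 3 * (\<zeta> ^ m * (27 * \<zeta>))) / of_nat p * (\<zeta> * \<zeta> * (1 - (\<zeta> ^ m) ^ 2)))"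
    unfolding alg_cong_def by (rule algebraic_int_mult)
      (intro algebraic_int_mult algebraic_int_diff algebraic_int_power zeta_alg_int, simp)
  have "\<not> 3 dvd m"
  proof
    assume "3 dvd m"
    then have "p\<^sup>2 mod 9 = 1" unfolding pm by presburger
    then show False using p(4) by simp
  qed
  then have "m mod 3 = 1 \<or> m mod 3 = 2" by presburger
  then have "\<zeta> ^ m = \<zeta> \<or> \<zeta> ^ m = \<zeta>\<^sup>2" using zeta_power_mod_3[of m] by auto
  moreover have "(3 * (27 * \<zeta>) - 3 * (t * (27 * \<zeta>))) * (\<zeta> * \<zeta> * (1 - t ^ 2)) = 243" if "t = \<zeta> \<or> t = \<zeta>\<^sup>2" for t
  proof -
    have "(1 - t) * (1 - t ^ 2) = 3"
      using that
    proof
      assume t: "t = \<zeta>"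
      show ?thesis unfolding t using zeta_zeta by Groebner_Basis.algebra
    next
      assume t: "t = \<zeta>\<^sup>2"
      show ?thesis unfolding t using zeta_zeta by Groebner_Basis.algebra
    qed
    moreover have "(3 * (27 * \<zeta>) - 3 * (t * (27 * \<zeta>))) * (\<zeta> * \<zeta> * (1 - t ^ 2)) = 81 * \<zeta> ^ 3 * ((1 - t) * (1 - t ^ 2))"
      by Groebner_Basis.algebra
    ultimately show ?thesis by (simp add: zeta_cubed)
  qed
  ultimately have "(3 * (27 * \<zeta>) - 3 * (\<zeta> ^ m * (27 * \<zeta>))) * (\<zeta> * \<zeta> * (1 - (\<zeta> ^ m) ^ 2)) = 243"
    by blast
  then have "(3 * (27 * \<zeta>) - 3 * (\<zeta> ^ m * (27 * \<zeta>))) / of_nat p * (\<zeta> * \<zeta> * (1 - (\<zeta> ^ m) ^ 2)) = 243 / of_nat p"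
    by (simp only: times_divide_eq_left)
  with I have "algebraic_int (243 / of_nat p :: complex)" by (simp only:)
  then have "243 / of_nat p \<in> (\<int> :: complex set)" by (rule rational_algebraic_int_is_int) auto
  then obtain j where "243 / of_nat p = (of_int j :: complex)" by (elim Ints_cases)
  then have "of_int (int p * j) = (of_int 243 :: complex)" using p0 by (simp add: field_simps)
  then have "int p * j = 243" by (simp only: of_int_eq_iff)
  then have "int p dvd 243" by (metis dvd_triv_left)
  then have "int p dvd int (3 ^ 5)" by simp
  then have "p dvd 3 ^ 5" by (simp only: int_dvd_int_iff)
  then have "p dvd 3" by (rule prime_dvd_power[OF p(1)])
  then show False using p(1,3) primes_dvd_imp_eq[of p 3] by simp
qed

section \<open>Units of the cyclotomic field and cubes in it\<close>

lemma cmod_sq_zeta_ext: "(cmod (complex_of_real u + complex_of_real v * \<zeta>))\<^sup>2 = u * u - u * v + v * v"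
proof -
  have "complex_of_real ((cmod (complex_of_real u + complex_of_real v * \<zeta>))\<^sup>2)
      = (complex_of_real u + complex_of_real v * \<zeta>) * (complex_of_real u + complex_of_real v * (\<zeta> * \<zeta>))"
    unfolding complex_norm_square by (simp add: cnj_zeta)
  also have "\<dots> = complex_of_real (u * u - u * v + v * v)"
    unfolding of_real_diff of_real_add of_real_mult using zeta_zeta by Groebner_Basis.algebra
  finally show ?thesis by (simp only: of_real_eq_iff)
qed

lemma cmod_sq_L: "w \<in> K \<Longrightarrow> (cmod w)\<^sup>2 \<in> L"
  unfolding K_eq
  by (elim zeta_extE) (simp add: cmod_sq_zeta_ext is_subfieldD(3,4,7)[OF L_subfield])

lemma cmod_sq_k0: "w \<in> k0 \<Longrightarrow> (cmod w)\<^sup>2 \<in> \<rat>"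
  by (elim k0_cases) (simp add: cmod_sq_zeta_ext)

lemma cmod_sq_EL: "w \<in> EK \<Longrightarrow> (cmod w)\<^sup>2 \<in> EL"
proof -
  assume w: "w \<in> EK"
  then have "w * cnj w \<in> EK" by (intro EK_mult EK_cnj)
  then have "complex_of_real ((cmod w)\<^sup>2) \<in> EK" by (simp only: complex_norm_square)
  moreover have "(cmod w)\<^sup>2 \<in> L" using w cmod_sq_L by (auto simp: ring_units_iff OK_iff)
  ultimately show ?thesis using EK_of_real_iff by blast
qed

lemma Rats_EL: "u \<in> \<rat> \<Longrightarrow> u \<in> EL \<Longrightarrow> \<bar>u\<bar> = 1"
proof -
  assume u: "u \<in> \<rat>" "u \<in> EL"
  then have "u \<noteq> 0" by (simp add: ring_units_iff)
  then have "nm u = u ^ 3" using u by (intro nm_homog homog_of_Rats) auto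
  then have "\<bar>u\<bar> ^ 3 = 1 ^ 3" using norm_of_unit[OF u(2)] by (simp add: power_abs)
  then show ?thesis by (rule power_eq_imp_eq_base) auto
qed

lemma k0_unit_cmod: "w \<in> k0 \<Longrightarrow> w \<in> EK \<Longrightarrow> cmod w = 1"
proof -
  assume w: "w \<in> k0" "w \<in> EK"
  have "\<bar>(cmod w)\<^sup>2\<bar> = 1" using Rats_EL[OF cmod_sq_k0[OF w(1)] cmod_sq_EL[OF w(2)]] .
  then have "(cmod w)\<^sup>2 = 1\<^sup>2" by simp
  then show ?thesis by (rule power_eq_imp_eq_base) auto
qed

text \<open>The traces t of w and -s of w \<zeta> are integers, and the squared absolute value 1 of
  w becomes s^2 - s t + t^2 = 3. This has six integer solutions, the sixth roots of unity.\<close>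

lemma k0_unit_cases:
  assumes w: "w \<in> k0" "w \<in> EK"
  shows "w \<in> {1, -1, \<zeta>, - \<zeta>, \<zeta> * \<zeta>, - (\<zeta> * \<zeta>)}"
proof -
  obtain u v where uv: "w = complex_of_real u + complex_of_real v * \<zeta>" "u \<in> \<rat>" "v \<in> \<rat>"
    using w(1) by (rule k0_cases)
  have wO: "algebraic_int w" using w(2) by (simp add: ring_units_iff OK_iff)
  have int: "2 * p - q \<in> \<int>" if "algebraic_int (complex_of_real p + complex_of_real q * \<zeta>)" "p \<in> \<rat>" "q \<in> \<rat>" for p q
  proof -
    define t where "t = complex_of_real p + complex_of_real q * \<zeta>"
    have ct: "cnj t = complex_of_real p + complex_of_real q * (\<zeta> * \<zeta>)" by (simp add: t_def cnj_zeta)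
    have "complex_of_real (2 * p - q) = t + cnj t"
      unfolding ct unfolding t_def of_real_diff of_real_mult of_real_numeral using zeta_zeta by Groebner_Basis.algebra
    moreover have "algebraic_int (t + cnj t)" using that(1) by (intro algebraic_int_add) (auto simp: t_def[symmetric])
    ultimately have "algebraic_int (2 * p - q)" by (metis algebraic_int_of_real_iff)
    then show ?thesis using that by (intro rational_algebraic_int_is_int) auto
  qed
  have "2 * u - v \<in> \<int>" using int[of u v] wO uv by simp
  then obtain t where t: "2 * u - v = of_int t" by (elim Ints_cases)
  have "w * \<zeta> = complex_of_real (- v) + complex_of_real (u - v) * \<zeta>"
    unfolding uv(1) of_real_diff of_real_minus using zeta_zeta by Groebner_Basis.algebra
  then have "algebraic_int (complex_of_real (- v) + complex_of_real (u - v) * \<zeta>)"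
    using algebraic_int_mult[OF wO zeta_alg_int] by simp
  then have "2 * (- v) - (u - v) \<in> \<int>" using uv by (intro int) auto
  then obtain s' where s': "2 * (- v) - (u - v) = of_int s'" by (elim Ints_cases)
  define s where "s = - s'"
  have s: "u + v = of_int s" using s' by (simp add: s_def)
  have "u * u - u * v + v * v = 1" using k0_unit_cmod[OF w] cmod_sq_zeta_ext[of u v] uv(1) by simp
  moreover have "3 * (u * u - u * v + v * v) = real_of_int (s * s - s * t + t * t)"
    unfolding of_int_add of_int_diff of_int_mult s[symmetric] t[symmetric] by Groebner_Basis.algebra
  ultimately have "real_of_int (s * s - s * t + t * t) = of_int 3" by simp
  then have st: "s * s - s * t + t * t = 3" by (simp only: of_int_eq_iff)
  have bound: "\<bar>y\<bar> \<le> 2" if "x * x - x * y + y * y = 3" for x y :: int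
  proof (rule ccontr)
    assume "\<not> \<bar>y\<bar> \<le> 2"
    then have "3 \<le> \<bar>y\<bar>" by simp
    then have "3 * 3 \<le> \<bar>y\<bar> * \<bar>y\<bar>" by (intro mult_mono) auto
    then have "9 \<le> y * y" by simp
    define A where "A = (2 * x - y) * (2 * x - y)"
    have "A + 3 * (y * y) = 4 * (x * x - x * y + y * y)" unfolding A_def by Groebner_Basis.algebra
    then have "A + 3 * (y * y) = 12" unfolding that by simp
    moreover have "0 \<le> A" by (simp add: A_def)
    ultimately show False using \<open>9 \<le> y * y\<close> by linarith
  qed
  have "\<bar>t\<bar> \<le> 2" using bound[OF st] .
  moreover have "\<bar>s\<bar> \<le> 2" using bound[of t s] st by (simp add: algebra_simps)
  ultimately have "s \<in> {-2, -1, 0, 1, 2}" "t \<in> {-2, -1, 0, 1, 2}" by auto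
  then have st': "(s, t) \<in> {(1, 2), (2, 1), (1, -1), (-1, 1), (-1, -2), (-2, -1)}" using st by auto
  define f where "f = (\<lambda>(s :: int, t :: int). ((of_int s + of_int t) / 3 :: real, (2 * of_int s - of_int t) / 3 :: real))"
  have "u = (of_int s + of_int t) / 3" "v = (2 * of_int s - of_int t) / 3"
    using s t by simp_all
  then have "(u, v) = f (s, t)" by (simp add: f_def)
  then have "(u, v) \<in> f ` {(1, 2), (2, 1), (1, -1), (-1, 1), (-1, -2), (-2, -1)}" using st' by (simp only: imageI)
  then have "(u, v) \<in> {(1, 0), (1, 1), (0, 1), (0, -1), (-1, 0), (-1, -1)}" by (simp add: f_def)
  then show ?thesis unfolding uv(1) using zeta_zeta by auto
qed

lemma rel_norm_k0: "w \<in> K \<Longrightarrow> rel_norm \<sigma> w \<in> k0"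
proof (elim K_cases)
  fix p q r assume w: "w = kel p q r" "p \<in> k0" "q \<in> k0" "r \<in> k0"
  have "of_nat n \<in> k0" "(3 :: complex) \<in> k0" for n
    using is_subfield_of_nat[OF k0_subfield] is_subfield_of_nat[OF k0_subfield, of 3] by simp_all
  then show ?thesis
    unfolding w(1) rel_norm_kel[OF w(2-4)] nf_def using w
    by (intro is_subfieldD(3,4,7,9)[OF k0_subfield])
qed

lemma rel_norm_EK: "w \<in> EK \<Longrightarrow> rel_norm \<sigma> w \<in> EK"
  unfolding rel_norm_def by (intro EK_mult EK_sigma)

text \<open>If \<sigma> fixes the cube of w, then \<sigma>(w) / w is a cube root of unity, so w is
  an eigenvector of \<sigma> and has a single component.\<close>

lemma cube_in_k0:
  assumes k: "p \<in> k0" "q \<in> k0" "r \<in> k0" and cube: "(kel p q r) ^ 3 \<in> k0"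
  shows "(q = 0 \<and> r = 0) \<or> (p = 0 \<and> r = 0) \<or> (p = 0 \<and> q = 0)"
proof (cases "kel p q r = 0")
  case True
  then show ?thesis using kel_eq_0 k by blast
next
  case False
  define w where "w = kel p q r"
  have wK: "w \<in> K" "w \<noteq> 0" using kel_in_K k False by (auto simp: w_def)
  have "\<sigma> w ^ 3 = w ^ 3" using sigma_k0[OF cube] sigma_power[OF wK(1), of 3] by (simp add: w_def)
  then have "(\<sigma> w - w) * ((\<sigma> w - \<zeta> * w) * (\<sigma> w - \<zeta> * \<zeta> * w)) = 0"
    using zeta_zeta by Groebner_Basis.algebra
  then have "\<sigma> w = 1 * w \<or> \<sigma> w = \<zeta> * w \<or> \<sigma> w = (\<zeta> * \<zeta>) * w" by simp
  then obtain c where c: "c = 1 \<or> c = \<zeta> \<or> c = \<zeta> * \<zeta>" "\<sigma> w = c * w" by blast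
  have ck: "c \<in> k0" using c(1) is_subfieldD(1,4)[OF k0_subfield] zeta_in_k0 by auto
  have "kel p (q * \<zeta>) (r * (\<zeta> * \<zeta>)) = kel (c * p) (c * q) (c * r)"
    using c(2) unfolding w_def sigma_kel[OF k] kel_scale .
  then have eqs: "p = c * p" "q * \<zeta> = c * q" "r * (\<zeta> * \<zeta>) = c * r"
    using kel_inject[OF k(1), of "q * \<zeta>" "r * (\<zeta> * \<zeta>)" "c * p" "c * q" "c * r"] k ck zeta_in_k0
      is_subfieldD(4)[OF k0_subfield] by blast+
  have ne: "\<zeta> \<noteq> 1" "\<zeta> * \<zeta> \<noteq> 1" "\<zeta> * \<zeta> \<noteq> \<zeta>"
    using zeta_neq_1 zeta_neq_0 zeta_3 by auto
  show ?thesis using c(1)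
  proof (elim disjE)
    assume "c = 1"
    then show ?thesis using eqs ne by auto
  next
    assume "c = \<zeta>"
    then show ?thesis using eqs ne by auto
  next
    assume "c = \<zeta> * \<zeta>"
    then show ?thesis using eqs ne by auto
  qed
qed

text \<open>By \<open>cube_in_k0\<close> the unit w has a single component, and its absolute value
  is 1. If that component belonged to \<open>D\<close> or \<open>E\<close>, squaring the absolute
  value would make \<open>E\<close> or \<open>D\<close> rational.\<close>

lemma unit_cube_in_k0:
  assumes w: "w \<in> EK" and cube: "w ^ 3 \<in> k0"
  shows "w \<in> k0"
proof -
  have wK: "w \<in> K" using w by (simp add: ring_units_iff OK_iff)
  obtain p q r where pqr: "w = kel p q r" and k: "p \<in> k0" "q \<in> k0" "r \<in> k0" using wK by (rule K_cases)
  have "cmod (w ^ 3) = 1" using k0_unit_cmod[OF cube EK_power[OF w]] .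
  then have "cmod w ^ 3 = 1 ^ 3" by (simp add: norm_power)
  then have w1: "cmod w = 1" by (rule power_eq_imp_eq_base) auto
  consider "q = 0 \<and> r = 0" | "p = 0 \<and> r = 0" | "p = 0 \<and> q = 0" using cube_in_k0[OF k] cube pqr by blast
  then show ?thesis
  proof cases
    case 1
    then show ?thesis using pqr k by (simp add: kel_def)
  next
    case 2
    then have "cmod q * D = 1" using w1 D_gt_1 by (simp add: pqr kel_def norm_mult)
    then have "(cmod q)\<^sup>2 * (D * D) = 1" by Groebner_Basis.algebra
    then have "((cmod q)\<^sup>2 * real b) * E = 1" by (simp only: D_D mult.assoc)
    moreover have "(cmod q)\<^sup>2 * real b \<in> \<rat>" using cmod_sq_k0[OF k(2)] by simp
    moreover have "(cmod q)\<^sup>2 * real b * E \<in> \<rat>" using calculation(1) by simp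
    ultimately have "(cmod q)\<^sup>2 * real b = 0" by (intro rational_mult_E)
    then have "0 * E = 1" using \<open>((cmod q)\<^sup>2 * real b) * E = 1\<close> by (simp only:)
    then show ?thesis by simp
  next
    case 3
    then have "cmod r * E = 1" using w1 E_gt_1 by (simp add: pqr kel_def norm_mult)
    then have "(cmod r)\<^sup>2 * (E * E) = 1" by Groebner_Basis.algebra
    then have "((cmod r)\<^sup>2 * real a) * D = 1" by (simp only: E_E mult.assoc)
    moreover have "(cmod r)\<^sup>2 * real a \<in> \<rat>" using cmod_sq_k0[OF k(3)] by simp
    moreover have "(cmod r)\<^sup>2 * real a * D \<in> \<rat>" using calculation(1) by simp
    ultimately have "(cmod r)\<^sup>2 * real a = 0" by (intro rational_mult_D)
    then have "0 * D = 1" using \<open>((cmod r)\<^sup>2 * real a) * D = 1\<close> by (simp only:)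
    then show ?thesis by simp
  qed
qed

lemma cube_Rats_homog:
  assumes u: "u \<in> L" "u \<noteq> 0" and cube: "u ^ 3 \<in> \<rat>"
  shows "homog u"
proof -
  obtain x y z where xyz: "u = el x y z" "x \<in> \<rat>" "y \<in> \<rat>" "z \<in> \<rat>" using u(1) by (rule L_cases)
  have k: "complex_of_real x \<in> k0" "complex_of_real y \<in> k0" "complex_of_real z \<in> k0"
    using xyz Rats_in_k0 of_real_Rats by blast+
  have "complex_of_real (u ^ 3) \<in> k0" using cube Rats_in_k0 of_real_Rats by blast
  then have "kel (complex_of_real x) (complex_of_real y) (complex_of_real z) ^ 3 \<in> k0"
    by (simp only: xyz(1) of_real_power of_real_el)
  from cube_in_k0[OF k this] have "u \<in> {x, y * D, z * E}" by (auto simp: xyz(1) el_def)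
  then show ?thesis using component_homog[OF xyz(2-4) _ u(2)] by blast
qed

lemma nm_L_pos_part: "\<alpha> \<in> L \<Longrightarrow> \<alpha> \<noteq> 0 \<Longrightarrow> \<alpha> ^ 3 / nm \<alpha> = \<alpha>\<^sup>2 / cp \<alpha>"
  by (simp add: nm_def power2_eq_square power3_eq_cube)

text \<open>Clearing denominators and removing rational factors turns any non-trivial invariant element
  into a principal factor.\<close>

lemma ambiguous_imp_type_beta:
  assumes amb: "ambiguous \<alpha>" and triv: "\<alpha> \<notin> trivial_factors"
  shows "type_beta d \<zeta> \<sigma>"
proof -
  have \<alpha>L: "\<alpha> \<in> L" "\<alpha> \<noteq> 0" using amb by (auto simp: ambiguous_def)
  \<comment> \<open>The integral absolute norms of rational multiples of \<alpha>. A multiple of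
    least norm is primitive, since dividing it by an integer would lower the norm.\<close>
  define P where "P = (\<lambda>n::nat. \<exists>s. s \<in> \<rat> \<and> s \<noteq> 0 \<and> \<bar>nm (\<alpha> * s)\<bar> = real n)"
  obtain p q :: int where pq: "q > 0" "nm \<alpha> = of_int p / of_int q" using nm_Rats[OF \<alpha>L(1)] by (auto elim: Rats_cases')
  have nms: "nm (\<alpha> * s) = nm \<alpha> * s ^ 3" if "s \<in> \<rat>" "s \<noteq> 0" for s
    using homog_of_Rats[OF that] by (simp add: nm_mult[OF \<alpha>L(1) homog_in_L] nm_homog)
  have "nm (\<alpha> * of_int q) = of_int (p * q\<^sup>2)"
    using pq by (simp add: nms power2_eq_square power3_eq_cube)
  then have "\<bar>nm (\<alpha> * of_int q)\<bar> = real (nat \<bar>p * q\<^sup>2\<bar>)" by simp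
  then have "P (nat \<bar>p * q\<^sup>2\<bar>)" unfolding P_def using pq(1) by (intro exI[of _ "of_int q"]) auto
  then have "P (Least P)" by (rule LeastI)
  then obtain s where s: "s \<in> \<rat>" "s \<noteq> 0" "\<bar>nm (\<alpha> * s)\<bar> = real (Least P)" unfolding P_def by blast
  define \<beta> where "\<beta> = \<alpha> * s"
  have hs: "homog s" using homog_of_Rats s by blast
  have amb': "ambiguous \<beta>" unfolding \<beta>_def by (rule ambiguous_mult_homog(1)[OF amb hs])
  have \<beta>L: "\<beta> \<in> L" "\<beta> \<noteq> 0" using amb' by (auto simp: ambiguous_def)
  have "nm \<beta> \<in> \<int>" 
  proof -
    have "nm \<beta> = real (Least P) \<or> nm \<beta> = - real (Least P)" using s(3) unfolding \<beta>_def[symmetric] by linarith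
    then show ?thesis by (elim disjE) simp_all
  qed
  then have \<beta>O: "\<beta> \<in> OL" by (rule ambiguous_integral[OF amb'])
  have "\<beta> / of_int m \<notin> OL" if m: "m > 1" for m :: int
  proof
    assume "\<beta> / of_int m \<in> OL"
    then obtain j where j: "nm (\<beta> / of_int m) = of_int j" using nm_int by (auto elim: Ints_cases)
    have sm: "s / of_int m \<in> \<rat>" "s / of_int m \<noteq> 0" using s m by auto
    have bm: "\<beta> / of_int m = \<alpha> * (s / of_int m)" by (simp add: \<beta>_def)
    have "\<bar>nm (\<alpha> * (s / of_int m))\<bar> = real (nat \<bar>j\<bar>)" using j by (simp add: bm)
    then have "P (nat \<bar>j\<bar>)" unfolding P_def using sm by blast
    then have "Least P \<le> nat \<bar>j\<bar>" by (rule Least_le)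
    moreover have "\<bar>nm \<beta>\<bar> = \<bar>nm (\<alpha> * (s / of_int m))\<bar> * of_int m ^ 3"
      unfolding \<beta>_def nms[OF s(1,2)] nms[OF sm] using m by (simp add: power_divide abs_mult)
    then have "real (Least P) = real (nat \<bar>j\<bar>) * of_int m ^ 3"
      using s(3) \<open>\<bar>nm (\<alpha> * (s / of_int m))\<bar> = real (nat \<bar>j\<bar>)\<close> by (simp add: \<beta>_def)
    moreover have "0 < real (nat \<bar>j\<bar>)" using j bm nm_eq_0 \<beta>L m OL_iff \<open>\<beta> / of_int m \<in> OL\<close> by fastforce
    moreover have "1 < real_of_int m ^ 3" using m by (intro one_less_power) auto
    ultimately have "real (nat \<bar>j\<bar>) * 1 < real (Least P)" by (metis mult_strict_left_mono)
    then show False using \<open>Least P \<le> nat \<bar>j\<bar>\<close> by simp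
  qed
  then have "principal_factor d \<zeta> \<sigma> \<beta>" using \<beta>O amb' by (simp add: principal_factor_iff)
  moreover have "\<beta> \<notin> trivial_factors" unfolding \<beta>_def using trivial_mult_iff[OF homog_trivial[OF hs] s(2)] triv by simp
  ultimately show ?thesis unfolding type_beta_def nontrivial_iff by blast
qed

end

section \<open>The unit index\<close>

lemma power_int_add_triple:
  fixes x :: "'a::field"
  assumes "x \<noteq> 0"
  shows "x powi (q + 3 * i) = x powi q * (x powi i) ^ 3"
proof -
  have "q + 3 * i = q + i + i + i" by simp
  then have "x powi (q + 3 * i) = x powi q * x powi i * x powi i * x powi i"
    using assms by (simp only: power_int_add simp_thms)
  then show ?thesis by (simp add: power3_eq_cube mult.assoc)
qed

text \<open>\<epsilon> is the fundamental unit of the maximal order of L. Its existence is supplied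
  by the period of the chain.\<close>

locale pure_cubic_units = pure_cubic_closure +
  fixes \<epsilon> :: real
  assumes eps_EL: "\<epsilon> \<in> ring_units (maximal_order (pure_cubic d))" and eps_gt_1: "1 < \<epsilon>"
    and eps_least: "\<And>u. u \<in> ring_units (maximal_order (pure_cubic d)) \<Longrightarrow> 1 < u \<Longrightarrow> \<epsilon> \<le> u"
begin

section \<open>Exponents of the fundamental unit\<close>

lemma EL_powi: "u \<in> EL \<Longrightarrow> u powi k \<in> EL"
  by (cases "k \<ge> 0") (simp_all add: power_int_def EL_power ring_units_inverse)

lemma EK_powi: "w \<in> EK \<Longrightarrow> w powi k \<in> EK"
  by (cases "k \<ge> 0") (simp_all add: power_int_def EK_power ring_units_inverse)

lemma eps_powi_inject: "\<epsilon> powi p = \<epsilon> powi q \<longleftrightarrow> p = q"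
proof
  assume eq: "\<epsilon> powi p = \<epsilon> powi q"
  have l: "ln (\<epsilon> powi k) = of_int k * ln \<epsilon>" for k
    using eps_gt_1 by (simp add: ln_powr flip: powr_real_of_int')
  have "of_int p * ln \<epsilon> = of_int q * ln \<epsilon>" unfolding l[symmetric] eq ..
  moreover have "ln \<epsilon> \<noteq> 0" using eps_gt_1 by simp
  ultimately show "p = q" by simp
qed simp

text \<open>Dividing u by a suitable power of \<epsilon> leaves a unit v with 1 \<le> v <
  \<epsilon>, and by the choice of \<epsilon> this is 1.\<close>

lemma EL_pos_power:
  assumes u: "u \<in> EL" "0 < u"
  obtains k where "u = \<epsilon> powi k"
proof -
  define k where "k = \<lfloor>log \<epsilon> u\<rfloor>"
  define v where "v = u * \<epsilon> powi (- k)"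
  have v: "v \<in> EL" unfolding v_def by (intro EL_mult EL_powi u eps_EL)
  have pw: "\<epsilon> powr of_int k = \<epsilon> powi k" using eps_gt_1 by (simp add: powr_real_of_int')
  have pos: "0 < \<epsilon> powi k" using eps_gt_1 by simp
  have "\<epsilon> powi k \<le> u" using eps_gt_1 u(2) unfolding pw[symmetric] by (simp add: k_def powr_le_iff)
  then have ge: "1 \<le> v" using pos by (simp add: v_def power_int_minus field_simps)
  have "u < \<epsilon> powr (of_int k + 1)" using eps_gt_1 u(2) by (simp add: k_def less_powr_iff)
  then have "u < \<epsilon> powi k * \<epsilon>" using eps_gt_1 pw by (simp add: powr_add)
  then have lt: "v < \<epsilon>" using pos by (simp add: v_def power_int_minus field_simps)
  have "v = 1" using eps_least[OF v] ge lt by linarith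
  then have "u = \<epsilon> powi k" using pos by (simp add: v_def power_int_minus field_simps)
  then show thesis by (rule that)
qed

text \<open>The square of the absolute value is w times its complex conjugate, hence a positive unit
  of L itself and a power of \<epsilon>.\<close>

definition expo :: "complex \<Rightarrow> int" where
  "expo w = (THE k. (cmod w)\<^sup>2 = \<epsilon> powi k)"

lemma expo_eq: "(cmod w)\<^sup>2 = \<epsilon> powi k \<Longrightarrow> expo w = k"
  unfolding expo_def by (rule the_equality) (simp_all add: eps_powi_inject)

lemma cmod_sq_expo:
  assumes "w \<in> EK" shows "(cmod w)\<^sup>2 = \<epsilon> powi expo w"
proof -
  have "0 < (cmod w)\<^sup>2" using assms by (simp add: ring_units_iff)
  then obtain k where "(cmod w)\<^sup>2 = \<epsilon> powi k" using EL_pos_power[OF cmod_sq_EL[OF assms]] by blast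
  then show ?thesis using expo_eq by simp
qed

lemma expo_mult: "w \<in> EK \<Longrightarrow> t \<in> EK \<Longrightarrow> expo (w * t) = expo w + expo t"
  using eps_gt_1 by (intro expo_eq) (simp add: norm_mult power_mult_distrib cmod_sq_expo power_int_add)

lemma expo_cmod_1: "cmod w = 1 \<Longrightarrow> expo w = 0"
  by (rule expo_eq) simp

lemma expo_inverse: "w \<in> EK \<Longrightarrow> expo (inverse w) = - expo w"
  by (rule expo_eq) (simp add: norm_inverse power_inverse cmod_sq_expo power_int_minus)

lemma expo_cong: "cmod w = cmod t \<Longrightarrow> expo w = expo t"
  by (simp add: expo_def)

lemma EK_in_K: "w \<in> EK \<Longrightarrow> w \<in> K" and EK_nonzero: "w \<in> EK \<Longrightarrow> w \<noteq> 0"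
  by (simp_all add: ring_units_iff OK_iff)

text \<open>The relative norm is a unit of k0 and so has absolute value 1.\<close>

lemma expo_sum: "w \<in> EK \<Longrightarrow> expo w + expo (\<sigma> w) + expo (\<sigma> (\<sigma> w)) = 0"
proof -
  assume w: "w \<in> EK"
  have "cmod (rel_norm \<sigma> w) = 1" using w EK_in_K rel_norm_k0 rel_norm_EK k0_unit_cmod by blast
  then have "expo (rel_norm \<sigma> w) = 0" by (rule expo_cmod_1)
  then show ?thesis unfolding rel_norm_def using w by (simp add: expo_mult EK_mult EK_sigma)
qed

text \<open>Modulo 3, this homomorphism has the subgroup generated by the units of the proper subfields as
  its kernel.\<close>

definition hx :: "complex \<Rightarrow> int" where
  "hx w = expo (\<sigma> (\<sigma> w)) - expo (\<sigma> w)"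

lemma hx_mult: "w \<in> EK \<Longrightarrow> t \<in> EK \<Longrightarrow> hx (w * t) = hx w + hx t"
  by (simp add: hx_def sigma_mult EK_in_K sigma_K expo_mult EK_sigma)

lemma hx_inverse: "w \<in> EK \<Longrightarrow> hx (inverse w) = - hx w"
  by (simp add: hx_def sigma_inverse EK_in_K sigma_K expo_inverse EK_sigma)

lemma hx_k0: "w \<in> k0 \<Longrightarrow> hx w = 0"
  by (simp add: hx_def sigma_k0)

lemma hx_EL: "u \<in> EL \<Longrightarrow> hx (complex_of_real u) = 0"
proof -
  assume "u \<in> EL"
  then have "u \<in> L" by (simp add: ring_units_iff OL_iff)
  then have "expo (\<sigma> (\<sigma> (complex_of_real u))) = expo (\<sigma> (complex_of_real u))"
    by (intro expo_cong) (simp add: sigma_sigma_L)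
  then show ?thesis by (simp add: hx_def)
qed

text \<open>For real u the two non-real conjugates have the same exponent r, so u has exponent -2 r
  because the sum is zero. The difference of two of the three exponents is then 0 or +-3 r.\<close>

lemma hx_sigma_EL:
  assumes u: "u \<in> EL"
  shows "3 dvd hx (\<sigma> (complex_of_real u))" and "3 dvd hx (\<sigma> (\<sigma> (complex_of_real u)))"
proof -
  define w where "w = complex_of_real u"
  have w: "w \<in> EK" "w \<in> K" using u EK_of_real EK_in_K by (auto simp: w_def)
  have eq: "expo (\<sigma> (\<sigma> w)) = expo (\<sigma> w)" using hx_EL[OF u] by (simp add: hx_def w_def)
  have sum: "expo w + expo (\<sigma> w) + expo (\<sigma> (\<sigma> w)) = 0" by (rule expo_sum[OF w(1)])
  show "3 dvd hx (\<sigma> (complex_of_real u))"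
    unfolding hx_def w_def[symmetric] sigma_3[OF w(2)] using eq sum by presburger
  show "3 dvd hx (\<sigma> (\<sigma> (complex_of_real u)))"
    unfolding hx_def w_def[symmetric] sigma_3[OF sigma_K[OF w(2)]] sigma_3[OF w(2)] using eq sum by presburger
qed

section \<open>The group generated by the units of the subfields, and its index\<close>

definition subfield_units :: "complex set" where
  "subfield_units = ring_units (maximal_order k0) \<union> ring_units (maximal_order (complex_of_real ` L)) \<union>
     ring_units (maximal_order (\<sigma> ` complex_of_real ` L)) \<union>
     ring_units (maximal_order (\<sigma> ` \<sigma> ` complex_of_real ` L))"

definition E0 :: "complex set" where
  "E0 = mult_subgroup_generated subfield_units"

lemma unit_index_eq: "subfield_unit_index d \<zeta> \<sigma> = mult_index EK E0"
  by (simp add: subfield_unit_index_def E0_def subfield_units_def Let_def)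

lemma units_k0_iff: "w \<in> ring_units (maximal_order k0) \<longleftrightarrow> w \<in> k0 \<and> w \<in> EK"
  using k0_subset_K is_subfieldD(5)[OF k0_subfield] is_subfieldD(5)[OF K_subfield]
  by (auto simp: ring_units_iff maximal_order_def)

lemma units_L_imp: "w \<in> ring_units (maximal_order (complex_of_real ` L)) \<Longrightarrow> \<exists>u\<in>EL. w = complex_of_real u"
  using is_subfieldD(5)[OF L_subfield]
  by (auto simp: ring_units_iff maximal_order_def algebraic_int_of_real_iff simp flip: of_real_inverse)

lemma units_sigma_L_imp:
  assumes "w \<in> ring_units (maximal_order (\<sigma> ` complex_of_real ` L))"
  shows "\<exists>u\<in>EL. w = \<sigma> (complex_of_real u)"
proof -
  obtain u where u: "u \<in> L" "w = \<sigma> (complex_of_real u)" using assms by (auto simp: ring_units_iff maximal_order_def)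
  have uK: "complex_of_real u \<in> K" using u L_subset_K by blast
  have "w \<in> EK"
    using assms u sigma_K[OF uK] is_subfieldD(5)[OF K_subfield] by (auto simp: ring_units_iff maximal_order_def)
  then have "\<sigma> (\<sigma> w) \<in> EK" by (intro EK_sigma)
  then have "complex_of_real u \<in> EK" using u(2) sigma_3[OF uK] by simp
  then show ?thesis using u EK_of_real_iff by blast
qed

lemma units_sigma_sigma_L_imp:
  assumes "w \<in> ring_units (maximal_order (\<sigma> ` \<sigma> ` complex_of_real ` L))"
  shows "\<exists>u\<in>EL. w = \<sigma> (\<sigma> (complex_of_real u))"
proof -
  obtain u where u: "u \<in> L" "w = \<sigma> (\<sigma> (complex_of_real u))" using assms by (auto simp: ring_units_iff maximal_order_def)
  have uK: "complex_of_real u \<in> K" using u L_subset_K by blast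
  have "w \<in> EK"
    using assms u sigma_K[OF sigma_K[OF uK]] is_subfieldD(5)[OF K_subfield] by (auto simp: ring_units_iff maximal_order_def)
  then have "\<sigma> w \<in> EK" by (rule EK_sigma)
  then have "complex_of_real u \<in> EK" using u(2) sigma_3[OF uK] by simp
  then show ?thesis using u EK_of_real_iff by blast
qed

lemma units_conjugates:
  assumes u: "u \<in> EL"
  shows "complex_of_real u \<in> ring_units (maximal_order (complex_of_real ` L))"
    and "\<sigma> (complex_of_real u) \<in> ring_units (maximal_order (\<sigma> ` complex_of_real ` L))"
    and "\<sigma> (\<sigma> (complex_of_real u)) \<in> ring_units (maximal_order (\<sigma> ` \<sigma> ` complex_of_real ` L))"
proof -
  have uL: "u \<in> L" "inverse u \<in> L" using u by (auto simp: ring_units_iff OL_iff)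
  define w where "w = complex_of_real u"
  have w: "w \<in> EK" "w \<in> K" using EK_of_real[OF u] EK_in_K by (auto simp: w_def)
  have iw: "inverse w = complex_of_real (inverse u)" by (simp add: w_def)
  have alg: "algebraic_int t \<and> algebraic_int (inverse t) \<and> t \<noteq> 0" if "t \<in> EK" for t
    using that by (simp add: ring_units_iff OK_iff)
  have inv: "inverse (\<sigma> w) = \<sigma> (inverse w)" "inverse (\<sigma> (\<sigma> w)) = \<sigma> (\<sigma> (inverse w))"
    using w sigma_K by (simp_all add: sigma_inverse)
  have mem: "w \<in> complex_of_real ` L" "inverse w \<in> complex_of_real ` L"
    unfolding iw unfolding w_def by (rule imageI; rule uL)+
  show "complex_of_real u \<in> ring_units (maximal_order (complex_of_real ` L))"
    unfolding w_def[symmetric] using alg[OF w(1)] mem by (simp add: ring_units_iff maximal_order_def)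
  show "\<sigma> (complex_of_real u) \<in> ring_units (maximal_order (\<sigma> ` complex_of_real ` L))"
    unfolding w_def[symmetric] using alg[OF EK_sigma[OF w(1)]] imageI[OF mem(1), of \<sigma>] imageI[OF mem(2), of \<sigma>]
    by (simp add: ring_units_iff maximal_order_def inv)
  show "\<sigma> (\<sigma> (complex_of_real u)) \<in> ring_units (maximal_order (\<sigma> ` \<sigma> ` complex_of_real ` L))"
    unfolding w_def[symmetric] using alg[OF EK_sigma[OF EK_sigma[OF w(1)]]]
      imageI[OF imageI[OF mem(1), of \<sigma>], of \<sigma>] imageI[OF imageI[OF mem(2), of \<sigma>], of \<sigma>]
    by (simp add: ring_units_iff maximal_order_def inv)
qed

lemma E0_least:
  assumes "1 \<in> H" "\<And>x y. x \<in> H \<Longrightarrow> y \<in> H \<Longrightarrow> x * y \<in> H" "\<And>x. x \<in> H \<Longrightarrow> inverse x \<in> H"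
    and "\<And>w. w \<in> k0 \<Longrightarrow> w \<in> EK \<Longrightarrow> w \<in> H" and "\<And>u. u \<in> EL \<Longrightarrow> complex_of_real u \<in> H"
    and "\<And>u. u \<in> EL \<Longrightarrow> \<sigma> (complex_of_real u) \<in> H" and "\<And>u. u \<in> EL \<Longrightarrow> \<sigma> (\<sigma> (complex_of_real u)) \<in> H"
  shows "E0 \<subseteq> H"
  unfolding E0_def
proof (rule mult_subgroup_generated_least)
  show "1 \<in> H" by fact
  show "x * y \<in> H" if "x \<in> H" "y \<in> H" for x y using that by (rule assms(2))
  show "inverse x \<in> H" if "x \<in> H" for x using that by (rule assms(3))
  show "subfield_units \<subseteq> H"
  proof
    fix w assume "w \<in> subfield_units"
    then consider "w \<in> ring_units (maximal_order k0)" | "w \<in> ring_units (maximal_order (complex_of_real ` L))"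
      | "w \<in> ring_units (maximal_order (\<sigma> ` complex_of_real ` L))"
      | "w \<in> ring_units (maximal_order (\<sigma> ` \<sigma> ` complex_of_real ` L))"
      unfolding subfield_units_def by blast
    then show "w \<in> H"
    proof cases
      case 1
      then show ?thesis using units_k0_iff assms(4) by blast
    next
      case 2
      then show ?thesis using units_L_imp assms(5) by blast
    next
      case 3
      then show ?thesis using units_sigma_L_imp assms(6) by blast
    next
      case 4
      then show ?thesis using units_sigma_sigma_L_imp assms(7) by blast
    qed
  qed
qed

lemmas E0_1 = mult_subgroup_generated_subgroup(1)[where S = subfield_units, folded E0_def]
  and E0_mult = mult_subgroup_generated_subgroup(2)[where S = subfield_units, folded E0_def]
  and E0_inverse = mult_subgroup_generated_subgroup(3)[where S = subfield_units, folded E0_def]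
  and E0_base = mult_subgroup_generated_subgroup(4)[where S = subfield_units, folded E0_def]

lemma E0_k0: "w \<in> k0 \<Longrightarrow> w \<in> EK \<Longrightarrow> w \<in> E0"
  by (rule E0_base) (simp add: subfield_units_def units_k0_iff)

lemma E0_EL: "u \<in> EL \<Longrightarrow> complex_of_real u \<in> E0"
  by (rule E0_base) (simp add: subfield_units_def units_conjugates(1))

lemma E0_sigma_sigma: "u \<in> EL \<Longrightarrow> \<sigma> (\<sigma> (complex_of_real u)) \<in> E0"
  by (rule E0_base) (simp add: subfield_units_def units_conjugates(3))

lemma E0_powi: "x \<in> E0 \<Longrightarrow> x powi k \<in> E0"
proof -
  assume x: "x \<in> E0"
  have "y ^ n \<in> E0" if "y \<in> E0" for y n using that by (induction n) (auto intro: E0_1 E0_mult)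
  then show ?thesis using x E0_inverse by (cases "k \<ge> 0") (simp_all add: power_int_def)
qed

lemma E0_imp_hx: "w \<in> E0 \<Longrightarrow> w \<in> EK \<and> 3 dvd hx w"
proof -
  have "E0 \<subseteq> {w \<in> EK. 3 dvd hx w}"
    by (rule E0_least)
      (auto simp: EK_1 hx_k0 is_subfieldD(1)[OF k0_subfield] EK_mult hx_mult ring_units_inverse hx_inverse
        EK_of_real hx_EL EK_sigma hx_sigma_EL)
  then show "w \<in> E0 \<Longrightarrow> w \<in> EK \<and> 3 dvd hx w" by blast
qed

text \<open>Each equation is the one for the squared absolute value of a conjugate of w, carried
  back to w by a power of \<sigma>. The twisted conjugates of \<open>cnj\<close> w arise because
  complex conjugation inverts \<sigma>.\<close>

lemma cmod_sq_sigma: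
  assumes w: "w \<in> EK"
  shows "w * cnj w = complex_of_real \<epsilon> powi expo w"
    and "w * \<sigma> (\<sigma> (cnj w)) = \<sigma> (complex_of_real \<epsilon>) powi expo (\<sigma> (\<sigma> w))"
    and "w * \<sigma> (cnj w) = \<sigma> (\<sigma> (complex_of_real \<epsilon>)) powi expo (\<sigma> w)"
proof -
  have eK: "complex_of_real \<epsilon> \<in> EK" "complex_of_real \<epsilon> \<in> K" using EK_of_real[OF eps_EL] EK_in_K by auto
  have main: "t * cnj t = complex_of_real \<epsilon> powi expo t" if "t \<in> EK" for t
    using cmod_sq_expo[OF that] by (simp flip: complex_norm_square of_real_power_int)
  have spow: "\<sigma> (t powi k) = \<sigma> t powi k" if "t \<in> K" for t k
    using that is_subfieldD(5,9)[OF K_subfield] by (cases "k \<ge> 0") (simp_all add: power_int_def sigma_power sigma_inverse)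
  have wK: "w \<in> K" "cnj w \<in> K" using EK_in_K[OF w] cnj_K by auto
  show "w * cnj w = complex_of_real \<epsilon> powi expo w" by (rule main[OF w])
  have "\<sigma> (\<sigma> (\<sigma> w) * cnj (\<sigma> (\<sigma> w))) = \<sigma> (complex_of_real \<epsilon> powi expo (\<sigma> (\<sigma> w)))"
    by (simp only: main[OF EK_sigma[OF EK_sigma[OF w]]])
  then show "w * \<sigma> (\<sigma> (cnj w)) = \<sigma> (complex_of_real \<epsilon>) powi expo (\<sigma> (\<sigma> w))"
    using wK sigma_K eK by (simp add: spow cnj_sigma_sigma sigma_mult sigma_3)
  have "\<sigma> (\<sigma> (\<sigma> w * cnj (\<sigma> w))) = \<sigma> (\<sigma> (complex_of_real \<epsilon> powi expo (\<sigma> w)))"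
    by (simp only: main[OF EK_sigma[OF w]])
  then show "w * \<sigma> (cnj w) = \<sigma> (\<sigma> (complex_of_real \<epsilon>)) powi expo (\<sigma> w)"
    using wK sigma_K eK by (simp add: spow cnj_sigma sigma_mult sigma_3)
qed

text \<open>The product of the three equations of \<open>cmod_sq_sigma\<close> expresses w^3 times a
  unit of k0 by the conjugates of \<epsilon> with exponents p, q, r. They have sum 0, and q = r
  modulo 3, so all three agree modulo 3. As the conjugates of \<epsilon> have product 1, the common
  part drops out and a cube t^3 with t in \<open>E0\<close> remains. Then w / t has its cube in k0,
  and lies in k0 itself.\<close>

lemma hx_imp_E0:
  assumes w: "w \<in> EK" and h: "3 dvd hx w"
  shows "w \<in> E0"
proof -
  define e e1 e2 where "e = complex_of_real \<epsilon>" and "e1 = \<sigma> e" and "e2 = \<sigma> e1"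
  have eEK: "e \<in> EK" "e1 \<in> EK" "e2 \<in> EK" using EK_of_real[OF eps_EL] EK_sigma by (simp_all add: e_def e1_def e2_def)
  then have e0: "e \<noteq> 0" "e1 \<noteq> 0" "e2 \<noteq> 0" using EK_nonzero by auto
  have "nm \<epsilon> = 1" using norm_of_unit[OF eps_EL] nm_pos[of \<epsilon>] eps_EL eps_gt_1 by (auto simp: ring_units_iff OL_iff)
  then have prod: "e * e1 * e2 = 1"
    using rel_norm_L[of \<epsilon>] eps_EL by (simp add: rel_norm_def e_def e1_def e2_def ring_units_iff OL_iff)
  define p q r where "p = expo w" and "q = expo (\<sigma> (\<sigma> w))" and "r = expo (\<sigma> w)"
  have sum: "p + r + q = 0" using expo_sum[OF w] by (simp add: p_def q_def r_def)
  obtain j where j: "q - r = 3 * j" using h by (auto simp: hx_def q_def r_def)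
  define i where "i = j - q"
  have pi: "p = q + 3 * i" and rj: "r = q + 3 * (- j)" using sum j by (simp_all add: i_def)
  define t where "t = e powi i * e2 powi (- j)"
  have tE0: "t \<in> E0" unfolding t_def e_def e2_def e1_def by (intro E0_mult E0_powi E0_EL E0_sigma_sigma eps_EL)
  have tEK: "t \<in> EK" using E0_imp_hx[OF tE0] by blast
  then have t0: "t \<noteq> 0" by (rule EK_nonzero)
  define \<rho> where "\<rho> = rel_norm \<sigma> (cnj w)"
  have \<rho>: "\<rho> \<in> k0" "\<rho> \<noteq> 0"
    using rel_norm_k0 cnj_K EK_in_K[OF w] EK_nonzero[OF rel_norm_EK[OF EK_cnj[OF w]]] by (auto simp: \<rho>_def)
  have "w ^ 3 * \<rho> = (w * cnj w) * (w * \<sigma> (\<sigma> (cnj w))) * (w * \<sigma> (cnj w))"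
    unfolding \<rho>_def rel_norm_def by Groebner_Basis.algebra
  also have "\<dots> = e powi p * e1 powi q * e2 powi r"
    unfolding cmod_sq_sigma[OF w] by (simp add: e_def e1_def e2_def p_def q_def r_def)
  also have "\<dots> = (e * e1 * e2) powi q * (e powi i * e2 powi (- j)) ^ 3"
  proof -
    have "e powi p = e powi q * (e powi i) ^ 3" "e2 powi r = e2 powi q * (e2 powi (- j)) ^ 3"
      unfolding pi rj by (rule power_int_add_triple[OF e0(1)], rule power_int_add_triple[OF e0(3)])
    then show ?thesis by (simp add: power_int_mult_distrib power_mult_distrib mult_ac)
  qed
  also have "\<dots> = t ^ 3" by (simp add: prod t_def)
  finally have cube: "w ^ 3 * \<rho> = t ^ 3" .
  define y where "y = w * inverse t"
  have yEK: "y \<in> EK" unfolding y_def by (intro EK_mult ring_units_inverse w tEK)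
  have "y ^ 3 = inverse \<rho>"
    using cube t0 \<rho>(2) by (simp add: y_def power_mult_distrib power_inverse field_simps)
  then have "y ^ 3 \<in> k0" using \<rho>(1) is_subfieldD(5)[OF k0_subfield] by simp
  then have "y \<in> k0" by (rule unit_cube_in_k0[OF yEK])
  then have "y * t \<in> E0" using E0_mult[OF E0_k0 tE0] yEK by blast
  moreover have "y * t = w" using t0 by (simp add: y_def mult.assoc)
  ultimately show ?thesis by simp
qed

lemma E0_eq: "E0 = {w \<in> EK. 3 dvd hx w}"
  using E0_imp_hx hx_imp_E0 by blast

text \<open>As \<open>E0\<close> is the kernel of \<open>hx\<close> modulo 3, its cosets are the
  non-empty fibres of this map.\<close>

lemma unit_index_card: "subfield_unit_index d \<zeta> \<sigma> = card ((\<lambda>w. hx w mod 3) ` EK)"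
proof -
  define C where "C = (\<lambda>r. {w \<in> EK. hx w mod 3 = r})"
  have coset: "(*) g ` E0 = C (hx g mod 3)" if g: "g \<in> EK" for g
  proof
    show "(*) g ` E0 \<subseteq> C (hx g mod 3)"
    proof
      fix w assume "w \<in> (*) g ` E0"
      then obtain x where x: "x \<in> E0" "w = g * x" by (elim imageE)
      have x': "x \<in> EK" "3 dvd hx x" using x(1) by (auto simp: E0_eq)
      have "hx w mod 3 = hx g mod 3" unfolding x(2) hx_mult[OF g x'(1)] using x'(2) by presburger
      then show "w \<in> C (hx g mod 3)" using EK_mult[OF g x'(1)] x(2) by (simp add: C_def)
    qed
    show "C (hx g mod 3) \<subseteq> (*) g ` E0"
    proof
      fix w assume "w \<in> C (hx g mod 3)"
      then have w: "w \<in> EK" "hx w mod 3 = hx g mod 3" by (auto simp: C_def)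
      define x where "x = w * inverse g"
      have "x \<in> EK" unfolding x_def by (intro EK_mult ring_units_inverse w g)
      moreover have "hx x = hx w - hx g"
        unfolding x_def hx_mult[OF w(1) ring_units_inverse[OF g]] hx_inverse[OF g] by simp
      then have "3 dvd hx x" using w(2) by presburger
      ultimately have "x \<in> E0" by (simp add: E0_eq)
      moreover have "w = g * x" using EK_nonzero[OF g] by (simp add: x_def)
      ultimately show "w \<in> (*) g ` E0" by (rule rev_image_eqI)
    qed
  qed
  have "(\<lambda>g. (*) g ` E0) ` EK = C ` ((\<lambda>w. hx w mod 3) ` EK)"
    unfolding image_image using coset by (intro image_cong refl)
  moreover have "inj_on C ((\<lambda>w. hx w mod 3) ` EK)"
  proof (rule inj_onI)
    fix r r' assume r: "r \<in> (\<lambda>w. hx w mod 3) ` EK" and eq: "C r = C r'"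
    obtain w where "w \<in> EK" "r = hx w mod 3" using r by (elim imageE)
    then have "w \<in> C r" by (simp add: C_def)
    then have "w \<in> C r'" using eq by simp
    then show "r = r'" using \<open>w \<in> C r\<close> by (simp add: C_def)
  qed
  ultimately show ?thesis unfolding unit_index_eq mult_index_def by (simp add: card_image)
qed

text \<open>If \<open>hx\<close> w is not divisible by 3, then 1, w and w^2 represent all three
  residues.\<close>

lemma unit_index_cases:
  "subfield_unit_index d \<zeta> \<sigma> = (if \<forall>w\<in>EK. 3 dvd hx w then 1 else 3)"
proof (cases "\<forall>w\<in>EK. 3 dvd hx w")
  case True
  have "(\<lambda>w. hx w mod 3) ` EK = {0}"
  proof
    show "(\<lambda>w. hx w mod 3) ` EK \<subseteq> {0}" using True by auto
    show "{0} \<subseteq> (\<lambda>w. hx w mod 3) ` EK" using EK_1 True by (auto intro!: image_eqI[of _ _ 1])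
  qed
  then show ?thesis using True by (simp add: unit_index_card)
next
  case False
  then obtain w where w: "w \<in> EK" "\<not> 3 dvd hx w" by blast
  have ww: "w * w \<in> EK" "hx (w * w) = hx w + hx w" using w EK_mult hx_mult by auto
  have h1: "hx 1 = 0" by (rule hx_k0[OF is_subfieldD(1)[OF k0_subfield]])
  have "(\<lambda>w. hx w mod 3) ` EK = {0, 1, 2}"
  proof
    have "n mod 3 = 0 \<or> n mod 3 = 1 \<or> n mod 3 = 2" for n :: int by presburger
    then show "(\<lambda>w. hx w mod 3) ` EK \<subseteq> {0, 1, 2}" by auto
    have mem: "hx v mod 3 \<in> (\<lambda>w. hx w mod 3) ` EK" if "v \<in> EK" for v using that by (rule imageI)
    have "hx w mod 3 = 1 \<and> hx (w * w) mod 3 = 2 \<or> hx w mod 3 = 2 \<and> hx (w * w) mod 3 = 1"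
      using w(2) ww(2) by presburger
    then show "{0, 1, 2} \<subseteq> (\<lambda>w. hx w mod 3) ` EK"
      using mem[OF EK_1] mem[OF w(1)] mem[OF ww(1)] h1 by auto
  qed
  then show ?thesis using False by (simp add: unit_index_card)
qed

text \<open>The unit \<alpha>^3 / \<open>nm\<close> \<alpha> is \<epsilon>^i. If 3 divided i, then
  \<alpha> divided by a power of \<epsilon> would have a rational cube, be homogeneous, and \<alpha>
  would be trivial. The unit w below has \<open>hx\<close> w = 2 i.\<close>

lemma type_beta_imp_hx:
  assumes "type_beta d \<zeta> \<sigma>"
  shows "\<exists>w\<in>EK. \<not> 3 dvd hx w"
proof -
  obtain \<alpha> where pf: "principal_factor d \<zeta> \<sigma> \<alpha>" and triv: "\<alpha> \<notin> trivial_factors"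
    using assms unfolding type_beta_def nontrivial_iff by blast
  have amb: "ambiguous \<alpha>" using pf by (simp add: principal_factor_iff)
  have \<alpha>: "\<alpha> \<in> L" "\<alpha> \<noteq> 0" "\<alpha> ^ 3 / nm \<alpha> \<in> EL" using amb by (auto simp: ambiguous_def)
  have cp: "cp \<alpha> > 0" by (rule cp_pos[OF \<alpha>(1,2)])
  define e where "e = \<alpha> ^ 3 / nm \<alpha>"
  have e: "e = \<alpha>\<^sup>2 / cp \<alpha>" unfolding e_def by (rule nm_L_pos_part[OF \<alpha>(1,2)])
  have "0 < e" unfolding e using cp \<alpha>(2) by simp
  then obtain i where i: "e = \<epsilon> powi i" using EL_pos_power \<alpha>(3) unfolding e_def by blast
  have i3: "\<not> 3 dvd i"
  proof
    assume "3 dvd i"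
    then obtain k where k: "i = 3 * k" by blast
    define u where "u = \<epsilon> powi k"
    have uEL: "u \<in> EL" unfolding u_def by (rule EL_powi[OF eps_EL])
    then have u: "u \<in> L" "u \<noteq> 0" by (auto simp: ring_units_iff OL_iff)
    have "e = u ^ 3" using power_int_add_triple[of \<epsilon> 0 k] eps_gt_1 by (simp add: i k u_def)
    then have "(\<alpha> / u) ^ 3 = nm \<alpha>" using u \<alpha> nm_eq_0[OF \<alpha>(1)] unfolding e_def power_divide by (metis nonzero_divide_eq_eq nonzero_eq_divide_eq power_not_zero mult.commute)
    then have "homog (\<alpha> / u)"
      using cube_Rats_homog[OF is_subfieldD(8)[OF L_subfield \<alpha>(1) u(1)]] \<alpha>(2) u(2) nm_Rats[OF \<alpha>(1)] by simp
    then have "u * (\<alpha> / u) \<in> trivial_factors" by (rule trivial_factorsI[OF uEL])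
    then show False using triv u(2) by simp
  qed
  define c where "c = complex_of_real \<alpha>"
  have cK: "c \<in> K" "\<sigma> c \<in> K" "c \<noteq> 0" "\<sigma> c \<noteq> 0" "\<sigma> (\<sigma> c) \<in> K" "\<sigma> (\<sigma> c) \<noteq> 0"
    using \<alpha> L_subset_K sigma_K sigma_eq_0 by (auto simp: c_def)
  have q: "\<sigma> c / c \<in> EK" using ambiguous_iff[OF \<alpha>(1,2)] amb by (simp add: c_def)
  \<comment> \<open>This is the quotient of the two non-real conjugates of \<alpha>. Its own further
    conjugates have squared absolute values 1 / e and e.\<close>
  define w where "w = \<sigma> (inverse (\<sigma> c / c))"
  have w: "w \<in> EK" unfolding w_def by (intro EK_sigma ring_units_inverse q)
  have ww: "w = \<sigma> c / \<sigma> (\<sigma> c)" using cK by (simp add: w_def sigma_divide)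
  have "\<sigma> w = \<sigma> (\<sigma> c) / c" "\<sigma> (\<sigma> w) = c / \<sigma> c"
    using cK by (simp_all add: ww sigma_divide sigma_3)
  moreover have cm: "(cmod (\<sigma> c))\<^sup>2 = cp \<alpha>" "(cmod (\<sigma> (\<sigma> c)))\<^sup>2 = cp \<alpha>" "(cmod c)\<^sup>2 = \<alpha>\<^sup>2"
    using sigma_sigma_L[OF \<alpha>(1)] by (simp_all add: cp_def c_def)
  ultimately have "(cmod (\<sigma> (\<sigma> w)))\<^sup>2 = \<epsilon> powi i" "(cmod (\<sigma> w))\<^sup>2 = \<epsilon> powi (- i)"
    by (simp_all add: norm_divide power_divide power_int_minus e flip: i)
  then have "expo (\<sigma> (\<sigma> w)) = i" "expo (\<sigma> w) = - i" by (auto intro: expo_eq)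
  then have "hx w = 2 * i" by (simp add: hx_def)
  then have "\<not> 3 dvd hx w" using i3 by presburger
  then show ?thesis using w by blast
qed

lemma rel_norm_k0_unit: "w \<in> k0 \<Longrightarrow> w \<in> EK \<Longrightarrow> w ^ 3 = 1 \<or> w ^ 3 = -1"
  using k0_unit_cases[of w] zeta_cubed by (auto simp: power_mult_distrib power_minus_odd)

text \<open>On \<open>E0\<close> the relative norm only takes the values 1 and -1: it is the cube of
  a unit on k0, and the norm to the rationals on the conjugates of L. So \<zeta> is not the norm of
  an element of \<open>E0\<close>.\<close>

lemma norm_zeta_imp_hx:
  assumes w: "w \<in> EK" and norm: "rel_norm \<sigma> w = \<zeta>"
  shows "\<not> 3 dvd hx w"
proof
  assume "3 dvd hx w"
  then have "w \<in> E0" using w by (simp add: E0_eq)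
  moreover have "E0 \<subseteq> {t \<in> EK. (rel_norm \<sigma> t)\<^sup>2 = 1}"
  proof (rule E0_least)
    show "1 \<in> {t \<in> EK. (rel_norm \<sigma> t)\<^sup>2 = 1}" by (simp add: EK_1 rel_norm_def)
    show "x * y \<in> {t \<in> EK. (rel_norm \<sigma> t)\<^sup>2 = 1}"
      if "x \<in> {t \<in> EK. (rel_norm \<sigma> t)\<^sup>2 = 1}" "y \<in> {t \<in> EK. (rel_norm \<sigma> t)\<^sup>2 = 1}" for x y
      using that by (simp add: EK_mult rel_norm_mult EK_in_K power_mult_distrib)
    show "inverse x \<in> {t \<in> EK. (rel_norm \<sigma> t)\<^sup>2 = 1}" if x: "x \<in> {t \<in> EK. (rel_norm \<sigma> t)\<^sup>2 = 1}" for x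
    proof -
      have xK: "x \<in> K" "x \<in> EK" using x EK_in_K by auto
      have "rel_norm \<sigma> (inverse x) = inverse (rel_norm \<sigma> x)"
        unfolding rel_norm_def using xK sigma_K by (simp add: sigma_inverse)
      then show ?thesis using x xK by (simp add: ring_units_inverse power_inverse)
    qed
    show "x \<in> {t \<in> EK. (rel_norm \<sigma> t)\<^sup>2 = 1}" if "x \<in> k0" "x \<in> EK" for x
    proof -
      have "rel_norm \<sigma> x = x ^ 3" using that by (simp add: rel_norm_def sigma_k0 power3_eq_cube)
      then have "(rel_norm \<sigma> x)\<^sup>2 = 1" using rel_norm_k0_unit[OF that] by (metis power2_minus power_one)
      then show ?thesis using that by simp
    qed
    fix u assume u: "u \<in> EL"
    define t where "t = complex_of_real u"
    have t: "t \<in> EK" "t \<in> K" using EK_of_real[OF u] EK_in_K by (auto simp: t_def)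
    have uL: "u \<in> L" using u by (simp add: ring_units_iff OL_iff)
    have "(nm u)\<^sup>2 = 1" using norm_of_unit[OF u] by (metis power2_abs power_one)
    then have nt: "(rel_norm \<sigma> t)\<^sup>2 = 1" unfolding t_def rel_norm_L[OF uL] by (metis of_real_1 of_real_power)
    have conj: "rel_norm \<sigma> (\<sigma> t) = rel_norm \<sigma> t" "rel_norm \<sigma> (\<sigma> (\<sigma> t)) = rel_norm \<sigma> t"
      unfolding rel_norm_def using t sigma_K by (simp_all add: sigma_3 mult_ac)
    show "complex_of_real u \<in> {t \<in> EK. (rel_norm \<sigma> t)\<^sup>2 = 1}"
      and "\<sigma> (complex_of_real u) \<in> {t \<in> EK. (rel_norm \<sigma> t)\<^sup>2 = 1}"
      and "\<sigma> (\<sigma> (complex_of_real u)) \<in> {t \<in> EK. (rel_norm \<sigma> t)\<^sup>2 = 1}"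
      unfolding t_def[symmetric] using t nt conj EK_sigma by simp_all
  qed
  ultimately have "\<zeta>\<^sup>2 = 1" using norm by blast
  then have "\<zeta> ^ 3 = \<zeta>" by (simp add: power2_eq_square power3_eq_cube)
  then show False using zeta_cubed zeta_neq_1 by simp
qed

section \<open>Invariant elements from units of relative norm 1\<close>

lemma real_in_K_imp_L:
  assumes w: "w \<in> K" and real: "cnj w = w"
  obtains u where "u \<in> L" "w = complex_of_real u"
proof -
  obtain u v where uv: "w = complex_of_real u + complex_of_real v * \<zeta>" "u \<in> L" "v \<in> L"
    using w unfolding K_eq by (rule zeta_extE)
  have "Im w = 0" using real by (simp add: complex_eq_iff)
  then have "v = 0" using Im_zeta by (simp add: uv(1))
  then show thesis using that[of u] uv by simp
qed

text \<open>Hilbert's Theorem 90, with a resolvent that is real because \<open>w\<close> has absolute value 1.\<close>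

lemma hilbert_90_real:
  assumes w: "w \<in> EK" and norm: "rel_norm \<sigma> w = 1" and abs: "cmod w = 1"
  obtains \<alpha> where "\<alpha> \<in> L" "\<alpha> \<noteq> 0" "complex_of_real \<alpha> = \<sigma> (\<sigma> w) * \<sigma> (complex_of_real \<alpha>)"
proof -
  have wK: "w \<in> K" "w \<noteq> 0" "\<sigma> w \<in> K" "\<sigma> (\<sigma> w) \<in> K" "\<sigma> w \<noteq> 0"
    using EK_in_K EK_nonzero w EK_sigma by auto
  define y where "y = \<sigma> (\<sigma> w)"
  have y: "y \<in> K" "\<sigma> y = w" using wK by (simp_all add: y_def sigma_3)
  have nrm: "w * \<sigma> w * y = 1" using norm by (simp add: rel_norm_def y_def)
  have cw: "cnj w = inverse w"
  proof -
    have "w * cnj w = 1" by (simp add: abs flip: complex_norm_square)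
    then show ?thesis by (metis inverse_unique)
  qed
  have yw: "y * w = inverse (\<sigma> w)" using nrm by (metis inverse_unique mult.assoc mult.commute)
  \<comment> \<open>Complex conjugation exchanges y and y w, hence also the last two terms of the
    resolvent at a real number; this makes the resolvent real.\<close>
  have cy: "cnj y = y * w"
    unfolding yw unfolding y_def cnj_sigma_sigma[OF wK(1)] cw by (rule sigma_inverse[OF wK(1)])
  have cyw: "cnj (y * w) = y" unfolding cy[symmetric] by simp
  \<comment> \<open>The resolvent with coefficients 1, y and y \<sigma>(y), the last being y w; it
    satisfies f(c) = y \<sigma>(f(c)).\<close>
  define f where "f = (\<lambda>c. complex_of_real c + y * \<sigma> (complex_of_real c) + y * w * \<sigma> (\<sigma> (complex_of_real c)))"
  have good: "\<exists>\<alpha>\<in>L. \<alpha> \<noteq> 0 \<and> complex_of_real \<alpha> = \<sigma> (\<sigma> w) * \<sigma> (complex_of_real \<alpha>)"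
    if c: "c \<in> L" "f c \<noteq> 0" for c
  proof -
    define k where "k = complex_of_real c"
    have k: "k \<in> K" "\<sigma> k \<in> K" "\<sigma> (\<sigma> k) \<in> K" "cnj k = k" using L_subset_K[OF c(1)] sigma_K by (auto simp: k_def)
    have fk: "f c = k + y * \<sigma> k + y * w * \<sigma> (\<sigma> k)" by (simp add: f_def k_def)
    have fK: "f c \<in> K" unfolding fk by (intro is_subfieldD(4,7)[OF K_subfield] y k wK)
    have cs: "cnj (\<sigma> k) = \<sigma> (\<sigma> k)" "cnj (\<sigma> (\<sigma> k)) = \<sigma> k"
      using k by (simp_all add: cnj_sigma cnj_sigma_sigma sigma_3)
    have "cnj (f c) = cnj k + cnj y * cnj (\<sigma> k) + cnj (y * w) * cnj (\<sigma> (\<sigma> k))" by (simp add: fk)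
    also have "\<dots> = k + y * w * \<sigma> (\<sigma> k) + y * \<sigma> k" unfolding cy cyw cs k(4) ..
    also have "\<dots> = f c" by (simp add: fk)
    finally have "cnj (f c) = f c" .
    then obtain \<alpha> where \<alpha>: "\<alpha> \<in> L" "f c = complex_of_real \<alpha>" using real_in_K_imp_L[OF fK] by blast
    have "\<sigma> (f c) = \<sigma> k + w * \<sigma> (\<sigma> k) + w * \<sigma> w * k"
      unfolding fk using k y wK is_subfieldD(4,7)[OF K_subfield] by (simp add: sigma_add sigma_mult sigma_3)
    then have "y * \<sigma> (f c) = y * \<sigma> k + y * w * \<sigma> (\<sigma> k) + (w * \<sigma> w * y) * k" by (simp add: algebra_simps)
    also have "\<dots> = f c" unfolding nrm by (simp add: fk)
    finally have "f c = y * \<sigma> (f c)" ..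
    then have "complex_of_real \<alpha> = \<sigma> (\<sigma> w) * \<sigma> (complex_of_real \<alpha>)" unfolding \<alpha>(2) y_def .
    moreover have "\<alpha> \<noteq> 0" using c(2) \<alpha>(2) by auto
    ultimately show ?thesis using \<alpha>(1) by blast
  qed
  show thesis
  proof (cases "f 1 = 0 \<and> f D = 0 \<and> f E = 0")
    case False
    then show thesis using that good is_subfieldD(1)[OF L_subfield] D_in_L E_in_L by blast
  next
    \<comment> \<open>The resolvent cannot vanish on the whole basis: the three equations, freed of
      \<open>D\<close> and \<open>E\<close>, add up to 3 = 0.\<close>
    case True
    have f1: "1 + y + y * w = 0" using True by (simp add: f_def)
    have zz: "\<sigma> (\<zeta> * complex_of_real D) = \<zeta> * \<zeta> * complex_of_real D"
      using k0_subset_K L_subset_K D_in_L by (simp add: sigma_mult sigma_D)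
    have zE: "\<sigma> (\<zeta> * \<zeta> * complex_of_real E) = \<zeta> * complex_of_real E"
    proof -
      have "\<sigma> (\<zeta> * \<zeta> * complex_of_real E) = \<zeta> * \<zeta> * (\<zeta> * \<zeta> * complex_of_real E)"
        using L_subset_K E_in_L is_subfieldD(4)[OF K_subfield] by (simp add: sigma_mult sigma_E)
      also have "\<dots> = \<zeta> * complex_of_real E" using zeta_cubed by Groebner_Basis.algebra
      finally show ?thesis .
    qed
    have "complex_of_real D * (1 + y * \<zeta> + y * w * (\<zeta> * \<zeta>)) = 0"
      using True unfolding f_def sigma_D zz by (simp add: algebra_simps)
    then have fD: "1 + y * \<zeta> + y * w * (\<zeta> * \<zeta>) = 0" using D_gt_1 by simp
    have "complex_of_real E * (1 + y * (\<zeta> * \<zeta>) + y * w * \<zeta>) = 0"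
      using True unfolding f_def sigma_E zE by (simp add: algebra_simps)
    then have fE: "1 + y * (\<zeta> * \<zeta>) + y * w * \<zeta> = 0" using E_gt_1 by simp
    have "(3 :: complex) = (1 + y + y * w) + (1 + y * \<zeta> + y * w * (\<zeta> * \<zeta>)) + (1 + y * (\<zeta> * \<zeta>) + y * w * \<zeta>)"
      using zeta_zeta by Groebner_Basis.algebra
    then show thesis unfolding f1 fD fE by simp
  qed
qed

lemma hx_imp_type_beta:
  assumes w: "w \<in> EK" and hx: "\<not> 3 dvd hx w" and norm: "rel_norm \<sigma> w = 1" and abs: "cmod w = 1"
  shows "type_beta d \<zeta> \<sigma>"
proof -
  obtain \<alpha> where \<alpha>: "\<alpha> \<in> L" "\<alpha> \<noteq> 0" and eq: "complex_of_real \<alpha> = \<sigma> (\<sigma> w) * \<sigma> (complex_of_real \<alpha>)"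
    by (rule hilbert_90_real[OF w norm abs])
  define c where "c = complex_of_real \<alpha>"
  have cK: "c \<in> K" "c \<noteq> 0" "\<sigma> c \<noteq> 0" "\<sigma> c \<in> K" "\<sigma> (\<sigma> c) \<noteq> 0" "\<sigma> (\<sigma> c) \<in> K"
    using \<alpha> L_subset_K sigma_eq_0 sigma_K by (auto simp: c_def)
  have yE: "\<sigma> (\<sigma> w) \<in> EK" by (intro EK_sigma w)
  have y0: "\<sigma> (\<sigma> w) \<noteq> 0" by (rule EK_nonzero[OF yE])
  have y_eq: "\<sigma> (\<sigma> w) = c / \<sigma> c" using eq cK by (simp add: c_def[symmetric] field_simps)
  have "\<sigma> c / c = inverse (\<sigma> (\<sigma> w))" by (simp add: y_eq)
  then have amb: "ambiguous \<alpha>" using ambiguous_iff[OF \<alpha>] ring_units_inverse[OF yE] by (simp add: c_def)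
  have "\<alpha> \<notin> trivial_factors"
  proof
    assume "\<alpha> \<in> trivial_factors"
    then obtain u s where us: "\<alpha> = u * s" "u \<in> EL" "homog s" unfolding trivial_factors_eq by blast
    obtain r e where re: "s = r * e" "r \<in> \<rat>" "r \<noteq> 0" "e \<in> {1, D, E}" using us(3) by (rule homogE)
    define t where "t = complex_of_real u"
    have t: "t \<in> EK" "t \<in> K" "t \<noteq> 0" "\<sigma> t \<in> EK" "\<sigma> t \<in> K" "\<sigma> t \<noteq> 0" "\<sigma> (\<sigma> t) \<in> EK"
      using EK_of_real[OF us(2)] EK_in_K EK_nonzero EK_sigma by (auto simp: t_def)
    obtain z where z: "z \<in> {1, \<zeta>, \<zeta> * \<zeta>}" "\<sigma> (complex_of_real s) = z * complex_of_real s"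
    proof -
      have r: "complex_of_real r \<in> k0" using re(2) Rats_in_k0 of_real_Rats by blast
      have eL: "e \<in> L" using re(4) is_subfieldD(1)[OF L_subfield] D_in_L E_in_L by auto
      have "\<sigma> (complex_of_real s) = complex_of_real r * \<sigma> (complex_of_real e)"
        unfolding re(1) of_real_mult using r eL by (simp add: sigma_mult k0_subset_K L_subset_K sigma_k0)
      moreover have "\<exists>z\<in>{1, \<zeta>, \<zeta> * \<zeta>}. \<sigma> (complex_of_real e) = z * complex_of_real e"
        using re(4) sigma_D sigma_E by auto
      then obtain z where "z \<in> {1, \<zeta>, \<zeta> * \<zeta>}" and "\<sigma> (complex_of_real e) = z * complex_of_real e"
        by (rule bexE)
      ultimately have "\<sigma> (complex_of_real s) = z * complex_of_real s" by (simp add: re(1))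
      then show thesis using that \<open>z \<in> {1, \<zeta>, \<zeta> * \<zeta>}\<close> by blast
    qed
    have s0: "complex_of_real s \<noteq> 0" using homog_nonzero[OF us(3)] by simp
    have zk: "z \<in> k0" using z(1) is_subfieldD(1,4)[OF k0_subfield] zeta_in_k0 by auto
    have z0: "z \<noteq> 0" using z(1) zeta_neq_0 by auto
    have zE: "z \<in> EK"
    proof -
      have "\<zeta> \<in> EK"
        using zeta_alg_int algebraic_int_mult[OF zeta_alg_int zeta_alg_int] inverse_unique[OF zeta_3]
          is_subfieldD(5)[OF K_subfield zeta_in_K] zeta_neq_0
        by (simp add: ring_units_iff OK_iff)
      then show ?thesis using z(1) EK_mult EK_1 by auto
    qed
    have sK: "complex_of_real s \<in> K" using homog_in_L[OF us(3)] L_subset_K by blast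
    have "c = t * complex_of_real s" by (simp add: c_def us(1) t_def)
    moreover have "\<sigma> c = \<sigma> t * (z * complex_of_real s)"
      unfolding calculation using t sK z(2) by (simp add: sigma_mult)
    ultimately have y2: "\<sigma> (\<sigma> w) = t * inverse (\<sigma> t) * inverse z"
      using y_eq s0 z0 t by (simp add: field_simps)
    have "w = \<sigma> (\<sigma> (\<sigma> w))" using sigma_3[OF EK_in_K[OF w]] ..
    also have "\<dots> = \<sigma> t * inverse (\<sigma> (\<sigma> t)) * inverse z"
      unfolding y2 using t zk is_subfieldD(4,5)[OF K_subfield] k0_subset_K
      by (simp add: sigma_mult sigma_inverse sigma_k0)
    finally have w_eq: "w = \<sigma> t * inverse (\<sigma> (\<sigma> t)) * inverse z" .
    have "hx w = hx (\<sigma> t) - hx (\<sigma> (\<sigma> t)) - hx z"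
      unfolding w_eq
      using t zE by (simp add: hx_mult EK_mult ring_units_inverse hx_inverse)
    moreover have "hx z = 0" by (rule hx_k0[OF zk])
    moreover have "3 dvd hx (\<sigma> t)" "3 dvd hx (\<sigma> (\<sigma> t))" using hx_sigma_EL[OF us(2)] by (simp_all add: t_def)
    ultimately have "3 dvd hx w" by presburger
    then show False using hx by blast
  qed
  then show ?thesis using ambiguous_imp_type_beta[OF amb] by blast
qed

text \<open>Squaring removes the sign of the relative norm without making \<open>hx\<close>
  divisible by 3, and leaves the norms 1, \<zeta> and \<zeta>^2. A second squaring reduces \<zeta>^2
  to \<zeta>. Norm 1 leads to type \<beta> once the absolute value is adjusted to 1.\<close>

lemma hx_imp_type_beta_or_norm_zeta:
  assumes w: "w \<in> EK" and hx: "\<not> 3 dvd hx w"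
  shows "type_beta d \<zeta> \<sigma> \<or> (\<exists>z\<in>EK. rel_norm \<sigma> z = \<zeta>)"
proof -
  define v where "v = w * w"
  have v: "v \<in> EK" "v \<in> K" unfolding v_def using EK_mult[OF w w] EK_in_K by auto
  have hv: "\<not> 3 dvd hx v" unfolding v_def hx_mult[OF w w] using hx by presburger
  have nv: "rel_norm \<sigma> v = rel_norm \<sigma> w * rel_norm \<sigma> w" unfolding v_def using EK_in_K[OF w] by (rule rel_norm_mult) fact
  have "rel_norm \<sigma> w \<in> {1, -1, \<zeta>, - \<zeta>, \<zeta> * \<zeta>, - (\<zeta> * \<zeta>)}"
    by (rule k0_unit_cases[OF rel_norm_k0[OF EK_in_K[OF w]] rel_norm_EK[OF w]])
  moreover have "\<zeta> * \<zeta> * (\<zeta> * \<zeta>) = \<zeta>" using zeta_cubed by Groebner_Basis.algebra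
  ultimately have "rel_norm \<sigma> v = 1 \<or> rel_norm \<sigma> v = \<zeta> \<or> rel_norm \<sigma> v = \<zeta> * \<zeta>" unfolding nv by auto
  then show ?thesis
  proof (elim disjE)
    assume "rel_norm \<sigma> v = \<zeta>"
    then show ?thesis using v by blast
  next
    assume n: "rel_norm \<sigma> v = \<zeta> * \<zeta>"
    have "rel_norm \<sigma> (v * v) = \<zeta> * \<zeta> * (\<zeta> * \<zeta>)" using v(2) n by (simp add: rel_norm_mult)
    also have "\<dots> = \<zeta>" using zeta_cubed by Groebner_Basis.algebra
    finally show ?thesis using EK_mult[OF v(1) v(1)] by blast
  next
    assume n: "rel_norm \<sigma> v = 1"
    define t where "t = \<sigma> (complex_of_real \<epsilon>)"
    \<comment> \<open>The squared absolute value of t is 1 / \<epsilon>, so the factor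
      \<open>t powi p\<close> brings v to absolute value 1; it has relative norm 1 and
      \<open>hx\<close> divisible by 3.\<close>
    define p where "p = expo v"
    define x where "x = v * t powi p"
    have \<epsilon>L: "\<epsilon> \<in> L" using eps_EL by (simp add: ring_units_iff OL_iff)
    have nm: "nm \<epsilon> = 1" using norm_of_unit[OF eps_EL] nm_pos[OF \<epsilon>L] eps_gt_1 by auto
    have t: "t \<in> EK" unfolding t_def by (intro EK_sigma EK_of_real eps_EL)
    have tp: "t powi p \<in> EK" by (rule EK_powi[OF t])
    have x: "x \<in> EK" unfolding x_def by (rule EK_mult[OF v(1) tp])
    have powi: "P (t powi p)" if "\<And>a b. a \<in> EK \<Longrightarrow> b \<in> EK \<Longrightarrow> P a \<Longrightarrow> P b \<Longrightarrow> P (a * b)"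
        "\<And>a. a \<in> EK \<Longrightarrow> P a \<Longrightarrow> P (inverse a)" "P 1" "P t" for P
    proof -
      have "P (a ^ n)" if "a \<in> EK" "P a" for a n
        using that \<open>P 1\<close> \<open>\<And>a b. a \<in> EK \<Longrightarrow> b \<in> EK \<Longrightarrow> P a \<Longrightarrow> P b \<Longrightarrow> P (a * b)\<close>
        by (induction n) (auto simp: EK_power)
      then show ?thesis using that(2,4) t ring_units_inverse[OF t] by (cases "p \<ge> 0") (simp_all add: power_int_def)
    qed
    have rn_t: "rel_norm \<sigma> (t powi p) = 1"
    proof (rule powi)
      show "rel_norm \<sigma> (a * b) = 1" if "a \<in> EK" "b \<in> EK" "rel_norm \<sigma> a = 1" "rel_norm \<sigma> b = 1" for a b
        using that EK_in_K by (simp add: rel_norm_mult)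
      show "rel_norm \<sigma> (inverse a) = 1" if a: "a \<in> EK" "rel_norm \<sigma> a = 1" for a
      proof -
        have "rel_norm \<sigma> (a * inverse a) = rel_norm \<sigma> a * rel_norm \<sigma> (inverse a)"
          using a EK_in_K ring_units_inverse by (intro rel_norm_mult) auto
        moreover have "rel_norm \<sigma> (a * inverse a) = 1" using EK_nonzero[OF a(1)] by (simp add: rel_norm_def)
        ultimately show ?thesis using a(2) by simp
      qed
      show "rel_norm \<sigma> 1 = 1" by (simp add: rel_norm_def)
      show "rel_norm \<sigma> t = 1"
        using rel_norm_L[OF \<epsilon>L] nm sigma_3[OF L_subset_K[OF \<epsilon>L]] by (simp add: rel_norm_def t_def mult_ac)
    qed
    have hx_t: "3 dvd hx (t powi p)"
    proof (rule powi)
      show "3 dvd hx (a * b)" if "a \<in> EK" "b \<in> EK" "3 dvd hx a" "3 dvd hx b" for a b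
        using that by (simp add: hx_mult)
      show "3 dvd hx (inverse a)" if "a \<in> EK" "3 dvd hx a" for a using that by (simp add: hx_inverse)
      show "3 dvd hx 1" using hx_k0[OF is_subfieldD(1)[OF k0_subfield]] by simp
      show "3 dvd hx t" unfolding t_def by (rule hx_sigma_EL(1)[OF eps_EL])
    qed
    have "hx x = hx v + hx (t powi p)" unfolding x_def by (rule hx_mult[OF v(1) tp])
    then have hxx: "\<not> 3 dvd hx x" using hv hx_t by presburger
    have nx: "rel_norm \<sigma> x = 1"
      unfolding x_def using rel_norm_mult[OF v(2) EK_in_K[OF tp]] n rn_t by simp
    have "(cmod t)\<^sup>2 = inverse \<epsilon>" using nm unfolding nm_def cp_def t_def by (simp add: inverse_unique)
    then have "(cmod (t powi p))\<^sup>2 = (inverse \<epsilon>) powi p"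
      by (simp add: norm_power_int power2_eq_square power_int_mult_distrib[symmetric])
    then have "(cmod x)\<^sup>2 = \<epsilon> powi p * (inverse \<epsilon>) powi p"
      unfolding x_def norm_mult power_mult_distrib p_def by (simp add: cmod_sq_expo[OF v(1)])
    also have "\<dots> = 1" using eps_gt_1 by (simp add: power_int_mult_distrib[symmetric])
    finally have "(cmod x)\<^sup>2 = 1\<^sup>2" by simp
    then have "cmod x = 1" by (rule power_eq_imp_eq_base) auto
    then show ?thesis using hx_imp_type_beta[OF x hxx nx] by blast
  qed
qed

lemma unit_index_iff:
  "subfield_unit_index d \<zeta> \<sigma> = 1 \<longleftrightarrow> \<not> type_beta d \<zeta> \<sigma> \<and> \<not> (\<exists>z\<in>EK. rel_norm \<sigma> z = \<zeta>)"
  and unit_index_1_or_3: "subfield_unit_index d \<zeta> \<sigma> = 1 \<or> subfield_unit_index d \<zeta> \<sigma> = 3"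
  using type_beta_imp_hx norm_zeta_imp_hx hx_imp_type_beta_or_norm_zeta unfolding unit_index_cases by auto

end

theorem theorem6p1:
  fixes d a b R Q l :: nat and \<zeta> :: complex and \<sigma> :: "complex \<Rightarrow> complex"
    and \<theta> :: "int \<Rightarrow> real"
  assumes "d \<ge> 2" and "cubefree d" and "d = a * b\<^sup>2" and "a > b" and "b \<ge> 1"
    and "squarefree a" and "squarefree b" and "coprime a b"
    and "\<zeta> ^ 3 = 1" and "\<zeta> \<noteq> 1"
    and "\<sigma> \<in> galois_group (normal_closure d \<zeta>) (cyclotomic3 \<zeta>)"
    and "\<sigma> (complex_of_real (delta d)) = \<zeta> * complex_of_real (delta d)"
    and "R = ram_invariant d a b"
    and "Q = subfield_unit_index d \<zeta> \<sigma>"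
    and "chain_of_minima \<sigma> (maximal_order (pure_cubic d)) \<theta>"
    and "primitive_period_length (maximal_order (pure_cubic d)) \<theta> l"
  shows
    "(d mod 9 \<in> {0, 3, 6} \<longrightarrow>
        (type_alpha d \<zeta> \<sigma> \<longleftrightarrow> Q = 1) \<and>
        (type_beta d \<zeta> \<sigma> \<longleftrightarrow> (\<exists>j\<in>{1..int l - 1}. norm_dvd \<sigma> (\<theta> j) (int R ^ 2))) \<and>
        (type_gamma d \<zeta> \<sigma> \<longleftrightarrow>
           (\<forall>j\<in>{1..int l - 1}. \<not> norm_dvd \<sigma> (\<theta> j) (int R ^ 2)) \<and> Q = 3)) \<and>
     (d mod 9 \<in> {2, 4, 5, 7} \<longrightarrow>
        (type_alpha d \<zeta> \<sigma> \<longleftrightarrow> Q = 1) \<and>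
        (type_beta d \<zeta> \<sigma> \<longleftrightarrow>
           (\<exists>j\<in>{1..int l - 1}. norm_dvd \<sigma> (\<theta> j) (int R ^ 2)) \<or> Q = 3) \<and>
        \<not> type_gamma d \<zeta> \<sigma>) \<and>
     (d mod 9 \<in> {1, 8} \<longrightarrow>
        (type_alpha d \<zeta> \<sigma> \<longleftrightarrow> Q = 1) \<and>
        (\<forall>(\<phi> :: int \<Rightarrow> real) l0.
           chain_of_minima \<sigma> (order0 d a b) \<phi> \<and>
           primitive_period_length (order0 d a b) \<phi> l0 \<longrightarrow>
           (type_beta d \<zeta> \<sigma> \<longleftrightarrow> (\<exists>j\<in>{1..int l0 - 1}. norm_dvd \<sigma> (\<phi> j) (int R ^ 2))) \<and>
           (type_gamma d \<zeta> \<sigma> \<longleftrightarrow>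
              (\<forall>j\<in>{1..int l0 - 1}. \<not> norm_dvd \<sigma> (\<phi> j) (int R ^ 2)) \<and> Q = 3)))"
proof -
  note per = \<open>primitive_period_length (maximal_order (pure_cubic d)) \<theta> l\<close>
  note chain = \<open>chain_of_minima \<sigma> (maximal_order (pure_cubic d)) \<theta>\<close>
  interpret pure_cubic_units d a b \<zeta> \<sigma> "\<theta> (int l)"
    by unfold_locales (use assms in \<open>simp_all add: primitive_period_length_def\<close>)
  note R = \<open>R = ram_invariant d a b\<close> and Q = \<open>Q = subfield_unit_index d \<zeta> \<sigma>\<close>
  have alpha: "type_alpha d \<zeta> \<sigma> \<longleftrightarrow> Q = 1"
    unfolding Q unit_index_iff type_alpha_def type_gamma_def by blast
  have gamma: "type_gamma d \<zeta> \<sigma> \<longleftrightarrow> \<not> type_beta d \<zeta> \<sigma> \<and> Q = 3"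
    using unit_index_iff unit_index_1_or_3 unfolding Q type_gamma_def by auto
  have beta: "type_beta d \<zeta> \<sigma> \<longleftrightarrow> (\<exists>j\<in>{1..int l' - 1}. norm_dvd \<sigma> (\<phi> j) (int R ^ 2))"
    if "d mod 9 \<in> {0, 3, 6, 1, 8}" "chain_of_minima \<sigma> O0 \<phi>" "primitive_period_length O0 \<phi> l'" for \<phi> l'
    unfolding R using type_beta_imp_chain[OF that(2,3) _ that(1)] chain_imp_type_beta[OF that(2,3)] by blast
  have case1: "(type_beta d \<zeta> \<sigma> \<longleftrightarrow> (\<exists>j\<in>{1..int l - 1}. norm_dvd \<sigma> (\<theta> j) (int R ^ 2)))" if d9: "d mod 9 \<in> {0, 3, 6}"
  proof -
    have OL_eq: "OL = O0" by (rule OL_eq_O0) (use d9 in auto)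
    show ?thesis by (rule beta[OF _ chain[unfolded OL_eq] per[unfolded OL_eq]]) (use d9 in auto)
  qed
  have case2: "(type_beta d \<zeta> \<sigma> \<longleftrightarrow> (\<exists>j\<in>{1..int l - 1}. norm_dvd \<sigma> (\<theta> j) (int R ^ 2)) \<or> Q = 3) \<and>
      \<not> type_gamma d \<zeta> \<sigma>" if d9: "d mod 9 \<in> {2, 4, 5, 7}"
  proof -
    have OL_eq: "OL = O0" by (rule OL_eq_O0) (use d9 in auto)
    have no: "\<not> (\<exists>z\<in>EK. rel_norm \<sigma> z = \<zeta>)"
      using no_norm_zeta[OF d9] by (auto simp: ring_units_iff)
    \<comment> \<open>Without units of norm \<zeta>, index 3 can only stem from type \<beta>; the
      chain contributes a sufficient condition.\<close>
    then have "type_beta d \<zeta> \<sigma> \<longleftrightarrow> Q = 3" using unit_index_iff unit_index_1_or_3 unfolding Q by auto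
    moreover have "type_beta d \<zeta> \<sigma>" if "j \<in> {1..int l - 1}" "norm_dvd \<sigma> (\<theta> j) (int R ^ 2)" for j
      by (rule chain_imp_type_beta[OF chain[unfolded OL_eq] per[unfolded OL_eq] that[unfolded R]])
    ultimately show ?thesis using no unfolding type_gamma_def by blast
  qed
  have case3: "(type_beta d \<zeta> \<sigma> \<longleftrightarrow> (\<exists>j\<in>{1..int l0 - 1}. norm_dvd \<sigma> (\<phi> j) (int R ^ 2)))"
    if "d mod 9 \<in> {1, 8}" "chain_of_minima \<sigma> O0 \<phi>" "primitive_period_length O0 \<phi> l0" for \<phi> l0
    by (rule beta[OF _ that(2,3)]) (use that(1) in auto)
  have case3': "(type_beta d \<zeta> \<sigma> \<longleftrightarrow> (\<exists>j\<in>{1..int l0 - 1}. norm_dvd \<sigma> (\<phi> j) (int R ^ 2))) \<and>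
      (type_gamma d \<zeta> \<sigma> \<longleftrightarrow> (\<forall>j\<in>{1..int l0 - 1}. \<not> norm_dvd \<sigma> (\<phi> j) (int R ^ 2)) \<and> Q = 3)"
    if "d mod 9 \<in> {1, 8}" "chain_of_minima \<sigma> O0 \<phi> \<and> primitive_period_length O0 \<phi> l0" for \<phi> l0
    using case3[OF that(1) conjunct1[OF that(2)] conjunct2[OF that(2)]] gamma by blast
  have case1': "type_gamma d \<zeta> \<sigma> \<longleftrightarrow>
      (\<forall>j\<in>{1..int l - 1}. \<not> norm_dvd \<sigma> (\<theta> j) (int R ^ 2)) \<and> Q = 3" if "d mod 9 \<in> {0, 3, 6}"
    using case1[OF that] gamma by blast
  show ?thesis
    by (intro conjI impI allI alpha case1 case1' conjunct1[OF case2] conjunct2[OF case2]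
      conjunct1[OF case3'] conjunct2[OF case3']) blast+
qed

end
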